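(* Let $\mathcal P$ be a Poisson point process of intensity $1$ on $\mathbb{R}_+^2$, with associated process $W=\{W(c)=(U(c),V(c)):c>0\}$ of vertices of its left-lower convex hull. For $0<a<b$, let $N(a,b)$ be the number of jumps of the process $W$ in the interval $[a,b]$, and let $D(a,b)$ be the area of the union of the triangles $T_i$ corresponding to the jump times $a_i\in[a,b]$ (as defined in the context). Then, as $b/a\to\infty$, $$\left(\tfrac{5}{27}\log(b/a)\right)^{-1/2}\left(N(a,b)-\tfrac13\log(b/a),\ D(a,b)-\tfrac13\log(b/a)\right)\stackrel{\mathcal D}{\longrightarrow}N(0,\Sigma),$$ where $N(0,\Sigma)$ is the bivariate normal distribution with expectation $0$ and covariance matrix $$\Sigma=\begin{pmatrix}1&1\\ 1&\tfrac{14}{5}\end{pmatrix}.$$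
   Context: $\mathcal P$ is the Poisson point process with intensity $1$ (with respect to Lebesgue measure) on the first quadrant $\mathbb{R}_+^2$. For each $c>0$, $W(c)=(U(c),V(c))$ is the point of the realization of $\mathcal P$ such that all points of the realization lie (weakly) to the right of the line of the form $x+cy=k$ which passes through $W(c)$. If there are several such points (which has probability zero for fixed $c$), $U(c)$ is defined as the supremum of the $x$-coordinates, and $V(c)$ as the infimum of the $y$-coordinates, of points of this type. Thus $c\mapsto W(c)$ is a pure jump process running through the vertices of the left-lower convex hull of $\mathcal P$. Triangles: given $a>0$, put $a_0=a$ and let $a_1<a_2<\dots$ be the successive jump times of $\{W(c):c\ge a\}$. For $i\ge1$, $T_i$ is the triangle with top at $W(a_{i-1})$, base along the $x$-axis, and other two sides along the lines $x+a_{i-1}y=U(a_{i-1})+a_{i-1}V(a_{i-1})$ and $x+a_iy=U(a_i)+a_iV(a_i)$. The triangles entering $D(a,b)$ are the $T_i$, $i\ge1$, with $a_i\le b$. The symbol $\stackrel{\mathcal D}{\longrightarrow}$ denotes convergence in distribution. *)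

theory Defs
  imports "HOL-Probability.Probability"
begin

(* The points of a realization are a set: a Poisson process whose intensity is Lebesgue
   measure has no multiple points. The probabilities in the third clause are
   pmf (poisson_pmf r) k, written out because poisson_pmf excludes the rate r = 0. *)
definition unit_poisson_process ::
  "'w measure \<Rightarrow> 'a::euclidean_space set \<Rightarrow> ('w \<Rightarrow> 'a set) \<Rightarrow> bool" where
  "unit_poisson_process M S P \<longleftrightarrow>
     (\<forall>\<omega>\<in>space M. P \<omega> \<subseteq> S \<and> (\<forall>A. bounded A \<longrightarrow> finite (P \<omega> \<inter> A))) \<and>
     (\<forall>A\<in>sets borel. bounded A \<longrightarrow>
        (\<lambda>\<omega>. card (P \<omega> \<inter> A)) \<in> measurable M (count_space UNIV)) \<and>
     (\<forall>A\<in>sets borel. bounded A \<and> A \<subseteq> S \<longrightarrow>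
        (\<forall>k. measure M {\<omega>\<in>space M. card (P \<omega> \<inter> A) = k} =
               measure lborel A ^ k / fact k * exp (- measure lborel A))) \<and>
     (\<forall>(I::nat set) A. finite I \<and> disjoint_family_on A I \<and>
        (\<forall>i\<in>I. A i \<in> sets borel \<and> bounded (A i) \<and> A i \<subseteq> S) \<longrightarrow>
        prob_space.indep_vars M (\<lambda>_. count_space UNIV) (\<lambda>i \<omega>. card (P \<omega> \<inter> A i)) I)"

definition first_quadrant :: "(real \<times> real) set" where
  "first_quadrant = {(x, y). 0 \<le> x \<and> 0 \<le> y}"

definition support_points :: "(real \<times> real) set \<Rightarrow> real \<Rightarrow> (real \<times> real) set" where
  "support_points S c = {p\<in>S. \<forall>q\<in>S. fst p + c * snd p \<le> fst q + c * snd q}"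

definition hull_U :: "(real \<times> real) set \<Rightarrow> real \<Rightarrow> real" where
  "hull_U S c = Sup (fst ` support_points S c)"

definition hull_V :: "(real \<times> real) set \<Rightarrow> real \<Rightarrow> real" where
  "hull_V S c = Inf (snd ` support_points S c)"

definition hull_W :: "(real \<times> real) set \<Rightarrow> real \<Rightarrow> real \<times> real" where
  "hull_W S c = (hull_U S c, hull_V S c)"

definition jump_times :: "(real \<times> real) set \<Rightarrow> real set" where
  "jump_times S = {c. 0 < c \<and> \<not> isCont (hull_W S) c}"

definition num_jumps :: "(real \<times> real) set \<Rightarrow> real \<Rightarrow> real \<Rightarrow> nat" where
  "num_jumps S a b = card (jump_times S \<inter> {a..b})"

(* For 0 < a the process hull_W S is right-continuous, so a jump at a itself is not a jump of its
   restriction to {a..}: the successive jump times a_1 < a_2 < ... of that restriction lie beyond a.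
   The list consists of a_0 = a followed by those a_i with a_i \<le> b. *)
definition jump_list :: "(real \<times> real) set \<Rightarrow> real \<Rightarrow> real \<Rightarrow> real list" where
  "jump_list S a b = a # sorted_list_of_set (jump_times S \<inter> {a<..b})"

(* For consecutive jump times s < t the line x + t y = U(t) + t V(t) also passes through W(s), so
   the three sides meet in W(s) and in the two points where the slanted sides hit the x-axis. *)
definition hull_triangle :: "(real \<times> real) set \<Rightarrow> real \<Rightarrow> real \<Rightarrow> (real \<times> real) set" where
  "hull_triangle S s t = convex hull
     {hull_W S s, (hull_U S s + s * hull_V S s, 0), (hull_U S t + t * hull_V S t, 0)}"

definition triangles_area :: "(real \<times> real) set \<Rightarrow> real \<Rightarrow> real \<Rightarrow> real" where
  "triangles_area S a b =
     (let as = jump_list S a b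
      in measure lborel (\<Union>i\<in>{1..<length as}. hull_triangle S (as ! (i - 1)) (as ! i)))"

definition normal_measure :: "real ^ 'n \<Rightarrow> real ^ 'n ^ 'n \<Rightarrow> (real ^ 'n) measure" where
  "normal_measure \<mu> \<Sigma> = density lborel
     (\<lambda>x. ennreal (exp (- ((x - \<mu>) \<bullet> (matrix_inv \<Sigma> *v (x - \<mu>))) / 2) /
                    sqrt ((2 * pi) ^ CARD('n) * det \<Sigma>)))"

(* The library's weak_conv_m covers only sequences of measures on the real line. *)
definition converges_in_distribution ::
  "'w measure \<Rightarrow> ('i \<Rightarrow> 'w \<Rightarrow> 'b::metric_space) \<Rightarrow> 'b measure \<Rightarrow> 'i filter \<Rightarrow> bool" where
  "converges_in_distribution M X N F \<longleftrightarrow>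
     (\<forall>\<^sub>F i in F. X i \<in> borel_measurable M) \<and>
     (\<forall>f::'b \<Rightarrow> real. continuous_on UNIV f \<and> bounded (range f) \<longrightarrow>
        ((\<lambda>i. \<integral>\<omega>. f (X i \<omega>) \<partial>M) \<longlongrightarrow> (\<integral>x. f x \<partial>N)) F)"

definition ratio_to_infinity :: "(real \<times> real) filter" where
  "ratio_to_infinity =
     inf (filtercomap (\<lambda>(a, b). b / a) at_top) (principal {(a, b). 0 < a \<and> a < b})"

end

theory Submission
  imports Defs "HOL-Real_Asymp.Real_Asymp"
begin

text \<open>
  Given the first vertices of the hull, the region swept out by the supporting lines is empty of
  further points, so that a chain of vertices has Lebesgue density \<open>exp (- A)\<close>, where \<open>A\<close> is the area
  of that region, i.e. the sum of the areas of the triangles. In the coordinates given by the triangle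
  areas and the ratios of successive heights this density factorises: all coordinates are independent,
  the areas are standard exponential and the ratios \<open>t\<close> have density \<open>2 * (1 - t)\<close> (the initial
  ratio is uniform). To avoid a formula for conditional laws, the law of a chain is only bounded from
  above, through independence of the process on dyadic cells and on the region left empty; as
  both sides are probability measures, the bound is an equality.

  The logarithm of the \<open>i\<close>-th jump time is \<open>ln (c V(c)\<^sup>2)\<close>, which stays tight, plus the random walk with
  steps \<open>- 2 * ln t\<close> of mean \<open>3\<close> and variance \<open>5\<close>. The number of jumps is therefore a renewal count up
  to level \<open>L = ln (b / a)\<close>, close to \<open>L / 3\<close> minus a third of the centred walk at time \<open>L / 3\<close>, and
  the total area differs from it by the centred sum of the first \<open>L / 3\<close> exponentials. The two central
  limit theorems, with variances \<open>5 L / 27\<close> and \<open>L / 3 = 9 / 5 * (5 L / 27)\<close>, are independent, which gives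
  the covariance matrix.
\<close>

section \<open>The lower left hull of a locally finite configuration\<close>

text \<open>The definition of convergence in distribution demands that count and area be measurable
  on the whole sample space, while chains of vertices exist only almost surely. The geometry is
  therefore developed on two levels: for arbitrary locally finite configurations, where the count is
  expressed by the values of \<open>hull_V\<close> at countably many parameters and the area by an
  integral of its square, and for the almost sure configurations, where the jumps form an infinite
  sequence. The ordinate suffices on both levels because it determines the vertex and is monotone in
  the parameter.

  The coordinates are normalised so that their joint law is free of a. This reflects the invariance
  of the process under the maps (x, y) -> (r x, y / r), which rescale the parameter but preserve
  areas and ratios of heights. Consequently the limit in two parameters is one along L = ln (b / a),
  studied for the fixed initial parameter 1.\<close>

locale quadrant_config =
  fixes S :: "(real \<times> real) set"
  assumes quadrant: "S \<subseteq> first_quadrant"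
    and locally_finite: "\<And>A. bounded A \<Longrightarrow> finite (S \<inter> A)"
begin

lemma point_nonneg:
  assumes "p \<in> S" shows "0 \<le> fst p" "0 \<le> snd p"
  using assms quadrant by (auto simp: first_quadrant_def)

lemma finite_below:
  assumes "0 < c" shows "finite {p\<in>S. fst p + c * snd p \<le> k}"
proof -
  have "{p\<in>S. fst p + c * snd p \<le> k} \<subseteq> S \<inter> ({0..k} \<times> {0..k / c})"
  proof clarsimp
    fix x y assume *: "(x, y) \<in> S" "x + c * y \<le> k"
    have "0 \<le> x" "0 \<le> y" using point_nonneg[OF *(1)] by auto
    moreover have "0 \<le> c * y" using \<open>0 \<le> y\<close> assms by simp
    ultimately have "x \<le> k" "c * y \<le> k" using *(2) by linarith+
    with \<open>0 \<le> x\<close> \<open>0 \<le> y\<close> show "0 \<le> x \<and> x \<le> k \<and> 0 \<le> y \<and> y \<le> k / c"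
      using assms by (simp add: pos_le_divide_eq mult.commute)
  qed
  moreover have "finite (S \<inter> ({0..k} \<times> {0..k / c}))"
    by (intro locally_finite bounded_Times bounded_closed_interval)
  ultimately show ?thesis by (rule finite_subset)
qed

text \<open>On a line x + c y = k the point of largest abscissa is also the point of smallest
  ordinate, so \<open>hull_U\<close> and \<open>hull_V\<close>, defined by a separate
  \<open>Sup\<close> and \<open>Inf\<close>, are attained by one and the same point. Local
  finiteness turns the infimum over all points into a minimum over a finite set.\<close>

lemma hull_W_props:
  assumes c: "0 < c" and ne: "S \<noteq> {}"
  shows "hull_W S c \<in> S"
    and "\<And>q. q \<in> S \<Longrightarrow> hull_U S c + c * hull_V S c \<le> fst q + c * snd q"
    and "\<And>q. q \<in> S \<Longrightarrow> fst q + c * snd q = hull_U S c + c * hull_V S c \<Longrightarrow> hull_V S c \<le> snd q"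
proof -
  define f where "f p = fst p + c * snd p" for p :: "real \<times> real"
  obtain q0 where q0: "q0 \<in> S" using ne by auto
  define A where "A = {p\<in>S. f p \<le> f q0}"
  have finA: "finite A" unfolding A_def f_def by (rule finite_below[OF c])
  have "q0 \<in> A" by (simp add: A_def q0)
  then obtain m where m: "m \<in> A" "\<And>p. p \<in> A \<Longrightarrow> f m \<le> f p"
    using ex_is_arg_min_if_finite[OF finA, of f] unfolding is_arg_min_linorder by blast
  have min: "f m \<le> f p" if "p \<in> S" for p
    using m that unfolding A_def by (cases "f p \<le> f q0") auto
  have sp: "support_points S c = {p\<in>S. f p = f m}"
  proof (intro equalityI subsetI)
    fix p assume "p \<in> support_points S c"
    then have "p \<in> S" "f p \<le> f m" using m(1) by (auto simp: support_points_def A_def f_def)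
    then show "p \<in> {p\<in>S. f p = f m}" using min[of p] by simp
  next
    fix p assume p: "p \<in> {p\<in>S. f p = f m}"
    then have "f p \<le> f q" if "q \<in> S" for q using min[OF that] by simp
    with p show "p \<in> support_points S c" by (simp add: support_points_def f_def)
  qed
  have finsp: "finite (support_points S c)"
    using m(1) by (intro finite_subset[OF _ finA]) (auto simp: sp A_def)
  have "m \<in> support_points S c" using m(1) by (auto simp: sp A_def)
  then obtain p where p: "p \<in> support_points S c" "\<And>q. q \<in> support_points S c \<Longrightarrow> snd p \<le> snd q"
    using ex_is_arg_min_if_finite[OF finsp, of snd] unfolding is_arg_min_linorder by blast
  have V: "hull_V S c = snd p"
    unfolding hull_V_def using p by (intro cInf_eq_minimum) auto
  have U: "hull_U S c = fst p"
    unfolding hull_U_def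
  proof (rule cSup_eq_maximum)
    show "fst p \<in> fst ` support_points S c" using p by auto
    fix x assume "x \<in> fst ` support_points S c"
    then obtain q where q: "q \<in> support_points S c" "x = fst q" by auto
    have "fst q + c * snd q = fst p + c * snd p" using q p by (auto simp: sp f_def)
    moreover have "c * snd p \<le> c * snd q" using p(2)[OF q(1)] c by simp
    ultimately show "x \<le> fst p" using q by linarith
  qed
  show "hull_W S c \<in> S" using p by (simp add: hull_W_def U V sp)
  show "hull_U S c + c * hull_V S c \<le> fst q + c * snd q" if "q \<in> S" for q
    using min[OF that] p by (simp add: U V sp f_def)
  show "hull_V S c \<le> snd q" if "q \<in> S" "fst q + c * snd q = hull_U S c + c * hull_V S c" for q
    using p that by (auto simp: U V sp f_def)
qed

lemma hull_V_nonneg: "0 < c \<Longrightarrow> S \<noteq> {} \<Longrightarrow> 0 \<le> hull_V S c"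
  using point_nonneg[OF hull_W_props(1)] by (auto simp: hull_W_def)

lemma hull_W_support:
  assumes "0 < c" "0 < d" "S \<noteq> {}"
  shows "hull_U S c + c * hull_V S c \<le> hull_U S d + c * hull_V S d"
  using hull_W_props(2)[OF assms(1,3) hull_W_props(1)[OF assms(2,3)]] by (simp add: hull_W_def)

text \<open>Adding the support inequalities at c and d cancels the abscissas. An empty configuration
  gets its own case, in which \<open>hull_V\<close> is the constant \<open>Inf {}\<close>.\<close>

lemma hull_V_antimono:
  assumes "0 < c" "c \<le> d" shows "hull_V S d \<le> hull_V S c"
proof (cases "S = {} \<or> c = d")
  case True
  then show ?thesis by (auto simp: hull_V_def support_points_def)
next
  case False
  then have ne: "S \<noteq> {}" and "c < d" using assms by auto
  have "(d - c) * hull_V S d \<le> (d - c) * hull_V S c"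
    using hull_W_support[of c d] hull_W_support[of d c] assms ne by (auto simp: algebra_simps)
  then show ?thesis using \<open>c < d\<close> by simp
qed

text \<open>Jumps of the vertex process can be read off the real function \<open>hull_V\<close>: if
  two vertices have the same height, the two support inequalities force equal abscissas as
  well.\<close>

lemma hull_W_eq_iff:
  assumes "0 < c" "0 < d" shows "hull_W S c = hull_W S d \<longleftrightarrow> hull_V S c = hull_V S d"
proof (cases "S = {}")
  case True
  then show ?thesis by (auto simp: hull_V_def hull_W_def hull_U_def support_points_def)
next
  case False
  then show ?thesis
    using hull_W_support[of c d] hull_W_support[of d c] assms by (auto simp: hull_W_def)
qed

lemma hull_V_const_between:
  assumes "0 < c" "c \<le> e" "e \<le> d" "hull_V S c = hull_V S d"
  shows "hull_V S e = hull_V S c"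
  using hull_V_antimono[of c e] hull_V_antimono[of e d] assms by auto

text \<open>A fixed point q bounds U(c) + c V(c) for all c up to b, and a \<le> c lets this bound
  control U(c) + a V(c). So all these vertices lie below one line of parameter a.\<close>

lemma hull_W_bounded_finite:
  assumes "0 < a" shows "finite (hull_W S ` {a..b})"
proof (cases "S = {}")
  case True
  then have "hull_W S ` {a..b} \<subseteq> {hull_W {} 0}"
    by (auto simp: hull_W_def hull_U_def hull_V_def support_points_def)
  then show ?thesis by (rule finite_subset) simp
next
  case False
  then obtain q where q: "q \<in> S" by auto
  have "hull_W S ` {a..b} \<subseteq> {p\<in>S. fst p + a * snd p \<le> fst q + b * snd q}"
  proof clarsimp
    fix c assume c: "a \<le> c" "c \<le> b"
    then have "0 < c" using assms by simp
    note W = hull_W_props[OF \<open>0 < c\<close> False]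
    have "a * hull_V S c \<le> c * hull_V S c" "c * snd q \<le> b * snd q"
      using c hull_V_nonneg[OF \<open>0 < c\<close> False] point_nonneg[OF q] by (auto intro: mult_right_mono)
    with W(1) W(2)[OF q] show "hull_W S c \<in> S \<and> fst (hull_W S c) + a * snd (hull_W S c) \<le> fst q + b * snd q"
      by (simp add: hull_W_def)
  qed
  then show ?thesis using finite_below[OF assms] finite_subset by blast
qed

text \<open>A competitor on the current supporting line lies higher than the chosen vertex, by the
  tie rule, and loses at once when c grows; any other competitor is strictly above the line and
  stays so for a while. Only finitely many vertices compete on [c, c + 1].\<close>

lemma hull_V_right_const:
  assumes c: "0 < c" shows "\<exists>e>c. \<forall>d\<in>{c..<e}. hull_V S d = hull_V S c"
proof (cases "S = {}")
  case True
  then show ?thesis by (intro exI[of _ "c+1"]) (auto simp: hull_V_def support_points_def)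
next
  case False
  note W = hull_W_props[OF c False]
  define F where "F = hull_W S ` {c..c+1}"
  have finF: "finite F" unfolding F_def using c by (rule hull_W_bounded_finite)
  have FS: "F \<subseteq> S" unfolding F_def using hull_W_props(1)[OF _ False] c by auto
  have "\<forall>\<^sub>F d in at_right c. \<forall>p\<in>F - {hull_W S c}. hull_U S c + d * hull_V S c < fst p + d * snd p"
  proof (intro eventually_ball_finite ballI)
    show "finite (F - {hull_W S c})" using finF by simp
    fix p assume p: "p \<in> F - {hull_W S c}"
    then have pS: "p \<in> S" using FS by auto
    show "\<forall>\<^sub>F d in at_right c. hull_U S c + d * hull_V S c < fst p + d * snd p"
    proof (cases "fst p + c * snd p = hull_U S c + c * hull_V S c")
      case True
      then have "hull_V S c \<le> snd p" using W(3)[OF pS] by simp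
      moreover have "hull_V S c \<noteq> snd p"
        using True p by (auto simp: hull_W_def prod_eq_iff)
      ultimately have lt: "hull_V S c < snd p" by simp
      have "hull_U S c + d * hull_V S c < fst p + d * snd p" if "c < d" for d
      proof -
        have "(d - c) * hull_V S c < (d - c) * snd p" using lt that by simp
        then show ?thesis using True by (simp add: algebra_simps)
      qed
      then show ?thesis unfolding eventually_at_right_field by (intro exI[of _ "c+1"]) auto
    next
      case False
      then have "hull_U S c + c * hull_V S c < fst p + c * snd p" using W(2)[OF pS] by simp
      then have "\<forall>\<^sub>F d in at c. hull_U S c + d * hull_V S c < fst p + d * snd p"
        by (intro eventually_mono[OF order_tendstoD(1)[of "\<lambda>d. (fst p + d * snd p) - (hull_U S c + d * hull_V S c)" "(fst p + c * snd p) - (hull_U S c + c * hull_V S c)" _ 0]])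
           (auto intro!: tendsto_intros)
      then show ?thesis by (auto simp: eventually_at_split)
    qed
  qed
  then obtain e where e: "e > c"
    "\<And>d. c < d \<Longrightarrow> d < e \<Longrightarrow> \<forall>p\<in>F - {hull_W S c}. hull_U S c + d * hull_V S c < fst p + d * snd p"
    by (auto simp: eventually_at_right_field)
  show ?thesis
  proof (intro exI[of _ "min e (c+1)"] conjI ballI)
    show "c < min e (c+1)" using e by simp
    fix d assume d: "d \<in> {c..<min e (c+1)}"
    show "hull_V S d = hull_V S c"
    proof (cases "d = c")
      case False
      with d have "0 < d" "c < d" "d < e" and dF: "hull_W S d \<in> F" using c by (auto simp: F_def)
      have "hull_W S d = hull_W S c"
      proof (rule ccontr)
        assume "hull_W S d \<noteq> hull_W S c"
        then have "hull_U S c + d * hull_V S c < hull_U S d + d * hull_V S d"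
          using bspec[OF e(2)[OF \<open>c < d\<close> \<open>d < e\<close>], of "hull_W S d"] dF by (simp add: hull_W_def)
        then show False using hull_W_support[OF \<open>0 < d\<close> c] \<open>S \<noteq> {}\<close> by simp
      qed
      then show ?thesis by (simp add: hull_W_def)
    qed simp
  qed
qed

text \<open>A continuous image of an interval is connected, and the vertex takes only finitely many
  values there, hence a single one. Conversely \<open>hull_V\<close> is monotone, so equal values at
  both ends make it constant in between, and right constancy excludes a jump at d.\<close>

lemma no_jump_iff:
  assumes c: "0 < c" and cd: "c \<le> d"
  shows "jump_times S \<inter> {c<..d} = {} \<longleftrightarrow> hull_V S c = hull_V S d"
proof (rule iffI)
  assume eq: "hull_V S c = hull_V S d"
  have "isCont (hull_W S) e" if e: "c < e" "e \<le> d" for e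
  proof -
    have "0 < e" using c e by simp
    from hull_V_right_const[OF this]
    obtain e' where e': "e' > e" "\<forall>x\<in>{e..<e'}. hull_V S x = hull_V S e" by blast
    have "hull_W S x = hull_W S e" if "c < x" "x < e'" for x
    proof -
      have "hull_V S x = hull_V S c" if "x \<le> e"
        by (rule hull_V_const_between[OF c _ _ eq]) (use that e \<open>c < x\<close> in linarith)+
      moreover have "hull_V S e = hull_V S c"
        by (rule hull_V_const_between[OF c _ _ eq]) (use e in linarith)+
      moreover have "hull_V S x = hull_V S e" if "\<not> x \<le> e"
        by (rule bspec[OF e'(2)]) (use that \<open>x < e'\<close> in simp)
      ultimately have "hull_V S x = hull_V S e" by (cases "x \<le> e") (simp_all only: simp_thms)
      then show ?thesis using hull_W_eq_iff[of x e] c e that by simp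
    qed
    note near = this
    have "\<forall>\<^sub>F x in nhds e. x \<in> {c<..<e'}"
      using e(1) e'(1) by (intro eventually_nhds_in_open) auto
    then have "\<forall>\<^sub>F x in nhds e. hull_W S x = hull_W S e"
      by (rule eventually_mono) (rule near, auto)
    then have "isCont (hull_W S) e \<longleftrightarrow> isCont (\<lambda>_. hull_W S e) e" by (rule isCont_cong)
    then show ?thesis by simp
  qed
  then show "jump_times S \<inter> {c<..d} = {}" by (auto simp: jump_times_def)
next
  assume J: "jump_times S \<inter> {c<..d} = {}"
  have "continuous_on {c..d} (hull_W S)"
    unfolding continuous_on_eq_continuous_within
  proof
    fix x assume x: "x \<in> {c..d}"
    show "continuous (at x within {c..d}) (hull_W S)"
    proof (cases "x = c")
      case False
      then have "x \<notin> jump_times S" using J x by auto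
      then have "isCont (hull_W S) x" using x c by (simp add: jump_times_def)
      then show ?thesis by (rule continuous_at_imp_continuous_at_within)
    next
      \<comment> \<open>At the left end only right continuity is available: a jump at c itself is
        allowed.\<close>
      case True
      obtain e' where e': "e' > c" "\<forall>x\<in>{c..<e'}. hull_V S x = hull_V S c"
        using hull_V_right_const[OF c] by blast
      have "\<forall>\<^sub>F y in at c within {c..d}. hull_W S y = hull_W S c"
        unfolding eventually_at_topological
      proof (intro exI[of _ "{..<e'}"] conjI ballI impI)
        fix y assume "y \<in> {..<e'}" "y \<in> {c..d}"
        then show "hull_W S y = hull_W S c" using bspec[OF e'(2), of y] hull_W_eq_iff[of y c] c by simp
      qed (use e'(1) in auto)
      then show ?thesis unfolding True continuous_within by (rule tendsto_eventually)
    qed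
  qed
  then have "connected (hull_W S ` {c..d})" by (intro connected_continuous_image) auto
  then have "hull_W S ` {c..d} = {} \<or> (\<exists>z. hull_W S ` {c..d} = {z})"
    using hull_W_bounded_finite[OF c] connected_finite_iff_sing by blast
  then have "hull_W S c = hull_W S d"
    using cd by (metis atLeastAtMost_iff image_eqI image_is_empty order_refl singletonD empty_iff)
  then show "hull_V S c = hull_V S d" by (simp add: hull_W_def)
qed

text \<open>Different jump times carry different vertices, and only finitely many vertices
  occur.\<close>

lemma finite_jumps:
  assumes a: "0 < a" shows "finite (jump_times S \<inter> {a<..b})"
proof (rule finite_imageD)
  show "finite (hull_W S ` (jump_times S \<inter> {a<..b}))"
    using hull_W_bounded_finite[OF a, of b] by (rule finite_subset[rotated]) auto
  show "inj_on (hull_W S) (jump_times S \<inter> {a<..b})"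
  proof (rule linorder_inj_onI')
    fix c d assume "c \<in> jump_times S \<inter> {a<..b}" "d \<in> jump_times S \<inter> {a<..b}" "c < d"
    then show "hull_W S c \<noteq> hull_W S d"
      using no_jump_iff[of c d] a by (auto simp: hull_W_def)
  qed
qed

text \<open>For parameters e slightly below t the vertex is still that of s, so its support
  inequality holds against the vertex of t; letting e tend to t gives one inequality, the support
  property at t the other.\<close>

lemma hull_line_crossing:
  assumes s: "0 < s" and st: "s < t" and ne: "S \<noteq> {}" and const: "\<And>e. s \<le> e \<Longrightarrow> e < t \<Longrightarrow> hull_V S e = hull_V S s"
  shows "hull_U S s + t * hull_V S s = hull_U S t + t * hull_V S t"
proof (rule antisym)
  have *: "hull_U S s + e * hull_V S s \<le> hull_U S t + e * hull_V S t" if "s \<le> e" "e < t" for e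
  proof -
    have "hull_W S e = hull_W S s" using hull_W_eq_iff[of e s] const[OF that] that s by auto
    then show ?thesis using hull_W_support[of e t] that s ne by (auto simp: hull_W_def)
  qed
  show "hull_U S s + t * hull_V S s \<le> hull_U S t + t * hull_V S t"
  proof (rule tendsto_le)
    show "((\<lambda>e. hull_U S s + e * hull_V S s) \<longlongrightarrow> hull_U S s + t * hull_V S s) (at_left t)"
         "((\<lambda>e. hull_U S t + e * hull_V S t) \<longlongrightarrow> hull_U S t + t * hull_V S t) (at_left t)"
      by (auto intro!: tendsto_intros)
    show "\<forall>\<^sub>F e in at_left t. hull_U S s + e * hull_V S s \<le> hull_U S t + e * hull_V S t"
      using * st by (auto simp: eventually_at_left_field)
  qed simp
  show "hull_U S t + t * hull_V S t \<le> hull_U S s + t * hull_V S s"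
    using hull_W_support[of t s] s st ne by auto
qed

end

section \<open>Triangles between two lines through a common apex and the x-axis\<close>

lemma emeasure_by_slices:
  fixes X :: "(real \<times> real) set"
  assumes X: "X \<in> sets borel" and v: "0 \<le> v" and st: "s \<le> t"
    and inner: "\<And>y. 0 < y \<Longrightarrow> y < v \<Longrightarrow> emeasure lborel ((\<lambda>x. (x, y)) -` X) = ennreal ((t - s) * (v - y))"
    and outer: "\<And>y. y < 0 \<or> v < y \<Longrightarrow> (\<lambda>x. (x, y)) -` X = {}"
  shows "emeasure lborel X = ennreal ((t - s) * v\<^sup>2 / 2)"
proof -
  have "emeasure lborel X = emeasure (lborel \<Otimes>\<^sub>M lborel) X"
    by (simp add: lborel_prod)
  also have "\<dots> = (\<integral>\<^sup>+ y. emeasure lborel ((\<lambda>x. (x, y)) -` X) \<partial>lborel)"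
    using X by (intro lborel_pair.emeasure_pair_measure_alt2) (subst lborel_prod, simp)
  \<comment> \<open>The slices at heights 0 and v are left open by the hypotheses and form a null
    set, so that one computation serves closed, half-open and open triangles.\<close>
  also have "\<dots> = (\<integral>\<^sup>+ y. ennreal ((t - s) * (v - y)) * indicator {0..v} y \<partial>lborel)"
  proof (rule nn_integral_cong_AE)
    show "AE y in lborel. emeasure lborel ((\<lambda>x. (x, y)) -` X) = ennreal ((t - s) * (v - y)) * indicator {0..v} y"
      using AE_lborel_singleton[of 0] AE_lborel_singleton[of v]
    proof eventually_elim
      case (elim y)
      then show ?case using inner[of y] outer[of y] by (cases "0 < y \<and> y < v") (auto simp: indicator_def)
    qed
  qed
  also have "\<dots> = ennreal ((t - s) * (v * v - v\<^sup>2 / 2) - (t - s) * (v * 0 - 0\<^sup>2 / 2))"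
    using v st by (intro nn_integral_FTC_Icc[where F="\<lambda>y. (t - s) * (v * y - y\<^sup>2 / 2)"])
      (auto intro!: derivative_eq_intros)
  also have "(t - s) * (v * v - v\<^sup>2 / 2) - (t - s) * (v * 0 - 0\<^sup>2 / 2) = (t - s) * v\<^sup>2 / 2"
    by (simp add: power2_eq_square field_simps)
  finally show ?thesis .
qed

definition closed_triangle :: "real \<times> real \<Rightarrow> real \<Rightarrow> real \<Rightarrow> (real \<times> real) set" where
  "closed_triangle p s t =
     {(x, y). 0 \<le> y \<and> y \<le> snd p \<and> s * (snd p - y) \<le> x - fst p \<and> x - fst p \<le> t * (snd p - y)}"

text \<open>Without the right-hand side and the apex the triangles of successive jumps become
  disjoint, while the area is unchanged.\<close>

definition half_open_triangle :: "real \<times> real \<Rightarrow> real \<Rightarrow> real \<Rightarrow> (real \<times> real) set" where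
  "half_open_triangle p s t =
     {(x, y). 0 \<le> y \<and> y < snd p \<and> s * (snd p - y) \<le> x - fst p \<and> x - fst p < t * (snd p - y)}"

text \<open>Only strict inequalities: membership is stable under small changes of the apex, the
  sides and the tested point.\<close>

definition open_triangle :: "real \<times> real \<Rightarrow> real \<Rightarrow> real \<Rightarrow> (real \<times> real) set" where
  "open_triangle p s t =
     {(x, y). 0 < y \<and> y < snd p \<and> s * (snd p - y) < x - fst p \<and> x - fst p < t * (snd p - y)}"

lemma fst_snd_borel_measurable [measurable]:
  "fst \<in> borel_measurable (borel :: (real \<times> real) measure)"
  "snd \<in> borel_measurable (borel :: (real \<times> real) measure)"
  by (intro borel_measurable_continuous_onI continuous_intros)+

lemma triangle_sets [measurable]:
  "closed_triangle p s t \<in> sets borel"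
  "half_open_triangle p s t \<in> sets borel"
  "open_triangle p s t \<in> sets borel"
proof -
  note defs = closed_triangle_def half_open_triangle_def open_triangle_def case_prod_unfold
  have "closed_triangle p s t = {q\<in>space borel. 0 \<le> snd q \<and> snd q \<le> snd p \<and>
      s * (snd p - snd q) \<le> fst q - fst p \<and> fst q - fst p \<le> t * (snd p - snd q)}"
    by (simp add: defs)
  also have "\<dots> \<in> sets borel" by measurable
  finally show "closed_triangle p s t \<in> sets borel" .
  have "half_open_triangle p s t = {q\<in>space borel. 0 \<le> snd q \<and> snd q < snd p \<and>
      s * (snd p - snd q) \<le> fst q - fst p \<and> fst q - fst p < t * (snd p - snd q)}"
    by (simp add: defs)
  also have "\<dots> \<in> sets borel" by measurable
  finally show "half_open_triangle p s t \<in> sets borel" .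
  have "open_triangle p s t = {q\<in>space borel. 0 < snd q \<and> snd q < snd p \<and>
      s * (snd p - snd q) < fst q - fst p \<and> fst q - fst p < t * (snd p - snd q)}"
    by (simp add: defs)
  also have "\<dots> \<in> sets borel" by measurable
  finally show "open_triangle p s t \<in> sets borel" .
qed

lemma emeasure_triangle:
  assumes "0 \<le> snd p" "s \<le> t"
  shows "emeasure lborel (closed_triangle p s t) = ennreal ((t - s) * (snd p)\<^sup>2 / 2)"
    and "emeasure lborel (half_open_triangle p s t) = ennreal ((t - s) * (snd p)\<^sup>2 / 2)"
    and "emeasure lborel (open_triangle p s t) = ennreal ((t - s) * (snd p)\<^sup>2 / 2)"
proof -
  have len: "s * (snd p - y) \<le> t * (snd p - y)" if "y < snd p" for y
    using assms that by (intro mult_right_mono) auto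
  note defs = closed_triangle_def half_open_triangle_def open_triangle_def
  have 1: "(\<lambda>x. (x, y)) -` closed_triangle p s t = {fst p + s * (snd p - y)..fst p + t * (snd p - y)}"
    "(\<lambda>x. (x, y)) -` half_open_triangle p s t = {fst p + s * (snd p - y)..<fst p + t * (snd p - y)}"
    "(\<lambda>x. (x, y)) -` open_triangle p s t = {fst p + s * (snd p - y)<..<fst p + t * (snd p - y)}"
    if "0 < y" "y < snd p" for y
    using that by (auto simp: defs)
  show "emeasure lborel (closed_triangle p s t) = ennreal ((t - s) * (snd p)\<^sup>2 / 2)"
    using assms len by (intro emeasure_by_slices) (auto simp: 1 left_diff_distrib, auto simp: defs)
  show "emeasure lborel (half_open_triangle p s t) = ennreal ((t - s) * (snd p)\<^sup>2 / 2)"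
    using assms len by (intro emeasure_by_slices) (auto simp: 1 left_diff_distrib, auto simp: defs)
  show "emeasure lborel (open_triangle p s t) = ennreal ((t - s) * (snd p)\<^sup>2 / 2)"
    using assms len by (intro emeasure_by_slices) (auto simp: 1 left_diff_distrib, auto simp: defs)
qed

lemma convex_hull_triangle:
  assumes v: "0 \<le> v" and st: "s < t"
  shows "convex hull {(u, v), (u + s * v, 0), (u + t * v, 0)} = closed_triangle (u, v) s t"
proof (intro equalityI hull_minimal subsetI)
  fix p assume "p \<in> {(u, v), (u + s * v, 0), (u + t * v, 0)}"
  moreover have "s * v \<le> t * v" using v st by (intro mult_right_mono) auto
  ultimately show "p \<in> closed_triangle (u, v) s t"
    using v by (auto simp: closed_triangle_def)
next
  have eq: "closed_triangle (u, v) s t =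
      {p. snd p \<ge> 0} \<inter> {p. snd p \<le> v} \<inter> {p. inner (1, s) p \<ge> u + s * v} \<inter> {p. inner (1, t) p \<le> u + t * v}"
    by (auto simp: closed_triangle_def inner_prod_def algebra_simps)
  have h: "{p :: real \<times> real. snd p \<ge> 0} = {p. inner (0, 1) p \<ge> 0}" "{p :: real \<times> real. snd p \<le> v} = {p. inner (0, 1) p \<le> v}"
    by (auto simp: inner_prod_def)
  show "convex (closed_triangle (u, v) s t)"
    unfolding eq h by (intro convex_Int convex_halfspace_le convex_halfspace_ge)
next
  fix p assume "p \<in> closed_triangle (u, v) s t"
  then obtain x y where p: "p = (x, y)" and y: "0 \<le> y" "y \<le> v"
    and x: "s * (v - y) \<le> x - u" "x - u \<le> t * (v - y)"
    by (auto simp: closed_triangle_def)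
  show "p \<in> convex hull {(u, v), (u + s * v, 0), (u + t * v, 0)}"
  proof (cases "v = 0 \<or> y = v")
    case True
    then have "p = (u, v)" using y x by (auto simp: p)
    then show ?thesis by (simp add: hull_inc)
  next
    case False
    then have v: "0 < v" and yv: "y < v" using v y by auto
    \<comment> \<open>Barycentric coordinates: q, the relative height of the point, is the weight of
      the apex; r is the parameter of the line from the apex through the point, and l its relative
      position between s and t.\<close>
    define q where "q = y / v"
    have q: "0 \<le> q" "q < 1" "q * v = y" using v yv y by (auto simp: q_def field_simps)
    define r where "r = (x - u) / (v - y)"
    have r: "r * (v - y) = x - u" using yv by (simp add: r_def)
    have rst: "s \<le> r" "r \<le> t" using x yv by (simp_all add: r_def field_simps)
    define l where "l = (r - s) / (t - s)"
    have l: "0 \<le> l" "l \<le> 1" "s + l * (t - s) = r" using rst st by (auto simp: l_def field_simps)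
    have "p = q *\<^sub>R (u, v) + ((1 - q) * (1 - l)) *\<^sub>R (u + s * v, 0) + ((1 - q) * l) *\<^sub>R (u + t * v, 0)"
    proof -
      have "q * u + (1 - q) * (1 - l) * (u + s * v) + (1 - q) * l * (u + t * v)
          = u + (s + l * (t - s)) * (v - q * v)" by (simp add: algebra_simps)
      also have "\<dots> = x" using l(3) q(3) r by simp
      finally show ?thesis using q(3) by (simp add: p)
    qed
    moreover have "q + (1 - q) * (1 - l) + (1 - q) * l = 1" by (simp add: algebra_simps)
    moreover have "0 \<le> (1 - q) * (1 - l)" "0 \<le> (1 - q) * l" using q l by auto
    ultimately show ?thesis unfolding convex_hull_3 using q(1) by blast
  qed
qed

section \<open>The area of the union of triangles as a sum and as an integral\<close>

context quadrant_config
begin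

lemma jump_list_props:
  assumes a: "0 < a" and xs: "xs = jump_list S a b"
  shows "xs ! 0 = a" "0 < length xs" "sorted_wrt (<) xs" "set xs = insert a (jump_times S \<inter> {a<..b})"
    and "\<And>i. i < length xs \<Longrightarrow> a \<le> xs ! i"
    and "\<And>i c. Suc i < length xs \<Longrightarrow> xs ! i \<le> c \<Longrightarrow> c < xs ! Suc i \<Longrightarrow> hull_V S c = hull_V S (xs ! i)"
proof -
  note fin = finite_jumps[OF a, of b]
  show "xs ! 0 = a" "0 < length xs" by (simp_all add: xs jump_list_def)
  show sorted: "sorted_wrt (<) xs" using fin by (auto simp: xs jump_list_def)
  show set: "set xs = insert a (jump_times S \<inter> {a<..b})" using fin by (simp add: xs jump_list_def)
  show ge: "a \<le> xs ! i" if "i < length xs" for i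
    using nth_mem[OF that] by (auto simp: set)
  fix i c assume i: "Suc i < length xs" and c: "xs ! i \<le> c" "c < xs ! Suc i"
  \<comment> \<open>A jump in between would be an entry of the sorted list strictly between two
    neighbours.\<close>
  have "jump_times S \<inter> {xs ! i<..c} = {}"
  proof (rule ccontr)
    assume "\<not> ?thesis"
    then obtain d where d: "d \<in> jump_times S" "xs ! i < d" "d \<le> c" by auto
    have "xs ! Suc i \<in> set xs" using i by simp
    then have "xs ! Suc i \<le> max a b" using a by (auto simp: set)
    then have "d \<in> set xs" using d c ge[of i] i by (auto simp: set max_def split: if_splits)
    then obtain j where j: "j < length xs" "xs ! j = d" by (auto simp: in_set_conv_nth)
    have "\<not> j \<le> i"
      using sorted_wrt_nth_less[OF sorted, of j i] j i d by (cases "j = i") auto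
    moreover have "\<not> Suc i \<le> j"
      using sorted_wrt_nth_less[OF sorted, of "Suc i" j] j i d c by (cases "j = Suc i") auto
    ultimately show False by simp
  qed
  then show "hull_V S c = hull_V S (xs ! i)"
    using no_jump_iff[of "xs ! i" c] ge[of i] i c a by auto
qed

lemma hull_triangle_eq:
  assumes s: "0 < s" and st: "s < t" and ne: "S \<noteq> {}" and const: "\<And>e. s \<le> e \<Longrightarrow> e < t \<Longrightarrow> hull_V S e = hull_V S s"
  shows "hull_triangle S s t = closed_triangle (hull_W S s) s t"
proof -
  have "hull_U S t + t * hull_V S t = hull_U S s + t * hull_V S s"
    using hull_line_crossing[OF assms] by simp
  then show ?thesis
    unfolding hull_triangle_def hull_W_def
    using convex_hull_triangle[OF hull_V_nonneg[OF s ne] st] by simp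
qed

text \<open>The line of parameter s' separates them: points of the first triangle lie strictly below
  it, whereas W(t) lies on or above it and, since t \<ge> s', so do all points below the height of
  W(t) and to the right of the line of parameter t through W(t).\<close>

lemma half_open_triangles_disjoint:
  assumes "0 < s" "s < s'" "s' \<le> t" and ne: "S \<noteq> {}"
    and cross: "hull_U S s + s' * hull_V S s = hull_U S s' + s' * hull_V S s'"
  shows "half_open_triangle (hull_W S s) s s' \<inter> half_open_triangle (hull_W S t) t t' = {}"
proof (rule ccontr)
  assume "\<not> ?thesis"
  then obtain x y where 1: "x - hull_U S s < s' * (hull_V S s - y)"
    and 2: "y < hull_V S t" "t * (hull_V S t - y) \<le> x - hull_U S t"
    by (auto simp: half_open_triangle_def hull_W_def)
  have "hull_U S s' + s' * hull_V S s' \<le> hull_U S t + s' * hull_V S t"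
    using hull_W_support[of s' t] assms by auto
  moreover have "s' * (hull_V S t - y) \<le> t * (hull_V S t - y)"
    using 2 assms by (intro mult_right_mono) auto
  ultimately show False using 1 2 cross by (simp add: algebra_simps)
qed

text \<open>That overlaps carry no area is shown without describing them: subadditivity bounds the
  union of the closed triangles from above, and the disjoint half-open triangles of equal area
  inside it bound it from below.\<close>

lemma triangles_area_eq_sum:
  assumes a: "0 < a" and xs: "xs = jump_list S a b"
  shows "triangles_area S a b =
    (\<Sum>i<length xs - 1. (xs ! Suc i - xs ! i) * (hull_V S (xs ! i))\<^sup>2 / 2)"
proof (cases "S = {}")
  case True
  have "hull_W {} = (\<lambda>c. hull_W {} 0)"
    by (auto simp: hull_W_def hull_U_def hull_V_def support_points_def fun_eq_iff)
  then have "isCont (hull_W {}) x" for x by (metis continuous_const)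
  then have "jump_times S = {}" unfolding True jump_times_def by auto
  then show ?thesis by (simp add: triangles_area_def xs jump_list_def)
next
  case ne: False
  note L = jump_list_props[OF a xs]
  let ?n = "length xs - 1"
  let ?T = "\<lambda>i. closed_triangle (hull_W S (xs ! i)) (xs ! i) (xs ! Suc i)"
  let ?H = "\<lambda>i. half_open_triangle (hull_W S (xs ! i)) (xs ! i) (xs ! Suc i)"
  let ?r = "\<lambda>i. (xs ! Suc i - xs ! i) * (hull_V S (xs ! i))\<^sup>2 / 2"
  have pos: "0 < xs ! i" if "i < length xs" for i using L(5)[OF that] a by simp
  have lt: "xs ! i < xs ! j" if "i < j" "j < length xs" for i j
    using sorted_wrt_nth_less[OF L(3) that] .
  have tri: "hull_triangle S (xs ! i) (xs ! Suc i) = ?T i" if "i < ?n" for i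
    using that pos lt L(6) ne by (intro hull_triangle_eq) auto
  have area: "triangles_area S a b = measure lborel (\<Union>i<?n. ?T i)"
  proof -
    have "(\<Union>i\<in>{1..<length xs}. hull_triangle S (xs ! (i - 1)) (xs ! i)) = (\<Union>i<?n. hull_triangle S (xs ! i) (xs ! Suc i))"
    proof (intro equalityI UN_least)
      fix i assume "i \<in> {1..<length xs}"
      then show "hull_triangle S (xs ! (i - 1)) (xs ! i) \<subseteq> (\<Union>i<?n. hull_triangle S (xs ! i) (xs ! Suc i))"
        by (intro order_trans[OF _ UN_upper[of "i - 1"]]) auto
    next
      fix i assume "i \<in> {..<?n}"
      then show "hull_triangle S (xs ! i) (xs ! Suc i) \<subseteq> (\<Union>i\<in>{1..<length xs}. hull_triangle S (xs ! (i - 1)) (xs ! i))"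
        by (intro order_trans[OF _ UN_upper[of "Suc i"]]) auto
    qed
    also have "\<dots> = (\<Union>i<?n. ?T i)" using tri by auto
    finally show ?thesis by (simp add: triangles_area_def Let_def flip: xs)
  qed
  have v: "0 \<le> snd (hull_W S (xs ! i))" if "i < length xs" for i
    using hull_V_nonneg[OF pos[OF that] ne] by (simp add: hull_W_def)
  have r0: "0 \<le> ?r i" if "i < ?n" for i
    using less_imp_le[OF lt[of i "Suc i"]] that
    by (intro divide_nonneg_nonneg mult_nonneg_nonneg) (auto simp: less_diff_conv)
  have mT: "emeasure lborel (?T i) = ennreal (?r i)" "emeasure lborel (?H i) = ennreal (?r i)" if "i < ?n" for i
    using emeasure_triangle[OF v, of i "xs ! i" "xs ! Suc i"] lt[of i "Suc i"] that by (auto simp: hull_W_def less_diff_conv)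
  have "emeasure lborel (\<Union>i<?n. ?T i) \<le> (\<Sum>i<?n. ennreal (?r i))"
    using emeasure_subadditive_finite[of "{..<?n}" ?T lborel] mT(1) by (auto simp: image_subset_iff)
  moreover have "(\<Sum>i<?n. ennreal (?r i)) = emeasure lborel (\<Union>i<?n. ?H i)"
  proof -
    have disj: "?H i \<inter> ?H j = {}" if "i < j" "j < ?n" for i j
    proof (rule half_open_triangles_disjoint)
      show "hull_U S (xs ! i) + xs ! Suc i * hull_V S (xs ! i) = hull_U S (xs ! Suc i) + xs ! Suc i * hull_V S (xs ! Suc i)"
        using that pos lt L(6) ne by (intro hull_line_crossing) auto
      show "xs ! Suc i \<le> xs ! j" using that less_imp_le[OF lt[of "Suc i" j]] by (cases "j = Suc i") auto
    qed (use that pos lt ne in auto)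
    have "disjoint_family_on ?H {..<?n}"
      unfolding disjoint_family_on_def
    proof (intro ballI impI)
      fix i j assume "i \<in> {..<?n}" "j \<in> {..<?n}" "i \<noteq> j"
      then show "?H i \<inter> ?H j = {}" using disj[of i j] disj[of j i] by (cases "i < j") auto
    qed
    then show ?thesis using sum_emeasure[where F="?H" and M=lborel and I="{..<?n}"] mT(2) by (auto simp: image_subset_iff)
  qed
  moreover have "emeasure lborel (\<Union>i<?n. ?H i) \<le> emeasure lborel (\<Union>i<?n. ?T i)"
    by (intro emeasure_mono UN_mono) (auto simp: closed_triangle_def half_open_triangle_def)
  ultimately have "emeasure lborel (\<Union>i<?n. ?T i) = (\<Sum>i<?n. ennreal (?r i))" by simp
  also have "\<dots> = ennreal (\<Sum>i<?n. ?r i)" using r0 by (intro sum_ennreal) auto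
  finally have "emeasure lborel (\<Union>i<?n. ?T i) = ennreal (\<Sum>i<?n. ?r i)" .
  moreover have "0 \<le> (\<Sum>i<?n. ?r i)" using r0 by (intro sum_nonneg) auto
  ultimately show ?thesis unfolding area measure_def by simp
qed

text \<open>This form makes the area measurable for every configuration. Each triangle contributes
  half the integral of the squared height between two successive jumps, and a parameter c below b
  precedes the last jump up to b exactly when its height differs from the height at b.\<close>

lemma triangles_area_eq_integral:
  assumes a: "0 < a" and ab: "a \<le> b"
  shows "triangles_area S a b =
    (\<integral>c. (if a \<le> c \<and> c < b \<and> hull_V S c \<noteq> hull_V S b then (hull_V S c)\<^sup>2 else 0) \<partial>lborel) / 2"
proof -
  define xs where xs: "xs = jump_list S a b"
  note L = jump_list_props[OF a xs]
  let ?n = "length xs - 1"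
  have lt: "xs ! i < xs ! j" if "i < j" "j < length xs" for i j
    using sorted_wrt_nth_less[OF L(3) that] .
  have last: "a \<le> xs ! ?n" "xs ! ?n \<le> b" using nth_mem[of ?n xs] L(2,4) ab by (auto simp del: nth_mem)
  have Vlast: "hull_V S (xs ! ?n) = hull_V S b"
  proof -
    have "jump_times S \<inter> {xs ! ?n<..b} = {}"
    proof (rule ccontr)
      assume "\<not> ?thesis"
      then obtain d where d: "d \<in> jump_times S" "xs ! ?n < d" "d \<le> b" by auto
      then have "d \<in> set xs" using last by (auto simp: L(4))
      then obtain j where j: "j < length xs" "xs ! j = d" by (auto simp: in_set_conv_nth)
      then have "j \<le> ?n" by auto
      then show False using lt[of j ?n] j d L(2) by (cases "j = ?n") auto
    qed
    then show ?thesis using no_jump_iff[of "xs ! ?n" b] last a by auto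
  qed
  \<comment> \<open>The intervals between successive entries are disjoint, so at most one summand
    contributes at c.\<close>
  have step: "(\<Sum>i<k. (hull_V S (xs ! i))\<^sup>2 * indicator {xs ! i..<xs ! Suc i} c) =
      (if c < xs ! k then (hull_V S c)\<^sup>2 else 0)" if "a \<le> c" "k \<le> ?n" for c k
    using that(2)
  proof (induction k)
    case 0
    then show ?case using that L(1) by simp
  next
    case (Suc k)
    then have "Suc k < length xs" using L(2) by linarith
    then show ?case using Suc L(6)[of k c] lt[of k "Suc k"] by (auto simp: indicator_def)
  qed
  have pt: "(if a \<le> c \<and> c < b \<and> hull_V S c \<noteq> hull_V S b then (hull_V S c)\<^sup>2 else 0) =
      (\<Sum>i<?n. (hull_V S (xs ! i))\<^sup>2 * indicator {xs ! i..<xs ! Suc i} c)" for c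
  proof (cases "a \<le> c")
    case False
    then have "c \<notin> {xs ! i..<xs ! Suc i}" if "i < ?n" for i using L(5)[of i] that by (auto simp: less_diff_conv)
    with False show ?thesis by (auto simp: sum.neutral)
  next
    case True
    have "c < xs ! ?n \<longleftrightarrow> c < b \<and> hull_V S c \<noteq> hull_V S b"
    proof
      assume c: "c < xs ! ?n"
      have "hull_V S c \<noteq> hull_V S (xs ! ?n)"
      proof
        assume "hull_V S c = hull_V S (xs ! ?n)"
        then have "jump_times S \<inter> {c<..xs ! ?n} = {}" using no_jump_iff[of c "xs ! ?n"] c True a by auto
        moreover have "xs ! ?n \<in> jump_times S" using nth_mem[of ?n xs] L(2,4) c True by (auto simp del: nth_mem)
        ultimately show False using c by auto
      qed
      then show "c < b \<and> hull_V S c \<noteq> hull_V S b" using c last Vlast by auto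
    next
      assume c: "c < b \<and> hull_V S c \<noteq> hull_V S b"
      show "c < xs ! ?n"
      proof (rule ccontr)
        assume "\<not> ?thesis"
        then have "hull_V S c = hull_V S (xs ! ?n)"
          using hull_V_const_between[of "xs ! ?n" c b] c last a Vlast by auto
        then show False using c Vlast by simp
      qed
    qed
    then show ?thesis using step[OF True, of ?n] True by auto
  qed
  have "(\<integral>c. (if a \<le> c \<and> c < b \<and> hull_V S c \<noteq> hull_V S b then (hull_V S c)\<^sup>2 else 0) \<partial>lborel) =
      (\<Sum>i<?n. (\<integral>c. (hull_V S (xs ! i))\<^sup>2 * indicator {xs ! i..<xs ! Suc i} c \<partial>lborel))"
    unfolding pt
  proof (intro Bochner_Integration.integral_sum integrable_mult_right integrable_real_indicator)
    show "emeasure lborel {xs ! i..<xs ! Suc i} < \<infinity>" for i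
      by (intro emeasure_bounded_finite bounded_subset[OF bounded_closed_interval[of "xs ! i" "xs ! Suc i"]]) auto
  qed auto
  also have "\<dots> = (\<Sum>i<?n. (hull_V S (xs ! i))\<^sup>2 * (xs ! Suc i - xs ! i))"
    using less_imp_le[OF lt[OF lessI]] by (intro sum.cong) (auto simp: less_diff_conv)
  finally show ?thesis
    unfolding triangles_area_eq_sum[OF a xs] by (simp add: sum_divide_distrib mult.commute)
qed

end

section \<open>Chains of hull vertices and their coordinates\<close>

definition next_jump :: "(real \<times> real) set \<Rightarrow> real \<Rightarrow> real" where
  "next_jump S c = Inf {d. c < d \<and> hull_V S d \<noteq> hull_V S c}"

primrec jump_seq :: "(real \<times> real) set \<Rightarrow> real \<Rightarrow> nat \<Rightarrow> real" where
  "jump_seq S a 0 = a"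
| "jump_seq S a (Suc i) = next_jump S (jump_seq S a i)"

text \<open>For an arbitrary tuple this plays the role of the jump time: the parameter of the line
  through two successive points, with the initial parameter at index 0.\<close>

fun slope :: "real \<Rightarrow> (nat \<Rightarrow> real \<times> real) \<Rightarrow> nat \<Rightarrow> real" where
  "slope a w 0 = a"
| "slope a w (Suc i) = (fst (w (Suc i)) - fst (w i)) / (snd (w i) - snd (w (Suc i)))"

text \<open>\<open>area_coord a w (Suc i)\<close> is the area of the triangle with top \<open>w i\<close>, and \<open>area_coord a w 0\<close> that of the
  triangle cut off from the quadrant by the supporting line at the initial parameter.\<close>

fun area_coord :: "real \<Rightarrow> (nat \<Rightarrow> real \<times> real) \<Rightarrow> nat \<Rightarrow> real" where
  "area_coord a w 0 = (fst (w 0) + a * snd (w 0))\<^sup>2 / (2 * a)"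
| "area_coord a w (Suc i) = (slope a w (Suc i) - slope a w i) * (snd (w i))\<^sup>2 / 2"

text \<open>At index 0 the reference height is that of the point where the supporting line of
  parameter a meets the y-axis; later it is the height of the previous vertex.\<close>

fun height_coord :: "real \<Rightarrow> (nat \<Rightarrow> real \<times> real) \<Rightarrow> nat \<Rightarrow> real" where
  "height_coord a w 0 = a * snd (w 0) / (fst (w 0) + a * snd (w 0))"
| "height_coord a w (Suc i) = snd (w (Suc i)) / snd (w i)"

text \<open>Strict inequalities throughout, so that a small change of the points stays inside the
  set; this is what lets whole dyadic cells consist of chains.\<close>

definition hull_chains :: "real \<Rightarrow> nat \<Rightarrow> (nat \<Rightarrow> real \<times> real) set" where
  "hull_chains a n = {w. 0 < fst (w 0) \<and> (\<forall>i\<le>n. 0 < snd (w i)) \<and>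
     (\<forall>i<n. snd (w (Suc i)) < snd (w i) \<and> slope a w i < slope a w (Suc i))}"

definition jump_count :: "(real \<times> real) set \<Rightarrow> real \<Rightarrow> real \<Rightarrow> nat" where
  "jump_count S a b = card {i. 1 \<le> i \<and> jump_seq S a i \<le> b}"

definition hull_chain :: "(real \<times> real) set \<Rightarrow> real \<Rightarrow> nat \<Rightarrow> real \<times> real" where
  "hull_chain S a i = hull_W S (jump_seq S a i)"

context quadrant_config
begin

text \<open>Right constancy at c keeps the infimum away from c; right constancy at the infimum shows
  that the height has changed there, since otherwise the infimum could be increased.\<close>

lemma next_jump_props:
  assumes c: "0 < c" and ex: "\<exists>d>c. hull_V S d \<noteq> hull_V S c"
  shows "c < next_jump S c" "hull_V S (next_jump S c) \<noteq> hull_V S c"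
    and "\<And>e. c \<le> e \<Longrightarrow> e < next_jump S c \<Longrightarrow> hull_V S e = hull_V S c"
proof -
  define X where "X = {d. c < d \<and> hull_V S d \<noteq> hull_V S c}"
  have ne: "X \<noteq> {}" using ex by (auto simp: X_def)
  have bdd: "bdd_below X" by (auto simp: X_def intro!: bdd_belowI[of _ c])
  have nj: "next_jump S c = Inf X" by (simp add: next_jump_def X_def)
  obtain e where e: "e > c" "\<forall>d\<in>{c..<e}. hull_V S d = hull_V S c"
    using hull_V_right_const[OF c] by blast
  have "e \<le> d" if "d \<in> X" for d
    using that bspec[OF e(2), of d] by (force simp: X_def)
  then have "e \<le> Inf X" using ne by (intro cInf_greatest) auto
  with e show gt: "c < next_jump S c" by (simp add: nj)
  show const: "hull_V S e = hull_V S c" if "c \<le> e" "e < next_jump S c" for e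
  proof (rule ccontr)
    assume "hull_V S e \<noteq> hull_V S c"
    then have "e \<in> X" using that by (cases "c = e") (auto simp: X_def)
    then have "Inf X \<le> e" using bdd by (rule cInf_lower)
    then show False using that by (simp add: nj)
  qed
  show "hull_V S (next_jump S c) \<noteq> hull_V S c"
  proof
    assume eq: "hull_V S (next_jump S c) = hull_V S c"
    have "0 < next_jump S c" using gt c by simp
    from hull_V_right_const[OF this] obtain e where e: "e > next_jump S c"
      "\<forall>d\<in>{next_jump S c..<e}. hull_V S d = hull_V S (next_jump S c)" by blast
    have "e \<le> d" if "d \<in> X" for d
    proof (rule ccontr)
      assume "\<not> e \<le> d"
      moreover have "next_jump S c \<le> d" unfolding nj using that bdd by (rule cInf_lower)
      ultimately have "hull_V S d = hull_V S c" using bspec[OF e(2), of d] eq by simp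
      then show False using that by (simp add: X_def)
    qed
    then have "e \<le> Inf X" using ne by (intro cInf_greatest) auto
    then show False using e by (simp add: nj)
  qed
qed

end

text \<open>The almost sure shape of a configuration: here the jumps after any parameter form an
  infinite strictly increasing sequence, which indexes the vertices.\<close>

locale nonstop_config = quadrant_config +
  assumes nonstop: "\<And>c. 0 < c \<Longrightarrow> \<exists>d>c. hull_V S d \<noteq> hull_V S c"
    and off_axes: "\<And>p. p \<in> S \<Longrightarrow> 0 < fst p \<and> 0 < snd p"
begin

lemma nonempty: "S \<noteq> {}"
  using nonstop[of 1] by (auto simp: hull_V_def support_points_def)

lemma hull_UV_pos: "0 < c \<Longrightarrow> 0 < hull_U S c" "0 < c \<Longrightarrow> 0 < hull_V S c"
  using off_axes[OF hull_W_props(1)[OF _ nonempty]] by (auto simp: hull_W_def)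

context
  fixes a :: real
  assumes a: "0 < a"
begin

lemma jump_seq_pos: "0 < jump_seq S a i"
proof (induction i)
  case (Suc i)
  then show ?case using next_jump_props(1)[OF Suc nonstop[OF Suc]] by simp
qed (use a in simp)

lemma jump_seq_less_Suc: "jump_seq S a i < jump_seq S a (Suc i)"
  and jump_seq_V_neq: "hull_V S (jump_seq S a (Suc i)) \<noteq> hull_V S (jump_seq S a i)"
  and jump_seq_V_const: "jump_seq S a i \<le> c \<Longrightarrow> c < jump_seq S a (Suc i) \<Longrightarrow> hull_V S c = hull_V S (jump_seq S a i)"
  unfolding jump_seq.simps by (fact next_jump_props[OF jump_seq_pos nonstop[OF jump_seq_pos]])+

lemma strict_mono_jump_seq: "strict_mono (jump_seq S a)"
  by (rule strict_monoI_Suc) (rule jump_seq_less_Suc)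

lemma jump_seq_less_iff [simp]: "jump_seq S a i < jump_seq S a j \<longleftrightarrow> i < j"
  using strict_mono_less[OF strict_mono_jump_seq] .

lemma jump_seq_le_iff [simp]: "jump_seq S a i \<le> jump_seq S a j \<longleftrightarrow> i \<le> j"
  using strict_mono_less_eq[OF strict_mono_jump_seq] .

lemma jump_seq_V_less: "hull_V S (jump_seq S a (Suc i)) < hull_V S (jump_seq S a i)"
  using hull_V_antimono[of "jump_seq S a i" "jump_seq S a (Suc i)"] jump_seq_pos[of i]
    jump_seq_less_Suc[of i] jump_seq_V_neq[of i] by auto

lemma jump_seq_crossing:
  "hull_U S (jump_seq S a i) + jump_seq S a (Suc i) * hull_V S (jump_seq S a i) =
   hull_U S (jump_seq S a (Suc i)) + jump_seq S a (Suc i) * hull_V S (jump_seq S a (Suc i))"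
  using jump_seq_pos jump_seq_less_Suc nonempty jump_seq_V_const by (rule hull_line_crossing)

lemma jump_seq_jumps: "jump_times S \<inter> {jump_seq S a i<..jump_seq S a (Suc i)} = {jump_seq S a (Suc i)}"
proof -
  have "jump_times S \<inter> {jump_seq S a i<..c} = {}" if "c < jump_seq S a (Suc i)" for c
  proof (cases "jump_seq S a i \<le> c")
    case True
    then show ?thesis using no_jump_iff[OF jump_seq_pos True] jump_seq_V_const[OF True that] by simp
  qed auto
  note none = this
  have only: "c = jump_seq S a (Suc i)"
    if "c \<in> jump_times S \<inter> {jump_seq S a i<..jump_seq S a (Suc i)}" for c
  proof (rule ccontr)
    assume "c \<noteq> jump_seq S a (Suc i)"
    then have "c < jump_seq S a (Suc i)" using that by simp
    from none[OF this] show False using that by (metis IntE IntI empty_iff greaterThanAtMost_iff order_refl)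
  qed
  moreover have "jump_times S \<inter> {jump_seq S a i<..jump_seq S a (Suc i)} \<noteq> {}"
    using no_jump_iff[OF jump_seq_pos less_imp_le[OF jump_seq_less_Suc], of i] jump_seq_V_neq[of i] by metis
  then have "jump_seq S a (Suc i) \<in> jump_times S \<inter> {jump_seq S a i<..jump_seq S a (Suc i)}"
    using only by (metis ex_in_conv)
  then show ?thesis using only by (intro equalityI subsetI) (simp_all only: singleton_iff)
qed

lemma jump_seq_Suc_jump: "jump_seq S a (Suc i) \<in> jump_times S"
  using jump_seq_jumps[of i] by blast

lemma inj_jump_seq: "inj_on (jump_seq S a) A"
  using strict_mono_imp_inj_on[OF strict_mono_jump_seq] by (rule inj_on_subset) (rule order_refl)

lemma finite_jump_seq_le: "finite {i. 1 \<le> i \<and> jump_seq S a i \<le> b}"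
proof (rule finite_imageD)
  have "jump_seq S a i \<in> jump_times S \<inter> {a<..b}" if "1 \<le> i" "jump_seq S a i \<le> b" for i
  proof -
    obtain j where j: "i = Suc j" using \<open>1 \<le> i\<close> by (cases i) auto
    have "jump_seq S a 0 < jump_seq S a i" using that(1) by (simp del: jump_seq.simps)
    then show ?thesis using jump_seq_Suc_jump[of j] that by (simp add: j del: jump_seq.simps(2))
  qed
  then have "jump_seq S a ` {i. 1 \<le> i \<and> jump_seq S a i \<le> b} \<subseteq> jump_times S \<inter> {a<..b}" by blast
  then show "finite (jump_seq S a ` {i. 1 \<le> i \<and> jump_seq S a i \<le> b})"
    by (rule finite_subset) (rule finite_jumps[OF a])
  show "inj_on (jump_seq S a) {i. 1 \<le> i \<and> jump_seq S a i \<le> b}"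
    by (rule inj_jump_seq)
qed

text \<open>As the sequence increases, the counted indices form an initial segment.\<close>

lemma jump_seq_le_iff_count: "1 \<le> i \<Longrightarrow> jump_seq S a i \<le> b \<longleftrightarrow> i \<le> jump_count S a b"
proof -
  let ?A = "{i. 1 \<le> i \<and> jump_seq S a i \<le> b}"
  assume i: "1 \<le> i"
  show ?thesis
  proof
    assume "jump_seq S a i \<le> b"
    then have le: "jump_seq S a j \<le> b" if "j \<le> i" for j
      using jump_seq_le_iff[of j i] that by linarith
    have "{1..i} \<subseteq> ?A"
    proof
      fix j assume "j \<in> {1..i}"
      then show "j \<in> ?A" using le[of j] by simp
    qed
    then have "card {1..i} \<le> card ?A" by (rule card_mono[OF finite_jump_seq_le])
    then show "i \<le> jump_count S a b" by (simp add: jump_count_def)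
  next
    assume le: "i \<le> jump_count S a b"
    show "jump_seq S a i \<le> b"
    proof (rule ccontr)
      assume "\<not> ?thesis"
      then have lt: "j < i" if "jump_seq S a j \<le> b" for j
        using jump_seq_less_iff[of j i] that by linarith
      have "?A \<subseteq> {1..<i}"
      proof
        fix j assume "j \<in> ?A"
        then show "j \<in> {1..<i}" using lt[of j] by simp
      qed
      then have "card ?A \<le> card {1..<i}" by (intro card_mono) auto
      then show False using le i by (simp add: jump_count_def)
    qed
  qed
qed

lemma jumps_eq_image: "jump_times S \<inter> {a<..b} = jump_seq S a ` {1..jump_count S a b}"
proof (intro equalityI subsetI)
  fix c assume c: "c \<in> jump_times S \<inter> {a<..b}"
  define k where "k = jump_count S a c"
  have "jump_seq S a k \<le> c"
  proof (cases "k = 0")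
    case False
    then show ?thesis using jump_seq_le_iff_count[of k c] by (simp add: k_def)
  qed (use c in simp)
  moreover have "c < jump_seq S a (Suc k)"
    using jump_seq_le_iff_count[of "Suc k" c] by (simp add: k_def del: jump_seq.simps)
  moreover have "c = jump_seq S a k"
  proof (rule ccontr)
    assume "c \<noteq> jump_seq S a k"
    then have "c \<in> jump_times S \<inter> {jump_seq S a k<..jump_seq S a (Suc k)}"
      using calculation c by (simp del: jump_seq.simps(2))
    then have "c = jump_seq S a (Suc k)" unfolding jump_seq_jumps by simp
    then show False using calculation by simp
  qed
  moreover have "k \<noteq> 0"
  proof
    assume "k = 0"
    then have "c = a" using \<open>c = jump_seq S a k\<close> by simp
    then show False using c by simp
  qed
  ultimately show "c \<in> jump_seq S a ` {1..jump_count S a b}"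
    using jump_seq_le_iff_count[of k b] c by auto
next
  fix c assume "c \<in> jump_seq S a ` {1..jump_count S a b}"
  then obtain k where k: "c = jump_seq S a k" "1 \<le> k" "k \<le> jump_count S a b" by auto
  obtain i where "k = Suc i" using k(2) by (cases k) auto
  with k have i: "c = jump_seq S a (Suc i)" "Suc i \<le> jump_count S a b" by simp_all
  have "jump_seq S a 0 < c" by (simp add: i del: jump_seq.simps)
  then show "c \<in> jump_times S \<inter> {a<..b}"
    using i jump_seq_Suc_jump[of i] jump_seq_le_iff_count[of "Suc i" b]
    by (simp del: jump_seq.simps(2))
qed

text \<open>The closed interval also counts a jump at a itself, which the sequence started at a does
  not list as a jump.\<close>

lemma num_jumps_eq: "num_jumps S a b = jump_count S a b + (if a \<in> jump_times S \<and> a \<le> b then 1 else 0)"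
proof -
  have "jump_times S \<inter> {a..b} = (jump_times S \<inter> {a<..b}) \<union> (if a \<in> jump_times S \<and> a \<le> b then {a} else {})"
    by (auto simp: less_le)
  moreover have "card (jump_times S \<inter> {a<..b}) = jump_count S a b"
    unfolding jumps_eq_image by (simp add: card_image[OF inj_jump_seq])
  moreover have "finite (jump_times S \<inter> {a<..b})" using a by (rule finite_jumps)
  ultimately show ?thesis unfolding num_jumps_def by (auto simp: card_insert_if)
qed

lemma jump_list_eq: "jump_list S a b = map (jump_seq S a) [0..<Suc (jump_count S a b)]"
proof -
  note fin = finite_jumps[OF a, of b]
  have "sorted_list_of_set (jump_times S \<inter> {a<..b}) = map (jump_seq S a) [1..<Suc (jump_count S a b)]"
  proof (rule strict_sorted_equal)
    show "sorted_wrt (<) (map (jump_seq S a) [1..<Suc (jump_count S a b)])"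
      by (simp add: sorted_wrt_map del: upt_Suc)
    show "sorted_wrt (<) (sorted_list_of_set (jump_times S \<inter> {a<..b}))" by simp
    show "set (sorted_list_of_set (jump_times S \<inter> {a<..b})) = set (map (jump_seq S a) [1..<Suc (jump_count S a b)])"
      unfolding set_sorted_list_of_set[OF fin]
      unfolding jumps_eq_image set_map set_upt atLeastLessThanSuc_atLeastAtMost ..
  qed
  then show ?thesis unfolding jump_list_def by (simp add: upt_conv_Cons del: upt_Suc)
qed

lemma slope_hull_chain: "slope a (hull_chain S a) i = jump_seq S a i"
proof (cases i)
  case (Suc j)
  show ?thesis
    using jump_seq_crossing[of j] jump_seq_V_less[of j]
    by (simp add: Suc hull_chain_def hull_W_def field_simps)
qed simp

lemma hull_chain_in_hull_chains: "hull_chain S a \<in> hull_chains a n"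
  using jump_seq_V_less hull_UV_pos jump_seq_pos a
  by (auto simp: hull_chains_def slope_hull_chain simp del: slope.simps jump_seq.simps)
     (auto simp: hull_chain_def hull_W_def)

lemma triangles_area_eq: "triangles_area S a b = (\<Sum>i=1..jump_count S a b. area_coord a (hull_chain S a) i)"
proof -
  have "triangles_area S a b = (\<Sum>i<jump_count S a b. area_coord a (hull_chain S a) (Suc i))"
    unfolding triangles_area_eq_sum[OF a refl]
    by (intro sum.cong)
       (auto simp: jump_list_eq slope_hull_chain hull_chain_def hull_W_def simp del: upt_Suc slope.simps jump_seq.simps)
  also have "\<dots> = (\<Sum>i=1..jump_count S a b. area_coord a (hull_chain S a) i)"
    by (rule sum.reindex_bij_witness[of _ "\<lambda>i. i - 1" Suc]) auto
  finally show ?thesis .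
qed

end

end

text \<open>The quantity $c\,V(c)^2$ at the successive jumps, which is a Markov chain driven by the coordinates.\<close>

primrec scaled_height :: "(nat \<Rightarrow> real) \<Rightarrow> (nat \<Rightarrow> real) \<Rightarrow> nat \<Rightarrow> real" where
  "scaled_height e t 0 = 2 * e 0 * (t 0)\<^sup>2"
| "scaled_height e t (Suc i) = (scaled_height e t i + 2 * e (Suc i)) * (t (Suc i))\<^sup>2"

text \<open>Twice the area coordinate is the increment of the slope times the squared old height. So
  slope times squared height first gains that amount and is then multiplied by the squared ratio of
  heights: this is the recursion of \<open>scaled_height\<close>.\<close>

lemma hull_chains_coords:
  assumes "w \<in> hull_chains a n" "0 < a" "i \<le> n"
  shows "0 < area_coord a w i" "0 < height_coord a w i" "height_coord a w i < 1"
    and "slope a w i * (snd (w i))\<^sup>2 = scaled_height (area_coord a w) (height_coord a w) i"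
    and "ln (snd (w i)) = ln (snd (w 0)) + (\<Sum>j=1..i. ln (height_coord a w j))"
    and "a \<le> slope a w i"
proof -
  have y: "0 < snd (w j)" if "j \<le> n" for j using assms(1) that by (simp add: hull_chains_def)
  have x0: "0 < fst (w 0)" using assms(1) by (simp add: hull_chains_def)
  have dec: "snd (w (Suc j)) < snd (w j)" "slope a w j < slope a w (Suc j)" if "j < n" for j
    using assms(1) that by (auto simp: hull_chains_def)
  have k: "0 < fst (w 0) + a * snd (w 0)" using x0 y[of 0] assms(2) by (simp add: add_pos_pos)
  show "0 < area_coord a w i"
  proof (cases i)
    case (Suc j)
    have "0 < (slope a w (Suc j) - slope a w j) * (snd (w j))\<^sup>2 / 2"
      using dec(2)[of j] y[of j] assms(3) Suc by (intro divide_pos_pos mult_pos_pos) auto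
    then show ?thesis by (simp add: Suc del: slope.simps)
  qed (use k assms(2) in simp)
  show "0 < height_coord a w i"
    using y[of "i - 1"] y[of i] k assms(2,3) by (cases i) auto
  show "height_coord a w i < 1"
    using y[of "i - 1"] dec(1)[of "i - 1"] k x0 assms(3) by (cases i) auto
  show "slope a w i * (snd (w i))\<^sup>2 = scaled_height (area_coord a w) (height_coord a w) i"
    using assms(3)
  proof (induction i)
    case 0
    show ?case using k assms(2) by (simp add: power2_eq_square)
  next
    case (Suc i)
    then have "scaled_height (area_coord a w) (height_coord a w) i = slope a w i * (snd (w i))\<^sup>2" by simp
    then show ?case using y[of i] Suc.prems
      by (simp add: power_divide del: slope.simps) (simp add: algebra_simps del: slope.simps)
  qed
  show "ln (snd (w i)) = ln (snd (w 0)) + (\<Sum>j=1..i. ln (height_coord a w j))"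
    using assms(3)
  proof (induction i)
    case (Suc i)
    then show ?case using y[of i] y[of "Suc i"] by (simp add: ln_div)
  qed simp
  show "a \<le> slope a w i" using assms(3)
  proof (induction i)
    case (Suc i)
    then show ?case using dec(2)[of i] by simp
  qed simp
qed

lemma ln_slope_eq:
  assumes "w \<in> hull_chains a n" "0 < a" "i \<le> n"
  shows "ln (slope a w i) - ln a = ln (scaled_height (area_coord a w) (height_coord a w) i)
    - ln (scaled_height (area_coord a w) (height_coord a w) 0) - 2 * (\<Sum>j=1..i. ln (height_coord a w j))"
proof -
  have y: "0 < snd (w j)" if "j \<le> n" for j using assms(1) that by (simp add: hull_chains_def)
  have "0 < slope a w i" using hull_chains_coords(6)[OF assms] assms(2) by simp
  then have "ln (scaled_height (area_coord a w) (height_coord a w) i) = ln (slope a w i) + 2 * ln (snd (w i))"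
    using y[OF assms(3)] unfolding hull_chains_coords(4)[OF assms, symmetric]
    by (simp add: ln_mult ln_realpow)
  moreover have "ln (scaled_height (area_coord a w) (height_coord a w) 0) = ln a + 2 * ln (snd (w 0))"
    using y[of 0] assms(2) hull_chains_coords(4)[OF assms(1,2), of 0, symmetric]
    by (simp add: ln_mult ln_realpow del: scaled_height.simps)
  ultimately show ?thesis using hull_chains_coords(5)[OF assms] by (simp del: scaled_height.simps)
qed

section \<open>Change of variables\<close>

text \<open>The substitution e = k^2 / (2 a) is carried out on [0, n] and extended to the half line
  by monotone convergence.\<close>

lemma nn_integral_quadratic_substitution:
  fixes f :: "real \<Rightarrow> ennreal"
  assumes [measurable]: "f \<in> borel_measurable borel" and a: "0 < a"
  shows "(\<integral>\<^sup>+k. f (k\<^sup>2 / (2 * a)) * ennreal (k / a) * indicator {0<..} k \<partial>lborel) = (\<integral>\<^sup>+e. f e * indicator {0<..} e \<partial>lborel)"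
proof -
  let ?g = "\<lambda>k::real. k\<^sup>2 / (2 * a)"
  define F where "F n e = f e * indicator {0..(real n)\<^sup>2 / (2 * a)} e" for n e
  define G where "G n k = f (?g k) * ennreal (k / a) * indicator {0..real n} k" for n k
  have eq: "(\<integral>\<^sup>+e. F (Suc n) e \<partial>lborel) = (\<integral>\<^sup>+k. G (Suc n) k \<partial>lborel)" for n
  proof -
    have "(\<integral>\<^sup>+e. f e * indicator {?g 0..?g (real (Suc n))} e \<partial>lborel) =
        (\<integral>\<^sup>+k. f (?g k) * ennreal (k / a) * indicator {0..real (Suc n)} k \<partial>lborel)"
      using a by (intro nn_integral_substitution_aux) (auto intro!: derivative_eq_intros continuous_intros)
    then show ?thesis by (simp add: F_def G_def)
  qed
  have "(\<integral>\<^sup>+e. f e * indicator {0<..} e \<partial>lborel) = (\<integral>\<^sup>+e. (SUP n. F (Suc n) e) \<partial>lborel)"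
  proof (rule nn_integral_cong_AE)
    show "AE e in lborel. f e * indicator {0<..} e = (SUP n. F (Suc n) e)"
      using AE_lborel_singleton[of 0]
    proof eventually_elim
      case (elim e)
      show ?case
      proof (cases "0 < e")
        case True
        obtain n where n: "sqrt (2 * a * e) \<le> real n" using real_arch_simple by blast
        have "2 * a * e = (sqrt (2 * a * e))\<^sup>2" using a True by simp
        also have "\<dots> \<le> (real (Suc n))\<^sup>2" using n a True by (intro power_mono) auto
        finally have "F (Suc n) e = f e"
          using True a by (simp add: F_def pos_le_divide_eq mult_ac)
        then have "f e \<le> (SUP n. F (Suc n) e)" by (metis SUP_upper UNIV_I)
        moreover have "(SUP n. F (Suc n) e) \<le> f e" by (rule SUP_least) (simp add: F_def indicator_def)
        ultimately show ?thesis using True by simp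
      next
        case False
        then show ?thesis using elim by (simp add: F_def)
      qed
    qed
  qed
  also have "\<dots> = (SUP n. \<integral>\<^sup>+e. F (Suc n) e \<partial>lborel)"
  proof (rule nn_integral_monotone_convergence_SUP)
    show "incseq (\<lambda>n. F (Suc n))"
    proof (intro incseq_SucI le_funI)
      fix n e
      have "(real (Suc n))\<^sup>2 / (2 * a) \<le> (real (Suc (Suc n)))\<^sup>2 / (2 * a)"
        using a by (intro divide_right_mono power_mono) auto
      then show "F (Suc n) e \<le> F (Suc (Suc n)) e"
        unfolding F_def by (intro mult_left_mono) (auto simp: indicator_def simp del: of_nat_Suc)
    qed
  qed (simp add: F_def)
  also have "\<dots> = (SUP n. \<integral>\<^sup>+k. G (Suc n) k \<partial>lborel)" by (simp add: eq)
  also have "\<dots> = (\<integral>\<^sup>+k. (SUP n. G (Suc n) k) \<partial>lborel)"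
    by (rule nn_integral_monotone_convergence_SUP[symmetric])
       (auto simp: G_def incseq_def le_fun_def indicator_def)
  also have "\<dots> = (\<integral>\<^sup>+k. f (?g k) * ennreal (k / a) * indicator {0<..} k \<partial>lborel)"
  proof (rule nn_integral_cong)
    fix k
    show "(SUP n. G (Suc n) k) = f (?g k) * ennreal (k / a) * indicator {0<..} k"
    proof (cases "0 < k")
      case True
      obtain n where n: "k \<le> real n" using real_arch_simple by blast
      then have "G (Suc n) k = f (?g k) * ennreal (k / a)" using True by (simp add: G_def)
      then have "f (?g k) * ennreal (k / a) \<le> (SUP n. G (Suc n) k)" by (metis SUP_upper UNIV_I)
      moreover have "(SUP n. G (Suc n) k) \<le> f (?g k) * ennreal (k / a)"
        by (rule SUP_least) (simp add: G_def indicator_def)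
      ultimately show ?thesis using True by simp
    next
      case False
      then have "G n k = 0" for n using a by (auto simp: G_def indicator_def)
      then show ?thesis using False by simp
    qed
  qed
  finally show ?thesis ..
qed

definition height_density :: "nat \<Rightarrow> real \<Rightarrow> real" where
  "height_density i t = (if 0 < t \<and> t < 1 then (if i = 0 then 1 else 2 * (1 - t)) else 0)"

lemma height_density_nonneg: "0 \<le> height_density i t"
  by (simp add: height_density_def)

lemma height_density_measurable [measurable]: "height_density i \<in> borel_measurable borel"
  unfolding height_density_def by measurable

text \<open>In the variables k = x + a y and t = a y / k the Jacobian of y for fixed k is k / a,
  which is the derivative of the area k^2 / (2 a). Hence the area receives Lebesgue measure and t
  the uniform law.\<close>

lemma first_step_integral:
  fixes \<phi> \<psi> :: "real \<Rightarrow> ennreal"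
  assumes [measurable]: "\<phi> \<in> borel_measurable borel" "\<psi> \<in> borel_measurable borel" and a: "0 < a"
  shows "(\<integral>\<^sup>+z. \<phi> ((fst z + a * snd z)\<^sup>2 / (2 * a)) * \<psi> (a * snd z / (fst z + a * snd z)) *
        indicator {z. 0 < fst z \<and> 0 < snd z} z \<partial>lborel) =
      (\<integral>\<^sup>+e. \<phi> e * indicator {0<..} e \<partial>lborel) * (\<integral>\<^sup>+t. \<psi> t * ennreal (height_density 0 t) \<partial>lborel)"
proof -
  define H where "H z = \<phi> ((fst z + a * snd z)\<^sup>2 / (2 * a)) * \<psi> (a * snd z / (fst z + a * snd z)) *
        (if 0 < fst z \<and> 0 < snd z then 1 else 0)" for z :: "real \<times> real"
  have [measurable]: "H \<in> borel_measurable (lborel \<Otimes>\<^sub>M lborel)"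
    unfolding H_def by measurable
  have "(\<integral>\<^sup>+z. \<phi> ((fst z + a * snd z)\<^sup>2 / (2 * a)) * \<psi> (a * snd z / (fst z + a * snd z)) *
        indicator {z. 0 < fst z \<and> 0 < snd z} z \<partial>lborel) = (\<integral>\<^sup>+z. H z \<partial>(lborel \<Otimes>\<^sub>M lborel))"
    unfolding lborel_prod by (simp add: H_def indicator_def of_bool_def)
  also have "\<dots> = (\<integral>\<^sup>+y. \<integral>\<^sup>+x. H (x, y) \<partial>lborel \<partial>lborel)"
    by (rule lborel_pair.nn_integral_snd[symmetric]) simp
  also have "\<dots> = (\<integral>\<^sup>+y. \<integral>\<^sup>+k. H (k - a * y, y) \<partial>lborel \<partial>lborel)"
  proof (rule nn_integral_cong)
    fix y
    have "(\<integral>\<^sup>+x. H (x, y) \<partial>lborel) = ennreal \<bar>1\<bar> * (\<integral>\<^sup>+k. H (- a * y + 1 * k, y) \<partial>lborel)"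
      by (rule nn_integral_real_affine) auto
    then show "(\<integral>\<^sup>+x. H (x, y) \<partial>lborel) = (\<integral>\<^sup>+k. H (k - a * y, y) \<partial>lborel)" by simp
  qed
  also have "\<dots> = (\<integral>\<^sup>+k. \<integral>\<^sup>+y. H (k - a * y, y) \<partial>lborel \<partial>lborel)"
    by (rule lborel_pair.Fubini') measurable
  also have "\<dots> = (\<integral>\<^sup>+k. (\<phi> (k\<^sup>2 / (2 * a)) * ennreal (k / a) * indicator {0<..} k) *
      (\<integral>\<^sup>+t. \<psi> t * ennreal (height_density 0 t) \<partial>lborel) \<partial>lborel)"
  proof (rule nn_integral_cong)
    fix k
    show "(\<integral>\<^sup>+y. H (k - a * y, y) \<partial>lborel) = (\<phi> (k\<^sup>2 / (2 * a)) * ennreal (k / a) * indicator {0<..} k) *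
      (\<integral>\<^sup>+t. \<psi> t * ennreal (height_density 0 t) \<partial>lborel)"
    proof (cases "0 < k")
      case False
      then have "H (k - a * y, y) = 0" for y
        using a by (auto simp: H_def dest: mult_pos_pos[OF a])
      then show ?thesis using False by simp
    next
      case True
      have "(\<integral>\<^sup>+y. H (k - a * y, y) \<partial>lborel) = ennreal \<bar>k / a\<bar> * (\<integral>\<^sup>+t. H (k - a * (0 + k / a * t), 0 + k / a * t) \<partial>lborel)"
        using True a by (intro nn_integral_real_affine) auto
      also have "(\<integral>\<^sup>+t. H (k - a * (0 + k / a * t), 0 + k / a * t) \<partial>lborel) =
          (\<integral>\<^sup>+t. \<phi> (k\<^sup>2 / (2 * a)) * (\<psi> t * ennreal (height_density 0 t)) \<partial>lborel)"
        using True a by (intro nn_integral_cong) (auto simp: H_def height_density_def zero_less_mult_iff zero_less_divide_iff)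
      also have "\<dots> = \<phi> (k\<^sup>2 / (2 * a)) * (\<integral>\<^sup>+t. \<psi> t * ennreal (height_density 0 t) \<partial>lborel)"
        by (rule nn_integral_cmult) simp
      finally show ?thesis using True a by (simp add: mult_ac)
    qed
  qed
  also have "\<dots> = (\<integral>\<^sup>+k. (\<phi> (k\<^sup>2 / (2 * a)) * ennreal (k / a) * indicator {0<..} k) \<partial>lborel) *
      (\<integral>\<^sup>+t. \<psi> t * ennreal (height_density 0 t) \<partial>lborel)"
    by (rule nn_integral_multc) measurable
  finally show ?thesis using nn_integral_quadratic_substitution[of \<phi> a] a by simp
qed

text \<open>For fixed height y the abscissa is affine in the area e with factor 2 (v - y) / v^2, and
  y = v t contributes another factor v, so the Jacobian is 2 (1 - t). It is free of u, v and s,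
  hence of all earlier vertices.\<close>

lemma next_step_integral:
  fixes \<phi> \<psi> :: "real \<Rightarrow> ennreal"
  assumes [measurable]: "\<phi> \<in> borel_measurable borel" "\<psi> \<in> borel_measurable borel" and v: "0 < v"
  shows "(\<integral>\<^sup>+z. \<phi> (((fst z - u) / (v - snd z) - s) * v\<^sup>2 / 2) * \<psi> (snd z / v) *
        indicator {z. 0 < snd z \<and> snd z < v \<and> s < (fst z - u) / (v - snd z)} z \<partial>lborel) =
      (\<integral>\<^sup>+e. \<phi> e * indicator {0<..} e \<partial>lborel) * (\<integral>\<^sup>+t. \<psi> t * ennreal (height_density (Suc i) t) \<partial>lborel)"
proof -
  define H where "H z = \<phi> (((fst z - u) / (v - snd z) - s) * v\<^sup>2 / 2) * \<psi> (snd z / v) *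
        (if 0 < snd z \<and> snd z < v \<and> s < (fst z - u) / (v - snd z) then 1 else 0)" for z :: "real \<times> real"
  let ?I = "\<integral>\<^sup>+e. \<phi> e * indicator {0<..} e \<partial>lborel"
  have [measurable]: "H \<in> borel_measurable (lborel \<Otimes>\<^sub>M lborel)"
    unfolding H_def by measurable
  have "(\<integral>\<^sup>+z. \<phi> (((fst z - u) / (v - snd z) - s) * v\<^sup>2 / 2) * \<psi> (snd z / v) *
        indicator {z. 0 < snd z \<and> snd z < v \<and> s < (fst z - u) / (v - snd z)} z \<partial>lborel) =
      (\<integral>\<^sup>+z. H z \<partial>(lborel \<Otimes>\<^sub>M lborel))"
    unfolding lborel_prod by (simp add: H_def indicator_def of_bool_def)
  also have "\<dots> = (\<integral>\<^sup>+y. \<integral>\<^sup>+x. H (x, y) \<partial>lborel \<partial>lborel)"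
    by (rule lborel_pair.nn_integral_snd[symmetric]) simp
  also have "\<dots> = (\<integral>\<^sup>+y. ?I * (\<psi> (y / v) * ennreal (if 0 < y \<and> y < v then 2 * (v - y) / v\<^sup>2 else 0)) \<partial>lborel)"
  proof (rule nn_integral_cong)
    fix y
    show "(\<integral>\<^sup>+x. H (x, y) \<partial>lborel) = ?I * (\<psi> (y / v) * ennreal (if 0 < y \<and> y < v then 2 * (v - y) / v\<^sup>2 else 0))"
    proof (cases "0 < y \<and> y < v")
      case False
      then have "H (x, y) = 0" for x by (auto simp: H_def)
      then show ?thesis by (simp add: if_not_P[OF False])
    next
      case True
      define c where "c = 2 * (v - y) / v\<^sup>2"
      have c: "0 < c" using True v by (simp add: c_def)
      have "(\<integral>\<^sup>+x. H (x, y) \<partial>lborel) = ennreal \<bar>c\<bar> * (\<integral>\<^sup>+e. H ((u + s * (v - y)) + c * e, y) \<partial>lborel)"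
        using c by (intro nn_integral_real_affine) auto
      also have "(\<integral>\<^sup>+e. H ((u + s * (v - y)) + c * e, y) \<partial>lborel) = (\<integral>\<^sup>+e. (\<phi> e * indicator {0<..} e) * \<psi> (y / v) \<partial>lborel)"
      proof (rule nn_integral_cong)
        fix e
        have q: "(u + s * (v - y) + c * e - u) / (v - y) = s + 2 * e / v\<^sup>2"
          using True v by (simp add: c_def field_simps)
        have q2: "(s + 2 * e / v\<^sup>2 - s) * v\<^sup>2 / 2 = e" using v by simp
        have q3: "s < s + 2 * e / v\<^sup>2 \<longleftrightarrow> 0 < e" using v by (simp add: zero_less_divide_iff)
        show "H ((u + s * (v - y)) + c * e, y) = (\<phi> e * indicator {0<..} e) * \<psi> (y / v)"
          using True unfolding H_def fst_conv snd_conv q q2 q3 by (simp add: mult_ac indicator_def)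
      qed
      also have "\<dots> = ?I * \<psi> (y / v)" by (rule nn_integral_multc) measurable
      finally show ?thesis using True c by (simp add: c_def mult_ac)
    qed
  qed
  also have "\<dots> = ?I * (\<integral>\<^sup>+y. (\<psi> (y / v) * ennreal (if 0 < y \<and> y < v then 2 * (v - y) / v\<^sup>2 else 0)) \<partial>lborel)"
    by (rule nn_integral_cmult) measurable
  also have "(\<integral>\<^sup>+y. (\<psi> (y / v) * ennreal (if 0 < y \<and> y < v then 2 * (v - y) / v\<^sup>2 else 0)) \<partial>lborel) =
      ennreal \<bar>v\<bar> * (\<integral>\<^sup>+t. (\<psi> ((0 + v * t) / v) * ennreal (if 0 < 0 + v * t \<and> 0 + v * t < v then 2 * (v - (0 + v * t)) / v\<^sup>2 else 0)) \<partial>lborel)"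
    using v by (intro nn_integral_real_affine) auto
  also have "\<dots> = (\<integral>\<^sup>+t. ennreal \<bar>v\<bar> * (\<psi> ((0 + v * t) / v) * ennreal (if 0 < 0 + v * t \<and> 0 + v * t < v then 2 * (v - (0 + v * t)) / v\<^sup>2 else 0)) \<partial>lborel)"
    by (rule nn_integral_cmult[symmetric]) measurable
  also have "\<dots> = (\<integral>\<^sup>+t. \<psi> t * ennreal (height_density (Suc i) t) \<partial>lborel)"
  proof (rule nn_integral_cong)
    fix t
    show "ennreal \<bar>v\<bar> * (\<psi> ((0 + v * t) / v) * ennreal (if 0 < 0 + v * t \<and> 0 + v * t < v then 2 * (v - (0 + v * t)) / v\<^sup>2 else 0)) =
       \<psi> t * ennreal (height_density (Suc i) t)"
    proof (cases "0 < t \<and> t < 1")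
      case True
      have "v * (2 * (v - v * t) / v\<^sup>2) = 2 * (1 - t)" using v by (simp add: power2_eq_square field_simps)
      then have "ennreal v * ennreal (2 * (v - v * t) / v\<^sup>2) = ennreal (2 * (1 - t))"
        using v by (subst ennreal_mult'[symmetric]) auto
      moreover have "0 < v * t" "v * t < v" using v True by auto
      ultimately show ?thesis
        using v True unfolding height_density_def by (simp only: mult.left_commute[of "ennreal \<bar>v\<bar>"]) simp
    next
      case False
      then show ?thesis using v by (auto simp: height_density_def zero_less_mult_iff)
    qed
  qed
  finally show ?thesis .
qed

lemma coords_upd_later:
  assumes "i < j"
  shows "slope a (w(j := z)) i = slope a w i" "area_coord a (w(j := z)) i = area_coord a w i"
    "height_coord a (w(j := z)) i = height_coord a w i"
proof -
  have *: "slope a (w(j := z)) i = slope a w i" if "i < j" for i using that by (cases i) auto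
  show "slope a (w(j := z)) i = slope a w i" "area_coord a (w(j := z)) i = area_coord a w i"
    "height_coord a (w(j := z)) i = height_coord a w i"
    using assms * by (cases i; simp)+
qed

lemma hull_chains_upd_Suc:
  "w(Suc n := z) \<in> hull_chains a (Suc n) \<longleftrightarrow> w \<in> hull_chains a n \<and> 0 < snd z \<and> snd z < snd (w n) \<and>
     slope a w n < (fst z - fst (w n)) / (snd (w n) - snd z)"
  by (auto simp: hull_chains_def le_Suc_eq less_Suc_eq coords_upd_later)

lemma coords_measurable [measurable]:
  assumes "i \<le> n"
  shows "(\<lambda>w. slope a w i) \<in> borel_measurable (PiM {..n} (\<lambda>_. lborel))"
    "(\<lambda>w. area_coord a w i) \<in> borel_measurable (PiM {..n} (\<lambda>_. lborel))"
    "(\<lambda>w. height_coord a w i) \<in> borel_measurable (PiM {..n} (\<lambda>_. lborel))"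
proof -
  have c: "(\<lambda>w. w i) \<in> borel_measurable (PiM {..n} (\<lambda>_. lborel :: (real \<times> real) measure))" if "i \<le> n" for i
    using measurable_component_singleton[of i "{..n}" "\<lambda>_. lborel :: (real \<times> real) measure"] that by simp
  have [measurable]: "(\<lambda>w. fst (w i)) \<in> borel_measurable (PiM {..n} (\<lambda>_. lborel :: (real \<times> real) measure))"
    "(\<lambda>w. snd (w i)) \<in> borel_measurable (PiM {..n} (\<lambda>_. lborel :: (real \<times> real) measure))" if "i \<le> n" for i
    using c[OF that] by measurable
  have [measurable]: "(\<lambda>w. slope a w i) \<in> borel_measurable (PiM {..n} (\<lambda>_. lborel))" if "i \<le> n" for i
    using that by (cases i) simp_all
  show "(\<lambda>w. slope a w i) \<in> borel_measurable (PiM {..n} (\<lambda>_. lborel))"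
    "(\<lambda>w. area_coord a w i) \<in> borel_measurable (PiM {..n} (\<lambda>_. lborel))"
    "(\<lambda>w. height_coord a w i) \<in> borel_measurable (PiM {..n} (\<lambda>_. lborel))"
    using assms by (cases i; simp del: slope.simps)+
qed

lemma hull_chains_measurable [measurable]:
  "Measurable.pred (PiM {..n} (\<lambda>_. lborel)) (\<lambda>w. w \<in> hull_chains a n)"
proof -
  have c: "(\<lambda>w. w i) \<in> borel_measurable (PiM {..n} (\<lambda>_. lborel :: (real \<times> real) measure))" if "i \<le> n" for i
    using measurable_component_singleton[of i "{..n}" "\<lambda>_. lborel :: (real \<times> real) measure"] that by simp
  have [measurable]: "(\<lambda>w. fst (w i)) \<in> borel_measurable (PiM {..n} (\<lambda>_. lborel :: (real \<times> real) measure))"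
    "(\<lambda>w. snd (w i)) \<in> borel_measurable (PiM {..n} (\<lambda>_. lborel :: (real \<times> real) measure))" if "i \<le> n" for i
    using c[OF that] by measurable
  have "Measurable.pred (PiM {..n} (\<lambda>_. lborel)) (\<lambda>w. 0 < fst (w 0) \<and> (\<forall>i\<in>{..n}. 0 < snd (w i)) \<and>
     (\<forall>i\<in>{..<n}. snd (w (Suc i)) < snd (w i) \<and> slope a w i < slope a w (Suc i)))"
    by (intro pred_intros_logic pred_intros_finite borel_measurable_pred_less coords_measurable) (auto simp del: slope.simps)
  then show ?thesis by (simp add: hull_chains_def Ball_def)
qed

text \<open>The last point is integrated out first: given the earlier ones its integral is a
  constant, which is why the product splits.\<close>

theorem chain_change_of_variables:
  fixes \<phi> \<psi> :: "nat \<Rightarrow> real \<Rightarrow> ennreal"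
  assumes m [measurable]: "\<And>i. \<phi> i \<in> borel_measurable borel" "\<And>i. \<psi> i \<in> borel_measurable borel" and a: "0 < a"
  shows "(\<integral>\<^sup>+w. (\<Prod>i\<le>n. \<phi> i (area_coord a w i) * \<psi> i (height_coord a w i)) * indicator (hull_chains a n) w
      \<partial>(PiM {..n} (\<lambda>_. lborel))) =
    (\<Prod>i\<le>n. (\<integral>\<^sup>+e. \<phi> i e * indicator {0<..} e \<partial>lborel) * (\<integral>\<^sup>+t. \<psi> i t * ennreal (height_density i t) \<partial>lborel))"
proof (induction n)
  case 0
  interpret product_sigma_finite "\<lambda>_::nat. lborel :: (real \<times> real) measure" by standard
  define g where "g z = \<phi> 0 ((fst z + a * snd z)\<^sup>2 / (2 * a)) * \<psi> 0 (a * snd z / (fst z + a * snd z)) *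
        indicator {z. 0 < fst z \<and> 0 < snd z} z" for z :: "real \<times> real"
  have [measurable]: "Measurable.pred borel (\<lambda>z :: real \<times> real. z \<in> {z. 0 < fst z \<and> 0 < snd z})"
    by simp
  have [measurable]: "g \<in> borel_measurable lborel"
    unfolding g_def by measurable
  have "(\<integral>\<^sup>+w. (\<Prod>i\<le>0. \<phi> i (area_coord a w i) * \<psi> i (height_coord a w i)) * indicator (hull_chains a 0) w
      \<partial>(PiM {..0} (\<lambda>_. lborel))) = (\<integral>\<^sup>+w. g (w 0) \<partial>(PiM {0::nat} (\<lambda>_. lborel)))"
    by (simp add: g_def hull_chains_def indicator_def)
  also have "\<dots> = (\<integral>\<^sup>+z. g z \<partial>lborel)" by (rule product_nn_integral_singleton) simp
  finally show ?case
    using first_step_integral[of "\<phi> 0" "\<psi> 0" a] a by (simp add: g_def)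
next
  case (Suc n)
  interpret product_sigma_finite "\<lambda>_::nat. lborel :: (real \<times> real) measure" by standard
  let ?F = "\<lambda>n w. (\<Prod>i\<le>n. \<phi> i (area_coord a w i) * \<psi> i (height_coord a w i)) * indicator (hull_chains a n) w"
  let ?c = "\<lambda>i. (\<integral>\<^sup>+e. \<phi> i e * indicator {0<..} e \<partial>lborel) * (\<integral>\<^sup>+t. \<psi> i t * ennreal (height_density i t) \<partial>lborel)"
  have meas: "?F n \<in> borel_measurable (PiM {..n} (\<lambda>_. lborel))" for n
    by (intro borel_measurable_times_ennreal borel_measurable_prod_ennreal measurable_compose[OF coords_measurable(2) m(1)]
        measurable_compose[OF coords_measurable(3) m(2)] borel_measurable_indicator') auto
  have ins: "{..Suc n} = insert (Suc n) {..n}" by auto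
  have "(\<integral>\<^sup>+w. ?F (Suc n) w \<partial>(PiM {..Suc n} (\<lambda>_. lborel))) =
      (\<integral>\<^sup>+w. (\<integral>\<^sup>+z. ?F (Suc n) (w(Suc n := z)) \<partial>lborel) \<partial>(PiM {..n} (\<lambda>_. lborel)))"
    using meas[of "Suc n"] unfolding ins by (intro product_nn_integral_insert) auto
  also have "\<dots> = (\<integral>\<^sup>+w. ?F n w * ?c (Suc n) \<partial>(PiM {..n} (\<lambda>_. lborel)))"
  proof (rule nn_integral_cong)
    fix w
    show "(\<integral>\<^sup>+z. ?F (Suc n) (w(Suc n := z)) \<partial>lborel) = ?F n w * ?c (Suc n)"
    proof (cases "w \<in> hull_chains a n")
      case False
      then show ?thesis by (simp add: hull_chains_upd_Suc indicator_def)
    next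
      case True
      let ?u = "fst (w n)" and ?v = "snd (w n)" and ?s = "slope a w n"
      let ?p = "\<Prod>i\<le>n. \<phi> i (area_coord a w i) * \<psi> i (height_coord a w i)"
      have v: "0 < ?v" using True by (simp add: hull_chains_def)
      have "(\<integral>\<^sup>+z. ?F (Suc n) (w(Suc n := z)) \<partial>lborel) =
        (\<integral>\<^sup>+z. ?p * (\<phi> (Suc n) (((fst z - ?u) / (?v - snd z) - ?s) * ?v\<^sup>2 / 2) * \<psi> (Suc n) (snd z / ?v) *
          indicator {z. 0 < snd z \<and> snd z < ?v \<and> ?s < (fst z - ?u) / (?v - snd z)} z) \<partial>lborel)"
        using True by (intro nn_integral_cong) (simp add: hull_chains_upd_Suc indicator_def coords_upd_later mult_ac)
      also have "\<dots> = ?p * ?c (Suc n)"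
        using next_step_integral[OF m(1)[of "Suc n"] m(2)[of "Suc n"] v, of ?u ?s n]
        by (subst nn_integral_cmult) auto
      finally show ?thesis using True by simp
    qed
  qed
  also have "\<dots> = (\<integral>\<^sup>+w. ?F n w \<partial>(PiM {..n} (\<lambda>_. lborel))) * ?c (Suc n)"
    by (rule nn_integral_multc) (rule meas)
  finally show ?case using Suc by simp
qed

section \<open>Regions swept out by the supporting lines\<close>

definition swept_region :: "real \<Rightarrow> nat \<Rightarrow> (nat \<Rightarrow> real \<times> real) \<Rightarrow> (real \<times> real) set" where
  "swept_region a n w = {(x, y). 0 < x \<and> 0 < y \<and> x + a * y < fst (w 0) + a * snd (w 0)} \<union>
     (\<Union>i<n. open_triangle (w i) (slope a w i) (slope a w (Suc i)))"

definition dyadic_code :: "nat \<Rightarrow> real \<times> real \<Rightarrow> int \<times> int" where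
  "dyadic_code m z = (\<lfloor>2 ^ m * fst z\<rfloor>, \<lfloor>2 ^ m * snd z\<rfloor>)"

definition dyadic_cell :: "nat \<Rightarrow> int \<times> int \<Rightarrow> (real \<times> real) set" where
  "dyadic_cell m \<kappa> = {z. dyadic_code m z = \<kappa>}"

definition tuple_code :: "nat \<Rightarrow> nat \<Rightarrow> (nat \<Rightarrow> real \<times> real) \<Rightarrow> nat \<Rightarrow> int \<times> int" where
  "tuple_code n m w = restrict (\<lambda>i. dyadic_code m (w i)) {..n}"

definition tuple_cell :: "nat \<Rightarrow> nat \<Rightarrow> (nat \<Rightarrow> int \<times> int) \<Rightarrow> (nat \<Rightarrow> real \<times> real) set" where
  "tuple_cell n m \<beta> = (\<Pi>\<^sub>E i\<in>{..n}. dyadic_cell m (\<beta> i))"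

text \<open>A deterministic region that is empty whenever some chain with vertices in the given cells is the
  hull chain, and disjoint from the cells, so that its emptiness is independent of the points in them.\<close>

definition core_region :: "real \<Rightarrow> nat \<Rightarrow> nat \<Rightarrow> (nat \<Rightarrow> int \<times> int) \<Rightarrow> (real \<times> real) set" where
  "core_region a n m \<beta> = interior (\<Inter>w\<in>tuple_cell n m \<beta>. swept_region a n w) - (\<Union>i\<le>n. dyadic_cell m (\<beta> i))"

section \<open>Stability of chains and swept regions on shrinking cells\<close>

lemma eventually_less_tendsto:
  fixes f g :: "'a \<Rightarrow> real"
  assumes "(f \<longlongrightarrow> l) F" "(g \<longlongrightarrow> l') F" "l < l'"
  shows "\<forall>\<^sub>F x in F. f x < g x"
  using order_tendstoD(2)[OF tendsto_diff[OF assms(1,2)], of 0] assms(3) by simp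

lemma slope_tendsto:
  assumes w: "w \<in> hull_chains a n" and lim: "\<And>i. i \<le> n \<Longrightarrow> ((\<lambda>m. W m i) \<longlongrightarrow> w i) F" and i: "i \<le> n"
  shows "((\<lambda>m. slope a (W m) i) \<longlongrightarrow> slope a w i) F"
proof (cases i)
  case (Suc j)
  then have "snd (w (Suc j)) < snd (w j)" using w i by (simp add: hull_chains_def)
  then show ?thesis unfolding Suc slope.simps
    using i Suc by (intro tendsto_intros lim) auto
qed simp

lemma eventually_hull_chains:
  assumes w: "w \<in> hull_chains a n" and lim: "\<And>i. i \<le> n \<Longrightarrow> ((\<lambda>m. W m i) \<longlongrightarrow> w i) F"
  shows "\<forall>\<^sub>F m in F. W m \<in> hull_chains a n"
proof -
  have "\<forall>\<^sub>F m in F. 0 < fst (W m 0)"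
    using w by (intro eventually_less_tendsto[OF tendsto_const tendsto_fst[OF lim]]) (auto simp: hull_chains_def)
  moreover have "\<forall>\<^sub>F m in F. \<forall>i\<in>{..n}. 0 < snd (W m i)"
    using w by (intro eventually_ball_finite ballI eventually_less_tendsto[OF tendsto_const tendsto_snd[OF lim]])
      (auto simp: hull_chains_def)
  moreover have "\<forall>\<^sub>F m in F. \<forall>i\<in>{..<n}. snd (W m (Suc i)) < snd (W m i)"
    using w by (intro eventually_ball_finite ballI eventually_less_tendsto[OF tendsto_snd[OF lim] tendsto_snd[OF lim]])
      (auto simp: hull_chains_def)
  moreover have "\<forall>\<^sub>F m in F. \<forall>i\<in>{..<n}. slope a (W m) i < slope a (W m) (Suc i)"
    using w by (intro eventually_ball_finite ballI eventually_less_tendsto[OF slope_tendsto[OF w lim] slope_tendsto[OF w lim]])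
      (auto simp: hull_chains_def simp del: slope.simps)
  ultimately show ?thesis
    by eventually_elim (auto simp: hull_chains_def simp del: slope.simps)
qed

text \<open>Openness jointly in the chain and the point. The moving point is needed to place a whole
  ball inside the swept regions of all chains in a small cell.\<close>

lemma eventually_swept_region:
  assumes w: "w \<in> hull_chains a n" and lim: "\<And>i. i \<le> n \<Longrightarrow> ((\<lambda>m. W m i) \<longlongrightarrow> w i) F"
    and z: "z \<in> swept_region a n w" and limz: "(Z \<longlongrightarrow> z) F"
  shows "\<forall>\<^sub>F m in F. Z m \<in> swept_region a n (W m)"
proof -
  note lf = tendsto_fst[OF limz] and ls = tendsto_snd[OF limz]
  from z consider "0 < fst z" "0 < snd z" "fst z + a * snd z < fst (w 0) + a * snd (w 0)"
    | i where "i < n" "z \<in> open_triangle (w i) (slope a w i) (slope a w (Suc i))"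
    by (cases z) (auto simp: swept_region_def)
  then show ?thesis
  proof cases
    case 1
    have "\<forall>\<^sub>F m in F. 0 < fst (Z m)" "\<forall>\<^sub>F m in F. 0 < snd (Z m)"
      using 1 by (auto intro: eventually_less_tendsto[OF tendsto_const lf] eventually_less_tendsto[OF tendsto_const ls])
    moreover have "\<forall>\<^sub>F m in F. fst (Z m) + a * snd (Z m) < fst (W m 0) + a * snd (W m 0)"
      using 1 by (intro eventually_less_tendsto[of _ "fst z + a * snd z" _ _ "fst (w 0) + a * snd (w 0)"]
        tendsto_intros lim lf ls) auto
    ultimately show ?thesis
      by eventually_elim (auto simp: swept_region_def case_prod_unfold)
  next
    case (2 i)
    note s = slope_tendsto[OF w lim, of i] slope_tendsto[OF w lim, of "Suc i"]
    have z': "0 < snd z" "snd z < snd (w i)" "slope a w i * (snd (w i) - snd z) < fst z - fst (w i)"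
      "fst z - fst (w i) < slope a w (Suc i) * (snd (w i) - snd z)"
      using 2(2) by (auto simp: open_triangle_def)
    have "\<forall>\<^sub>F m in F. 0 < snd (Z m)" "\<forall>\<^sub>F m in F. snd (Z m) < snd (W m i)"
      using z' 2(1) by (auto intro!: eventually_less_tendsto[OF tendsto_const ls] eventually_less_tendsto[OF ls tendsto_snd[OF lim]])
    moreover have "\<forall>\<^sub>F m in F. slope a (W m) i * (snd (W m i) - snd (Z m)) < fst (Z m) - fst (W m i)"
      using z' 2(1) by (intro eventually_less_tendsto[OF tendsto_mult[OF s(1) tendsto_diff[OF tendsto_snd[OF lim] ls]]
          tendsto_diff[OF lf tendsto_fst[OF lim]]]) auto
    moreover have "\<forall>\<^sub>F m in F. fst (Z m) - fst (W m i) < slope a (W m) (Suc i) * (snd (W m i) - snd (Z m))"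
      using z' 2(1) by (intro eventually_less_tendsto[OF tendsto_diff[OF lf tendsto_fst[OF lim]]
          tendsto_mult[OF s(2) tendsto_diff[OF tendsto_snd[OF lim] ls]]]) auto
    ultimately show ?thesis
    proof eventually_elim
      case (elim m)
      then have "Z m \<in> open_triangle (W m i) (slope a (W m) i) (slope a (W m) (Suc i))"
        by (simp add: open_triangle_def case_prod_unfold del: slope.simps)
      then show ?case using 2(1) unfolding swept_region_def by blast
    qed
  qed
qed

lemma floor_eq_imp_close:
  fixes x y :: real assumes "\<lfloor>2 ^ m * x\<rfloor> = \<lfloor>2 ^ m * y\<rfloor>" shows "\<bar>x - y\<bar> \<le> (1 / 2) ^ m"
proof -
  have "\<bar>2 ^ m * x - 2 ^ m * y\<bar> < 1" using assms by linarith
  then have "2 ^ m * \<bar>x - y\<bar> < 1" by (simp add: abs_mult right_diff_distrib[symmetric])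
  then show ?thesis by (simp add: power_one_over field_simps)
qed

lemma dyadic_code_tendsto:
  assumes "\<And>m. dyadic_code m (Z m) = dyadic_code m z" shows "Z \<longlonglongrightarrow> z"
proof -
  have h: "(\<lambda>m. (1 / 2 :: real) ^ m) \<longlonglongrightarrow> 0" by (intro LIMSEQ_power_zero) simp
  have "(\<lambda>m. fst (Z m) - fst z) \<longlonglongrightarrow> 0"
    using assms by (intro Lim_null_comparison[OF _ h] always_eventually) (auto simp: dyadic_code_def intro: floor_eq_imp_close)
  moreover have "(\<lambda>m. snd (Z m) - snd z) \<longlonglongrightarrow> 0"
    using assms by (intro Lim_null_comparison[OF _ h] always_eventually) (auto simp: dyadic_code_def intro: floor_eq_imp_close)
  ultimately have "(\<lambda>m. (fst (Z m), snd (Z m))) \<longlonglongrightarrow> (fst z, snd z)"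
    by (intro tendsto_Pair) (auto intro: LIM_zero_cancel)
  then show ?thesis by simp
qed

lemma mem_tuple_cell_iff:
  "w \<in> tuple_cell n m \<beta> \<longleftrightarrow> w \<in> extensional {..n} \<and> (\<forall>i\<le>n. dyadic_code m (w i) = \<beta> i)"
  by (auto simp: tuple_cell_def dyadic_cell_def PiE_iff)

lemma mem_tuple_cell_code: "w \<in> extensional {..n} \<Longrightarrow> w \<in> tuple_cell n m (tuple_code n m w)"
  by (simp add: mem_tuple_cell_iff tuple_code_def)

lemma tuple_cell_tendsto:
  assumes "\<And>m. W m \<in> tuple_cell n m (tuple_code n m w)" "i \<le> n"
  shows "(\<lambda>m. W m i) \<longlonglongrightarrow> w i"
  using assms by (intro dyadic_code_tendsto) (auto simp: mem_tuple_cell_iff tuple_code_def)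

lemma eventually_cell_subset_hull_chains:
  assumes w: "w \<in> hull_chains a n" "w \<in> extensional {..n}"
  shows "\<forall>\<^sub>F m in sequentially. tuple_cell n m (tuple_code n m w) \<subseteq> hull_chains a n"
proof -
  \<comment> \<open>A counterexample is chosen from each cell that does not consist of chains, and w
    itself from the others. The choices converge to w, so counterexamples occur only finitely
    often.\<close>
  define W where "W m = (if tuple_cell n m (tuple_code n m w) \<subseteq> hull_chains a n then w
    else SOME w'. w' \<in> tuple_cell n m (tuple_code n m w) \<and> w' \<notin> hull_chains a n)" for m
  have bad: "W m \<in> tuple_cell n m (tuple_code n m w) \<and> W m \<notin> hull_chains a n"
    if "\<not> tuple_cell n m (tuple_code n m w) \<subseteq> hull_chains a n" for m
  proof -
    have "\<exists>w'. w' \<in> tuple_cell n m (tuple_code n m w) \<and> w' \<notin> hull_chains a n" using that by blast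
    from someI_ex[OF this] that show ?thesis by (simp add: W_def)
  qed
  have "W m \<in> tuple_cell n m (tuple_code n m w)" for m
    using bad[of m] mem_tuple_cell_code[OF w(2)] by (cases "tuple_cell n m (tuple_code n m w) \<subseteq> hull_chains a n") (auto simp: W_def)
  then have "\<forall>\<^sub>F m in sequentially. W m \<in> hull_chains a n"
    by (intro eventually_hull_chains[OF w(1)] tuple_cell_tendsto)
  then show ?thesis by (rule eventually_mono) (use bad in blast)
qed

lemma eventually_core_region:
  assumes w: "w \<in> hull_chains a n" "w \<in> extensional {..n}"
    and z: "z \<in> swept_region a n w" "\<And>i. i \<le> n \<Longrightarrow> z \<noteq> w i"
  shows "\<forall>\<^sub>F m in sequentially. z \<in> core_region a n m (tuple_code n m w)"
proof -
  let ?c = "\<lambda>m. tuple_cell n m (tuple_code n m w)"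
  \<comment> \<open>The same selection argument for pairs of a tuple in the cell and a point within
    1 / (m + 1) of z. If no pair is bad, a ball around z lies in all swept regions of the cell, so z
    is interior to their intersection.\<close>
  define bad where "bad m p \<longleftrightarrow> fst p \<in> ?c m \<and> dist (snd p) z < 1 / Suc m \<and> snd p \<notin> swept_region a n (fst p)" for m p
  define p where "p m = (if \<exists>p. bad m p then SOME p. bad m p else (w, z))" for m
  have p: "bad m (p m)" if "\<exists>p. bad m p" for m
    using someI_ex[OF that] that by (simp add: p_def)
  have p_in: "fst (p m) \<in> ?c m" "dist (snd (p m)) z < 1 / Suc m" for m
    using p[of m] mem_tuple_cell_code[OF w(2)] by (cases "\<exists>p. bad m p"; auto simp: bad_def p_def)+
  have "(\<lambda>m. snd (p m)) \<longlonglongrightarrow> z"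
  proof (rule metric_tendsto_imp_tendsto[of "\<lambda>m. 1 / real (Suc m)" 0])
    show "(\<lambda>m. 1 / real (Suc m)) \<longlonglongrightarrow> 0" using LIMSEQ_inverse_real_of_nat by (simp add: inverse_eq_divide)
    show "\<forall>\<^sub>F m in sequentially. dist (snd (p m)) z \<le> dist (1 / real (Suc m)) 0"
      using p_in(2) by (intro always_eventually allI) (simp add: less_imp_le)
  qed
  then have "\<forall>\<^sub>F m in sequentially. snd (p m) \<in> swept_region a n (fst (p m))"
    by (intro eventually_swept_region[where W="\<lambda>m. fst (p m)", OF w(1) _ z(1)])
       (rule tuple_cell_tendsto[OF p_in(1)])
  then have 1: "\<forall>\<^sub>F m in sequentially. z \<in> interior (\<Inter>w'\<in>?c m. swept_region a n w')"
  proof eventually_elim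
    case (elim m)
    have no: "\<not> bad m q" for q
    proof
      assume "bad m q"
      then have "\<exists>p. bad m p" by blast
      from p[OF this] elim show False by (simp add: bad_def)
    qed
    have "ball z (1 / Suc m) \<subseteq> (\<Inter>w'\<in>?c m. swept_region a n w')"
    proof (intro subsetI INT_I)
      fix y w' assume "y \<in> ball z (1 / Suc m)" "w' \<in> ?c m"
      then show "y \<in> swept_region a n w'" using no[of "(w', y)"] by (auto simp: bad_def dist_commute)
    qed
    then show ?case by (rule interiorI[OF open_ball, rotated]) simp
  qed
  have 2: "\<forall>\<^sub>F m in sequentially. \<forall>i\<in>{..n}. dyadic_code m z \<noteq> dyadic_code m (w i)"
  proof (intro eventually_ball_finite ballI)
    fix i assume "i \<in> {..n}"
    then have ne: "z \<noteq> w i" using z by simp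
    \<comment> \<open>If z shared its cell with \<open>w i\<close> at infinitely many levels, this
      sequence would equal z infinitely often and yet converge to \<open>w i\<close>.\<close>
    define Z where "Z m = (if dyadic_code m z = dyadic_code m (w i) then z else w i)" for m
    have "Z \<longlonglongrightarrow> w i" by (rule dyadic_code_tendsto) (simp add: Z_def)
    then have "\<forall>\<^sub>F m in sequentially. Z m \<noteq> z" using ne by (intro tendsto_imp_eventually_ne) auto
    then show "\<forall>\<^sub>F m in sequentially. dyadic_code m z \<noteq> dyadic_code m (w i)"
      by eventually_elim (auto simp: Z_def)
  qed simp
  show ?thesis using 1 2
    by eventually_elim (auto simp: core_region_def tuple_code_def dyadic_cell_def)
qed

section \<open>Area and boundedness of the swept region\<close>

lemma swept_region_measurable [measurable]: "swept_region a n w \<in> sets borel"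
proof -
  have "{(x, y). 0 < x \<and> 0 < y \<and> x + a * y < fst (w 0) + a * snd (w 0)} =
    {z\<in>space borel. 0 < fst z \<and> 0 < snd z \<and> fst z + a * snd z < fst (w 0) + a * snd (w 0)}"
    by (auto simp: case_prod_unfold)
  also have "\<dots> \<in> sets borel" by measurable
  finally show ?thesis unfolding swept_region_def by (intro sets.Un sets.finite_UN triangle_sets) auto
qed

text \<open>Each triangle lies strictly above the line of its own slope through its top and strictly
  below the line of the next slope. Points of an earlier piece that are low enough stay below all
  later lines, so the pieces are disjoint and their areas add.\<close>

lemma emeasure_swept_region:
  assumes w: "w \<in> hull_chains a n" and a: "0 < a"
  shows "emeasure lborel (swept_region a n w) = ennreal (\<Sum>i\<le>n. area_coord a w i)"
proof -
  let ?k = "\<lambda>i. fst (w i) + slope a w i * snd (w i)"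
  define R where "R i = (case i of 0 \<Rightarrow> {(x, y). 0 < x \<and> 0 < y \<and> x + a * y < fst (w 0) + a * snd (w 0)}
    | Suc i \<Rightarrow> open_triangle (w i) (slope a w i) (slope a w (Suc i)))" for i
  have y: "0 < snd (w j)" if "j \<le> n" for j using w that by (simp add: hull_chains_def)
  have dec: "snd (w (Suc j)) < snd (w j)" "slope a w j < slope a w (Suc j)" if "j < n" for j
    using w that by (auto simp: hull_chains_def)
  have k0: "0 < fst (w 0) + a * snd (w 0)" using w y[of 0] a by (simp add: hull_chains_def add_pos_pos)
  have un: "swept_region a n w = (\<Union>i\<le>n. R i)"
  proof -
    have "{..n} = insert 0 (Suc ` {..<n})" using image_Suc_lessThan by (auto simp: atMost_atLeast0 image_iff Suc_le_eq dest: gr0_implies_Suc)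
    then show ?thesis by (simp add: swept_region_def R_def)
  qed
  have line: "fst (w i) + slope a w (Suc i) * snd (w i) = ?k (Suc i)" if "i < n" for i
    using dec(1)[OF that] by (simp add: field_simps)
  have below: "x + slope a w j * y < ?k j" if "(x, y) \<in> R j" "j \<le> n" for x y j
  proof (cases j)
    case 0
    then show ?thesis using that by (simp add: R_def)
  next
    case (Suc i)
    then have "x + slope a w (Suc i) * y < fst (w i) + slope a w (Suc i) * snd (w i)"
      using that by (simp add: R_def open_triangle_def algebra_simps del: slope.simps)
    then show ?thesis using line[of i] that Suc by simp
  qed
  \<comment> \<open>Passing to the next slope rotates the line about a vertex; a point below the old
    line and lower than that vertex is also below the new line.\<close>
  have propagate: "x + slope a w (i + d) * y < ?k (i + d)"
    if "x + slope a w i * y < ?k i" "i + d \<le> n" "y < snd (w (i + d)) \<or> d = 0" for x y i d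
    using that
  proof (induction d)
    case (Suc d)
    have lt: "y < snd (w (Suc (i + d)))" "y < snd (w (i + d))" using Suc.prems dec(1)[of "i + d"] by auto
    have "x + slope a w (i + d) * y < ?k (i + d)" using Suc lt by simp
    moreover have "(slope a w (Suc (i + d)) - slope a w (i + d)) * y \<le> (slope a w (Suc (i + d)) - slope a w (i + d)) * snd (w (i + d))"
      using lt dec(2)[of "i + d"] Suc.prems by (intro mult_left_mono) auto
    ultimately have "x + slope a w (Suc (i + d)) * y < fst (w (i + d)) + slope a w (Suc (i + d)) * snd (w (i + d))"
      by (simp add: algebra_simps del: slope.simps)
    then show ?case using line[of "i + d"] Suc.prems by simp
  qed simp
  have disj: "R i \<inter> R j = {}" if "i < j" "j \<le> n" for i j
  proof (rule ccontr)
    assume "\<not> ?thesis"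
    then obtain x y where xy: "(x, y) \<in> R i" "(x, y) \<in> R j" by auto
    obtain d where j: "j = Suc (i + d)" using less_imp_Suc_add[OF \<open>i < j\<close>] by blast
    have "y < snd (w (i + d))" "slope a w (i + d) * (snd (w (i + d)) - y) < x - fst (w (i + d))"
      using xy(2) by (auto simp: j R_def open_triangle_def simp del: slope.simps)
    moreover have "x + slope a w (i + d) * y < ?k (i + d)"
      using below[OF xy(1)] that j calculation by (intro propagate) auto
    ultimately show False by (simp add: algebra_simps del: slope.simps)
  qed
  have dis: "disjoint_family_on R {..n}"
    unfolding disjoint_family_on_def
  proof (intro ballI impI)
    fix i j assume "i \<in> {..n}" "j \<in> {..n}" "i \<noteq> j"
    then show "R i \<inter> R j = {}" using disj[of i j] disj[of j i] by (cases "i < j") auto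
  qed
  have sets: "R i \<in> sets borel" for i
  proof (cases i)
    case 0
    have "swept_region a 0 w \<in> sets borel" by measurable
    then show ?thesis by (simp add: 0 R_def swept_region_def)
  qed (simp add: R_def)
  have em: "emeasure lborel (R i) = ennreal (area_coord a w i)" if "i \<le> n" for i
  proof (cases i)
    case 0
    let ?K = "fst (w 0) + a * snd (w 0)"
    have "emeasure lborel (R 0) = ennreal ((a - 0) * (?K / a)\<^sup>2 / 2)"
    proof (rule emeasure_by_slices)
      fix y assume "0 < y" "y < ?K / a"
      then have "(\<lambda>x. (x, y)) -` R 0 = {0<..<?K - a * y}" and "0 \<le> ?K - a * y"
        using a by (auto simp: R_def field_simps)
      then have "emeasure lborel ((\<lambda>x. (x, y)) -` R 0) = ennreal (?K - a * y)" by simp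
      also have "?K - a * y = (a - 0) * (?K / a - y)" using a by (simp add: right_diff_distrib)
      finally show "emeasure lborel ((\<lambda>x. (x, y)) -` R 0) = ennreal ((a - 0) * (?K / a - y))" .
    next
      fix y assume "y < 0 \<or> ?K / a < y"
      then show "(\<lambda>x. (x, y)) -` R 0 = {}" using a by (auto simp: R_def field_simps)
    qed (use sets k0 a in auto)
    also have "(a - 0) * (?K / a)\<^sup>2 / 2 = area_coord a w 0" using a by (simp add: power2_eq_square)
    finally show ?thesis by (simp add: 0)
  next
    case (Suc j)
    then show ?thesis
      using emeasure_triangle(3)[of "w j" "slope a w j" "slope a w (Suc j)"] y[of j] dec(2)[of j] that
      by (simp add: R_def less_imp_le del: slope.simps)
  qed
  have "emeasure lborel (swept_region a n w) = (\<Sum>i\<le>n. emeasure lborel (R i))"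
    unfolding un using sets dis by (intro sum_emeasure[symmetric]) auto
  also have "\<dots> = (\<Sum>i\<le>n. ennreal (area_coord a w i))" using em by (intro sum.cong) auto
  also have "\<dots> = ennreal (\<Sum>i\<le>n. area_coord a w i)"
    using hull_chains_coords(1)[OF w a] by (intro sum_ennreal) (auto intro: less_imp_le)
  finally show ?thesis .
qed

text \<open>The Poisson hypotheses on void probabilities concern bounded subsets of the quadrant.
  Abscissas increase along a chain because slopes are positive and heights decrease.\<close>

lemma swept_region_bounded:
  assumes w: "w \<in> hull_chains a n" and a: "0 < a"
  shows "bounded (swept_region a n w)" "swept_region a n w \<subseteq> {(x, y). 0 < x \<and> 0 < y}"
proof -
  have y: "0 < snd (w j)" if "j \<le> n" for j using w that by (simp add: hull_chains_def)
  have dec: "snd (w (Suc j)) < snd (w j)" "slope a w j < slope a w (Suc j)" if "j < n" for j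
    using w that by (auto simp: hull_chains_def)
  have s: "a \<le> slope a w j" if "j \<le> n" for j using hull_chains_coords(6)[OF w a that] .
  have x: "0 < fst (w j)" if "j \<le> n" for j
    using that
  proof (induction j)
    case 0
    then show ?case using w by (simp add: hull_chains_def)
  next
    case (Suc j)
    have "0 < slope a w (Suc j) * (snd (w j) - snd (w (Suc j)))"
      using s[of "Suc j"] a dec(1)[of j] Suc.prems by (intro mult_pos_pos) auto
    also have "\<dots> = fst (w (Suc j)) - fst (w j)" using dec(1)[of j] Suc.prems by simp
    finally show ?case using Suc by simp
  qed
  have tri: "open_triangle (w i) (slope a w i) (slope a w (Suc i)) \<subseteq>
      {(x, y). 0 < x \<and> 0 < y} \<inter> ({0..fst (w i) + slope a w (Suc i) * snd (w i)} \<times> {0..snd (w i)})" if "i < n" for i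
  proof (intro subsetI)
    fix r assume r: "r \<in> open_triangle (w i) (slope a w i) (slope a w (Suc i))"
    obtain p q where pq: "r = (p, q)" by (cases r)
    from r have *: "0 < q" "q < snd (w i)" "slope a w i * (snd (w i) - q) < p - fst (w i)"
      "p - fst (w i) < slope a w (Suc i) * (snd (w i) - q)"
      by (auto simp: open_triangle_def pq)
    have "0 \<le> slope a w i * (snd (w i) - q)" using * s[of i] a that by (intro mult_nonneg_nonneg) auto
    moreover have "slope a w (Suc i) * (snd (w i) - q) \<le> slope a w (Suc i) * snd (w i)"
      using * s[of "Suc i"] a that by (intro mult_left_mono) auto
    ultimately show "r \<in> {(x, y). 0 < x \<and> 0 < y} \<inter> ({0..fst (w i) + slope a w (Suc i) * snd (w i)} \<times> {0..snd (w i)})"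
      using * x[of i] that by (simp add: pq del: slope.simps)
  qed
  let ?K = "fst (w 0) + a * snd (w 0)"
  have zero: "{(x, y). 0 < x \<and> 0 < y \<and> x + a * y < ?K} \<subseteq> {0..?K} \<times> {0..?K / a}"
  proof (intro subsetI)
    fix r assume r: "r \<in> {(x, y). 0 < x \<and> 0 < y \<and> x + a * y < ?K}"
    obtain p q where pq: "r = (p, q)" by (cases r)
    from r have *: "0 < p" "0 < q" "p + a * q < ?K" by (auto simp: pq)
    moreover have "0 < a * q" using * a by simp
    ultimately have "p \<le> ?K" "a * q \<le> ?K" by linarith+
    then show "r \<in> {0..?K} \<times> {0..?K / a}" using a * by (simp add: pq pos_le_divide_eq mult.commute)
  qed
  have bb: "bounded ({p..q} \<times> {r..s})" for p q r s :: real by (intro bounded_Times bounded_closed_interval)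
  show "bounded (swept_region a n w)"
  proof -
    have "bounded (open_triangle (w i) (slope a w i) (slope a w (Suc i)))" if "i < n" for i
      by (rule bounded_subset[OF bb order_trans[OF tri[OF that] Int_lower2]])
    then show ?thesis
      unfolding swept_region_def bounded_Un using bounded_subset[OF bb zero] by (auto intro!: bounded_UN)
  qed
  show "swept_region a n w \<subseteq> {(x, y). 0 < x \<and> 0 < y}"
    unfolding swept_region_def using tri by blast
qed

section \<open>Void probabilities and measurability\<close>

text \<open>The random time is approximated from the right by dyadic numbers, of which only
  countably many occur, and constancy to the right makes the approximation eventually exact.\<close>

lemma right_const_measurable:
  fixes X :: "real \<Rightarrow> 'b \<Rightarrow> real"
  assumes X: "\<And>c. 0 < c \<Longrightarrow> X c \<in> borel_measurable N"
    and rc: "\<And>\<omega> c. \<omega> \<in> space N \<Longrightarrow> 0 < c \<Longrightarrow> \<exists>e>c. \<forall>d\<in>{c..<e}. X d \<omega> = X c \<omega>"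
    and T [measurable]: "T \<in> borel_measurable N" and pos: "\<And>\<omega>. \<omega> \<in> space N \<Longrightarrow> 0 < T \<omega>"
  shows "(\<lambda>\<omega>. X (T \<omega>) \<omega>) \<in> borel_measurable N"
proof (rule borel_measurable_LIMSEQ_metric)
  \<comment> \<open>The value 1 for nonpositive k keeps the parameter in the range where X is known
    to be measurable.\<close>
  let ?r = "\<lambda>m k. if 0 < k then k / 2 ^ m else (1::real)"
  show "(\<lambda>\<omega>. X (?r m (real_of_int (\<lfloor>2 ^ m * T \<omega>\<rfloor> + 1))) \<omega>) \<in> borel_measurable N" for m
  proof (rule measurable_compose_countable[where f="\<lambda>i \<omega>. X (?r m (real_of_int (i + 1))) \<omega>" and g="\<lambda>\<omega>. \<lfloor>2 ^ m * T \<omega>\<rfloor>"])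
    show "(\<lambda>\<omega>. X (?r m (real_of_int (i + 1))) \<omega>) \<in> borel_measurable N" for i
      by (rule X) simp
  qed measurable
  fix \<omega> assume \<omega>: "\<omega> \<in> space N"
  obtain e where e: "e > T \<omega>" "\<forall>d\<in>{T \<omega>..<e}. X d \<omega> = X (T \<omega>) \<omega>"
    using rc[OF \<omega> pos[OF \<omega>]] by blast
  have "(\<lambda>m. (1 / 2 :: real) ^ m) \<longlonglongrightarrow> 0" by (intro LIMSEQ_power_zero) simp
  then have "\<forall>\<^sub>F m in sequentially. (1 / 2) ^ m < e - T \<omega>"
    using e(1) by (intro order_tendstoD) auto
  then have "\<forall>\<^sub>F m in sequentially. X (?r m (real_of_int (\<lfloor>2 ^ m * T \<omega>\<rfloor> + 1))) \<omega> = X (T \<omega>) \<omega>"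
  proof eventually_elim
    case (elim m)
    let ?k = "real_of_int (\<lfloor>2 ^ m * T \<omega>\<rfloor> + 1)"
    have k: "2 ^ m * T \<omega> < ?k" "?k \<le> 2 ^ m * T \<omega> + 1" by linarith+
    have "0 < 2 ^ m * T \<omega>" using pos[OF \<omega>] by simp
    then have "0 < ?k" using k by linarith
    moreover have "T \<omega> \<le> ?k / 2 ^ m" using k by (simp add: field_simps)
    moreover have "?k / 2 ^ m \<le> T \<omega> + (1 / 2) ^ m" using k by (simp add: field_simps power_one_over)
    ultimately show ?case using elim bspec[OF e(2), of "?k / 2 ^ m"] by simp
  qed
  then show "(\<lambda>m. X (?r m (real_of_int (\<lfloor>2 ^ m * T \<omega>\<rfloor> + 1))) \<omega>) \<longlonglongrightarrow> X (T \<omega>) \<omega>"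
    by (rule tendsto_eventually)
qed

section \<open>Countable criteria for heights, jumps and their number\<close>

context quadrant_config
begin

lemma hull_U_right_const:
  assumes c: "0 < c" shows "\<exists>e>c. \<forall>d\<in>{c..<e}. hull_U S d = hull_U S c"
proof -
  obtain e where e: "e > c" "\<forall>d\<in>{c..<e}. hull_V S d = hull_V S c"
    using hull_V_right_const[OF c] by blast
  have "hull_U S d = hull_U S c" if "d \<in> {c..<e}" for d
    using bspec[OF e(2) that] hull_W_eq_iff[of d c] that c by (auto simp: hull_W_def)
  then show ?thesis using e(1) by blast
qed

text \<open>A description by countably many hitting events. For the converse a rational level is
  taken between the minimal level and the next one attained: there only points of the supporting
  line remain, and one of them has height at most y.\<close>

lemma hull_V_le_iff:
  assumes c: "0 < c" and ne: "S \<noteq> {}"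
  shows "hull_V S c \<le> y \<longleftrightarrow> (\<forall>s::rat. (\<exists>p\<in>S. fst p + c * snd p \<le> of_rat s) \<longrightarrow>
    (\<exists>p\<in>S. fst p + c * snd p \<le> of_rat s \<and> snd p \<le> y))"
proof
  note W = hull_W_props[OF c ne]
  assume "hull_V S c \<le> y"
  then show "\<forall>s::rat. (\<exists>p\<in>S. fst p + c * snd p \<le> of_rat s) \<longrightarrow>
    (\<exists>p\<in>S. fst p + c * snd p \<le> of_rat s \<and> snd p \<le> y)"
    using W(1,2) by (intro allI impI bexI[of _ "hull_W S c"]) (force simp: hull_W_def)+
next
  note W = hull_W_props[OF c ne]
  let ?k = "hull_U S c + c * hull_V S c"
  assume *: "\<forall>s::rat. (\<exists>p\<in>S. fst p + c * snd p \<le> of_rat s) \<longrightarrow>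
    (\<exists>p\<in>S. fst p + c * snd p \<le> of_rat s \<and> snd p \<le> y)"
  \<comment> \<open>The points at levels above the minimum by at most 1; being finite in number,
    they leave a gap just above the minimum.\<close>
  define F where "F = {p\<in>S. fst p + c * snd p \<le> ?k + 1 \<and> ?k < fst p + c * snd p}"
  have "finite F" by (rule finite_subset[OF _ finite_below[OF c, of "?k + 1"]]) (auto simp: F_def)
  define s where "s = Min (insert (?k + 1) ((\<lambda>p. fst p + c * snd p) ` F))"
  have fin: "finite (insert (?k + 1) ((\<lambda>p. fst p + c * snd p) ` F))" using \<open>finite F\<close> by simp
  have "s \<in> insert (?k + 1) ((\<lambda>p. fst p + c * snd p) ` F)"
    unfolding s_def using fin by (intro Min_in) auto
  then have "?k < s" by (auto simp: F_def)
  moreover have "s \<le> ?k + 1" "\<forall>p\<in>F. s \<le> fst p + c * snd p"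
    unfolding s_def using fin by (auto intro: Min_le)
  ultimately have s: "?k < s" "s \<le> ?k + 1" "\<forall>p\<in>F. s \<le> fst p + c * snd p" by blast+
  obtain q where q: "?k < of_rat q" "of_rat q < s" using of_rat_dense[OF s(1)] by blast
  have "\<exists>p\<in>S. fst p + c * snd p \<le> of_rat q"
    using W(1) q(1) by (intro bexI[of _ "hull_W S c"]) (auto simp: hull_W_def)
  then obtain p where p: "p \<in> S" "fst p + c * snd p \<le> of_rat q" "snd p \<le> y" using * by blast
  have "p \<notin> F" using s(3) p q by fastforce
  then have "fst p + c * snd p = ?k" using p q s W(2)[OF p(1)] by (auto simp: F_def)
  then show "hull_V S c \<le> y" using W(3)[OF p(1)] p by simp
qed

text \<open>The jumps in (a / 2, a] are finitely many, so without a jump at a some rational just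
  below a has the same height. The bound a / 2 keeps the parameters away from 0.\<close>

lemma jump_time_iff:
  assumes a: "0 < a"
  shows "a \<in> jump_times S \<longleftrightarrow> (\<forall>q::rat. a / 2 < of_rat q \<and> of_rat q < a \<longrightarrow> hull_V S (of_rat q) \<noteq> hull_V S a)"
proof
  assume J: "a \<in> jump_times S"
  show "\<forall>q::rat. a / 2 < of_rat q \<and> of_rat q < a \<longrightarrow> hull_V S (of_rat q) \<noteq> hull_V S a"
  proof (intro allI impI)
    fix q :: rat assume q: "a / 2 < of_rat q \<and> of_rat q < a"
    then have "0 < (of_rat q :: real)" using a by linarith
    then show "hull_V S (of_rat q) \<noteq> hull_V S a"
      using no_jump_iff[of "of_rat q" a] J q by auto
  qed
next
  assume *: "\<forall>q::rat. a / 2 < of_rat q \<and> of_rat q < a \<longrightarrow> hull_V S (of_rat q) \<noteq> hull_V S a"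
  show "a \<in> jump_times S"
  proof (rule ccontr)
    assume a': "a \<notin> jump_times S"
    define F where "F = jump_times S \<inter> {a / 2<..a}"
    have fin: "finite F" unfolding F_def using a by (intro finite_jumps) simp
    define m where "m = Max (insert (a / 2) F)"
    have "m \<in> insert (a / 2) F" unfolding m_def using fin by (intro Max_in) auto
    then have m: "m < a" "a / 2 \<le> m" using a a' by (auto simp: F_def less_le)
    obtain q where q: "m < of_rat q" "of_rat q < a" using of_rat_dense[OF m(1)] by blast
    have "jump_times S \<inter> {of_rat q<..a} = {}"
    proof (rule ccontr)
      assume "\<not> ?thesis"
      then obtain x where x: "x \<in> jump_times S" "of_rat q < x" "x \<le> a" by auto
      then have "x \<in> F" using q m by (auto simp: F_def)
      then have "x \<le> m" unfolding m_def using fin by (intro Max_ge) auto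
      then show False using x q by simp
    qed
    moreover have "0 < (of_rat q :: real)" using q m a by linarith
    ultimately have "hull_V S (of_rat q) = hull_V S a" using no_jump_iff[of "of_rat q" a] q by simp
    then show False using * q m by auto
  qed
qed

text \<open>Every jump produces a new value, and every value persists to the right, hence is seen at
  a rational parameter. A value that starts only at b is seen at b itself, and the value at a
  accounts for the \<open>Suc\<close>.\<close>

lemma card_jumps_eq_card_values:
  assumes a: "0 < a" and ab: "a < b"
  shows "Suc (card (jump_times S \<inter> {a<..b})) = card (hull_V S ` ({a} \<union> {of_rat q |q. a < of_rat q \<and> of_rat q < b} \<union> {b}))"
proof -
  let ?J = "jump_times S \<inter> {a<..b}" and ?D = "{a} \<union> {of_rat q |q. a < of_rat q \<and> of_rat q < b} \<union> {b}"
  have fin: "finite ?J" using a by (rule finite_jumps)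
  have inj: "inj_on (hull_V S) (insert a ?J)"
  proof (rule linorder_inj_onI')
    fix c d assume cd: "c \<in> insert a ?J" "d \<in> insert a ?J" "c < d"
    then have "d \<in> jump_times S \<inter> {c<..d}" "0 < c" using a ab by auto
    then show "hull_V S c \<noteq> hull_V S d" using no_jump_iff[of c d] cd by auto
  qed
  have 1: "hull_V S ` ?D \<subseteq> hull_V S ` insert a ?J"
  proof
    fix v assume "v \<in> hull_V S ` ?D"
    then obtain d where d: "v = hull_V S d" "a \<le> d" "d \<le> b" using ab by auto
    define m where "m = Max (insert a (?J \<inter> {..d}))"
    have m: "m \<in> insert a (?J \<inter> {..d})" unfolding m_def using fin by (intro Max_in) auto
    have "jump_times S \<inter> {m<..d} = {}"
    proof (rule ccontr)
      assume "\<not> ?thesis"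
      then obtain x where x: "x \<in> jump_times S" "m < x" "x \<le> d" by auto
      then have "x \<in> insert a (?J \<inter> {..d})" using m d by auto
      then have "x \<le> m" unfolding m_def using fin by (intro Max_ge) auto
      then show False using x by simp
    qed
    then have "v = hull_V S m" using no_jump_iff[of m d] m d a by auto
    moreover have "m \<in> insert a ?J" using m by auto
    ultimately show "v \<in> hull_V S ` insert a ?J" by (rule image_eqI)
  qed
  have 2: "hull_V S ` insert a ?J \<subseteq> hull_V S ` ?D"
  proof
    fix v assume "v \<in> hull_V S ` insert a ?J"
    then obtain c where c: "v = hull_V S c" "a \<le> c" "c \<le> b" using ab by auto
    show "v \<in> hull_V S ` ?D"
    proof (cases "c = a \<or> c = b")
      case True
      then show ?thesis using c by auto
    next
      case False
      obtain e where e: "e > c" "\<forall>d\<in>{c..<e}. hull_V S d = hull_V S c"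
        using hull_V_right_const[of c] c a by (meson less_le_trans)
      have "c < min e b" using e(1) False c by auto
      from of_rat_dense[OF this] obtain q where q: "c < of_rat q" "of_rat q < min e b" by blast
      then have "hull_V S (of_rat q) = v" using bspec[OF e(2), of "of_rat q"] c by simp
      moreover have "of_rat q \<in> ?D" using q c by auto
      ultimately show ?thesis by blast
    qed
  qed
  have "card (hull_V S ` ?D) = card (hull_V S ` insert a ?J)"
    by (rule arg_cong[where f=card], rule subset_antisym[OF 1 2])
  also have "\<dots> = card (insert a ?J)" by (rule card_image[OF inj])
  also have "\<dots> = Suc (card ?J)" using fin by simp
  finally show ?thesis ..
qed

end

text \<open>Distinct values are counted by their first occurrences in an enumeration; for random f
  the count becomes the size of a set of indices with measurable membership.\<close>

lemma card_image_from_nat_into: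
  assumes "countable D" "D \<noteq> {}"
  shows "card (f ` D) = card {i. \<forall>j<i. f (from_nat_into D j) \<noteq> f (from_nat_into D i)}"
proof -
  let ?I = "{i. \<forall>j<i. f (from_nat_into D j) \<noteq> f (from_nat_into D i)}"
  let ?g = "\<lambda>i. f (from_nat_into D i)"
  have inj: "inj_on ?g ?I"
    by (rule linorder_inj_onI') auto
  have im: "?g ` ?I = f ` D"
  proof (intro equalityI subsetI)
    fix y assume "y \<in> f ` D"
    then have ex: "\<exists>i. ?g i = y" using assms by (metis image_iff range_from_nat_into)
    define i where "i = (LEAST i. ?g i = y)"
    have "?g i = y" unfolding i_def using ex by (rule LeastI_ex)
    moreover have "?g j \<noteq> y" if "j < i" for j using not_less_Least that unfolding i_def by blast
    ultimately show "y \<in> ?g ` ?I" by (intro image_eqI[of _ _ i]) auto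
  next
    fix y assume "y \<in> ?g ` ?I"
    then obtain i where "y = ?g i" by auto
    then show "y \<in> f ` D" using from_nat_into[OF assms(2), of i] by simp
  qed
  show ?thesis using card_image[OF inj] unfolding im .
qed

section \<open>Void and hitting probabilities, almost sure shape\<close>

locale quadrant_poisson = prob_space M for M :: "'w measure" +
  fixes P :: "'w \<Rightarrow> (real \<times> real) set"
  assumes poisson: "unit_poisson_process M first_quadrant P"
begin

lemma config: "\<omega> \<in> space M \<Longrightarrow> quadrant_config (P \<omega>)"
  using poisson by (auto simp: unit_poisson_process_def quadrant_config_def)

lemma card_measurable:
  "A \<in> sets borel \<Longrightarrow> bounded A \<Longrightarrow> (\<lambda>\<omega>. card (P \<omega> \<inter> A)) \<in> measurable M (count_space UNIV)"
  using poisson by (auto simp: unit_poisson_process_def)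

lemma hit_iff_card:
  "\<omega> \<in> space M \<Longrightarrow> bounded A \<Longrightarrow> P \<omega> \<inter> A = {} \<longleftrightarrow> card (P \<omega> \<inter> A) = 0"
  using quadrant_config.locally_finite[OF config] by simp

lemma hit_iff:
  assumes "\<omega> \<in> space M" "bounded A"
  shows "(\<exists>p\<in>A. p \<in> P \<omega>) \<longleftrightarrow> card (P \<omega> \<inter> A) \<noteq> 0"
proof -
  have "(\<exists>p\<in>A. p \<in> P \<omega>) \<longleftrightarrow> P \<omega> \<inter> A \<noteq> {}" by blast
  then show ?thesis using hit_iff_card[OF assms] by simp
qed

lemma hit_measurable:
  assumes A: "A \<in> sets borel" "bounded A"
  shows "Measurable.pred M (\<lambda>\<omega>. \<exists>p\<in>A. p \<in> P \<omega>)"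
proof -
  note [measurable] = card_measurable[OF A]
  have "{\<omega>\<in>space M. \<exists>p\<in>A. p \<in> P \<omega>} = {\<omega>\<in>space M. card (P \<omega> \<inter> A) \<noteq> 0}"
    by (intro Collect_cong conj_cong refl hit_iff A)
  also have "\<dots> \<in> sets M" by simp
  finally show ?thesis by (simp add: pred_def)
qed

lemma void_prob:
  assumes A: "A \<in> sets borel" "bounded A" "A \<subseteq> first_quadrant"
  shows "prob {\<omega>\<in>space M. card (P \<omega> \<inter> A) = 0} = exp (- measure lborel A)"
proof -
  have "\<forall>k. measure M {\<omega>\<in>space M. card (P \<omega> \<inter> A) = k} = measure lborel A ^ k / fact k * exp (- measure lborel A)"
    using poisson A by (auto simp: unit_poisson_process_def)
  from this[rule_format, of 0] show ?thesis by simp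
qed

lemma hit_prob_le:
  assumes A: "A \<in> sets borel" "bounded A" "A \<subseteq> first_quadrant"
  shows "prob {\<omega>\<in>space M. card (P \<omega> \<inter> A) \<noteq> 0} \<le> measure lborel A"
proof -
  note [measurable] = card_measurable[OF A(1,2)]
  have "prob {\<omega>\<in>space M. \<not> card (P \<omega> \<inter> A) = 0} = 1 - prob {\<omega>\<in>space M. card (P \<omega> \<inter> A) = 0}"
    by (rule prob_neg) measurable
  then have "prob {\<omega>\<in>space M. card (P \<omega> \<inter> A) \<noteq> 0} = 1 - exp (- measure lborel A)"
    by (simp add: void_prob[OF A])
  then show ?thesis using exp_ge_add_one_self[of "- measure lborel A"] by simp
qed

text \<open>Counts on disjoint sets are independent, and a set is hit with probability 1 - exp (-
  area), which is at most its area.\<close>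

lemma hit_void_prob_le:
  fixes n :: nat
  assumes B: "\<And>i. i \<le> n \<Longrightarrow> B i \<in> sets borel \<and> bounded (B i) \<and> B i \<subseteq> first_quadrant"
    and R: "R \<in> sets borel" "bounded R" "R \<subseteq> first_quadrant"
    and dB: "\<And>i j. i \<le> n \<Longrightarrow> j \<le> n \<Longrightarrow> i \<noteq> j \<Longrightarrow> B i \<inter> B j = {}"
    and dR: "\<And>i. i \<le> n \<Longrightarrow> B i \<inter> R = {}"
  shows "prob {\<omega>\<in>space M. (\<forall>i\<le>n. P \<omega> \<inter> B i \<noteq> {}) \<and> P \<omega> \<inter> R = {}} \<le>
    (\<Prod>i\<le>n. measure lborel (B i)) * exp (- measure lborel R)"
proof -
  \<comment> \<open>The index \<open>Suc n\<close> carries the region that has to be empty, and C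
    lists the admissible counts.\<close>
  define A where "A i = (if i \<le> n then B i else R)" for i
  define C where "C i = (if i \<le> n then - {0} else {0::nat})" for i
  have A: "A i \<in> sets borel" "bounded (A i)" "A i \<subseteq> first_quadrant" for i
    using B R by (auto simp: A_def)
  have "disjoint_family_on A {..Suc n}"
    unfolding disjoint_family_on_def
  proof (intro ballI impI)
    fix i j assume "i \<in> {..Suc n}" "j \<in> {..Suc n}" "i \<noteq> j"
    then show "A i \<inter> A j = {}" using dB[of i j] dR[of i] dR[of j] by (auto simp: A_def)
  qed
  moreover have "\<forall>(I::nat set) A. finite I \<and> disjoint_family_on A I \<and>
        (\<forall>i\<in>I. A i \<in> sets borel \<and> bounded (A i) \<and> A i \<subseteq> first_quadrant) \<longrightarrow>
        indep_vars (\<lambda>_. count_space UNIV) (\<lambda>i \<omega>. card (P \<omega> \<inter> A i)) I"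
    using poisson unfolding unit_poisson_process_def by (elim conjE) assumption
  ultimately have ind: "indep_vars (\<lambda>_. count_space UNIV) (\<lambda>i \<omega>. card (P \<omega> \<inter> A i)) {..Suc n}"
    using A by simp
  have "{\<omega>\<in>space M. (\<forall>i\<le>n. P \<omega> \<inter> B i \<noteq> {}) \<and> P \<omega> \<inter> R = {}} =
      (\<Inter>i\<in>{..Suc n}. (\<lambda>\<omega>. card (P \<omega> \<inter> A i)) -` C i \<inter> space M)"
  proof (rule set_eqI)
    fix \<omega>
    have "(\<forall>i\<in>{..Suc n}. card (P \<omega> \<inter> A i) \<in> C i) \<longleftrightarrow>
        (\<forall>i\<le>n. card (P \<omega> \<inter> B i) \<noteq> 0) \<and> card (P \<omega> \<inter> R) = 0"
      unfolding atMost_Suc ball_simps by (auto simp: A_def C_def)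
    then show "\<omega> \<in> {\<omega>\<in>space M. (\<forall>i\<le>n. P \<omega> \<inter> B i \<noteq> {}) \<and> P \<omega> \<inter> R = {}} \<longleftrightarrow>
        \<omega> \<in> (\<Inter>i\<in>{..Suc n}. (\<lambda>\<omega>. card (P \<omega> \<inter> A i)) -` C i \<inter> space M)"
      using hit_iff_card[of \<omega>] B R by (cases "\<omega> \<in> space M") (simp_all add: atMost_Suc)
  qed
  also have "prob \<dots> = (\<Prod>i\<in>{..Suc n}. prob ((\<lambda>\<omega>. card (P \<omega> \<inter> A i)) -` C i \<inter> space M))"
    by (rule indep_varsD[OF ind]) auto
  also have "\<dots> = (\<Prod>i\<le>n. prob ((\<lambda>\<omega>. card (P \<omega> \<inter> A i)) -` C i \<inter> space M)) *
      prob ((\<lambda>\<omega>. card (P \<omega> \<inter> A (Suc n))) -` C (Suc n) \<inter> space M)"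
    by simp
  also have "prob ((\<lambda>\<omega>. card (P \<omega> \<inter> A (Suc n))) -` C (Suc n) \<inter> space M) = exp (- measure lborel R)"
    using void_prob[OF R] by (simp add: A_def C_def vimage_def Int_def conj_commute)
  also have "(\<Prod>i\<le>n. prob ((\<lambda>\<omega>. card (P \<omega> \<inter> A i)) -` C i \<inter> space M)) \<le> (\<Prod>i\<le>n. measure lborel (B i))"
  proof (intro prod_mono conjI)
    fix i assume i: "i \<in> {..n}"
    have "(\<lambda>\<omega>. card (P \<omega> \<inter> A i)) -` C i \<inter> space M = {\<omega>\<in>space M. card (P \<omega> \<inter> B i) \<noteq> 0}"
      using i by (auto simp: A_def C_def)
    then show "prob ((\<lambda>\<omega>. card (P \<omega> \<inter> A i)) -` C i \<inter> space M) \<le> measure lborel (B i)"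
      using hit_prob_le[of "B i"] B[of i] i by simp
  qed simp
  finally show ?thesis by (simp add: mult_right_mono)
qed

text \<open>Points of arbitrarily small height keep the hull from ending. The description by
  countably many boxes makes the event measurable.\<close>

definition nice_set :: "'w set" where
  "nice_set = {\<omega>\<in>space M. (\<forall>k::nat. \<not> (\<exists>p\<in>{0} \<times> {0..real k} \<union> {0..real k} \<times> {0}. p \<in> P \<omega>)) \<and>
     (\<forall>k::nat. \<exists>m::nat. \<exists>p\<in>{0..real m} \<times> {0..1 / real (Suc k)}. p \<in> P \<omega>)}"

lemma rectangle_props: "{x..y} \<times> {u..v} \<in> sets borel" "bounded ({x..y} \<times> {u..v})" for x y u v :: real
  by (auto intro!: borel_closed closed_Times bounded_Times)

lemma nice_set_measurable [measurable]: "nice_set \<in> sets M"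
proof -
  have [measurable]: "Measurable.pred M (\<lambda>\<omega>. \<exists>p\<in>{0..real m} \<times> {0..1 / real (Suc k)}. p \<in> P \<omega>)" for m k :: nat
    by (rule hit_measurable) (rule rectangle_props)+
  have [measurable]: "Measurable.pred M (\<lambda>\<omega>. \<exists>p\<in>{0} \<times> {0..real k} \<union> {0..real k} \<times> {0}. p \<in> P \<omega>)" for k :: nat
    using rectangle_props[of 0 0 0 "real k"] rectangle_props[of 0 "real k" 0 0]
    by (intro hit_measurable) auto
  show ?thesis unfolding nice_set_def by measurable
qed

lemma measure_rectangle:
  "measure lborel ({x..y} \<times> {u..v}) = (y - x) * (v - u)" if "x \<le> y" "u \<le> v" for x y u v :: real
proof -
  have "measure lborel ({x..y} \<times> {u..v}) = measure (lborel \<Otimes>\<^sub>M lborel) ({x..y} \<times> {u..v})"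
    by (simp add: lborel_prod)
  also have "\<dots> = (y - x) * (v - u)"
    unfolding measure_def using that
    by (subst lborel.emeasure_pair_measure_Times) (auto simp: enn2real_mult)
  finally show ?thesis .
qed

lemma AE_nice: "AE \<omega> in M. \<omega> \<in> nice_set"
proof -
  have "AE \<omega> in M. \<forall>k::nat. \<not> (\<exists>p\<in>{0} \<times> {0..real k} \<union> {0..real k} \<times> {0}. p \<in> P \<omega>)"
    unfolding AE_all_countable
  proof
    fix k :: nat
    let ?A = "{0::real} \<times> {0..real k} \<union> {0..real k} \<times> {0::real}"
    have A: "?A \<in> sets borel" "bounded ?A" "?A \<subseteq> first_quadrant"
      using rectangle_props[of 0 0 0 "real k"] rectangle_props[of 0 "real k" 0 0]
      by (auto simp: first_quadrant_def)
    note [measurable] = card_measurable[OF A(1,2)]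
    have "measure lborel ?A \<le> measure lborel ({0::real..0} \<times> {0..real k}) + measure lborel ({0..real k} \<times> {0::real..0})"
      using rectangle_props[of 0 0 0 "real k"] rectangle_props[of 0 "real k" 0 0]
      by (simp del: atLeastAtMost_singleton add: atLeastAtMost_singleton[symmetric]) (rule measure_Un_le, auto)
    also have "\<dots> = 0"
      using measure_rectangle[of 0 0 0 "real k"] measure_rectangle[of 0 "real k" 0 0] by simp
    finally have "measure lborel ?A = 0" by (simp add: antisym)
    then have "prob {\<omega>\<in>space M. card (P \<omega> \<inter> ?A) = 0} = 1" using void_prob[OF A] by simp
    then have "AE \<omega> in M. card (P \<omega> \<inter> ?A) = 0" by (subst (asm) prob_Collect_eq_1) auto
    then show "AE \<omega> in M. \<not> (\<exists>p\<in>?A. p \<in> P \<omega>)"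
    proof (rule AE_mp)
      show "AE \<omega> in M. card (P \<omega> \<inter> ?A) = 0 \<longrightarrow> \<not> (\<exists>p\<in>?A. p \<in> P \<omega>)"
        using hit_iff[OF _ A(2)] by (intro AE_I2) simp
    qed
  qed
  moreover have "AE \<omega> in M. \<forall>k::nat. \<exists>m::nat. \<exists>p\<in>{0..real m} \<times> {0..1 / real (Suc k)}. p \<in> P \<omega>"
    unfolding AE_all_countable
  proof
    fix k :: nat
    let ?A = "\<lambda>m. {0..real m} \<times> {0..1 / real (Suc k)}"
    have A: "?A m \<in> sets borel" "bounded (?A m)" "?A m \<subseteq> first_quadrant" for m
      using rectangle_props[of 0 "real m" 0 "1 / real (Suc k)"] by (auto simp: first_quadrant_def)
    have [measurable]: "Measurable.pred M (\<lambda>\<omega>. \<exists>p\<in>?A m. p \<in> P \<omega>)" for m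
      by (rule hit_measurable) (rule A)+
    have meas: "{\<omega>\<in>space M. \<not> (\<exists>m. \<exists>p\<in>?A m. p \<in> P \<omega>)} \<in> sets M" by measurable
    \<comment> \<open>A strip of length m and height 1 / (k + 1) is empty with probability exp (- m
      / (k + 1)), which tends to 0 as m grows.\<close>
    have "prob {\<omega>\<in>space M. \<not> (\<exists>m. \<exists>p\<in>?A m. p \<in> P \<omega>)} \<le> exp (- (1 / real (Suc k)) * real m)" for m
    proof -
      note [measurable] = card_measurable[OF A(1,2)[of m]]
      have "prob {\<omega>\<in>space M. \<not> (\<exists>m. \<exists>p\<in>?A m. p \<in> P \<omega>)} \<le> prob {\<omega>\<in>space M. card (P \<omega> \<inter> ?A m) = 0}"
        using hit_iff[OF _ A(2)[of m]] by (intro finite_measure_mono) (fastforce, measurable)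
      also have "\<dots> = exp (- (1 / real (Suc k)) * real m)"
        unfolding void_prob[OF A] by (subst measure_rectangle) auto
      finally show ?thesis .
    qed
    moreover have "(\<lambda>m. exp (- (1 / real (Suc k)) * real m)) \<longlonglongrightarrow> 0"
    proof -
      have "(\<lambda>m. exp (- (1 / real (Suc k))) ^ m) \<longlonglongrightarrow> 0"
        by (intro LIMSEQ_power_zero) auto
      then show ?thesis by (simp add: exp_of_nat_mult[symmetric] mult.commute)
    qed
    ultimately have "prob {\<omega>\<in>space M. \<not> (\<exists>m. \<exists>p\<in>?A m. p \<in> P \<omega>)} \<le> 0"
      by (intro tendsto_lowerbound[of _ 0 sequentially]) auto
    then have "prob {\<omega>\<in>space M. \<not> (\<exists>m. \<exists>p\<in>?A m. p \<in> P \<omega>)} = 0" by (simp add: antisym)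
    then show "AE \<omega> in M. \<exists>m. \<exists>p\<in>?A m. p \<in> P \<omega>"
      using meas by (subst (asm) prob_Collect_eq_0) auto
  qed
  ultimately show ?thesis
    using AE_space by eventually_elim (simp add: nice_set_def)
qed

lemma nice_in_space: "\<omega> \<in> nice_set \<Longrightarrow> \<omega> \<in> space M"
  by (simp add: nice_set_def)

lemma nonstop:
  assumes \<omega>: "\<omega> \<in> nice_set" shows "nonstop_config (P \<omega>)"
proof -
  interpret quadrant_config "P \<omega>" by (rule config[OF nice_in_space[OF \<omega>]])
  have off: "0 < fst p \<and> 0 < snd p" if p: "p \<in> P \<omega>" for p
  proof -
    obtain k :: nat where k: "max (fst p) (snd p) \<le> real k" using real_arch_simple by blast
    have "p \<notin> {0} \<times> {0..real k} \<union> {0..real k} \<times> {0}" using \<omega> p unfolding nice_set_def by blast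
    then show ?thesis using point_nonneg[OF p] k by (cases p) auto
  qed
  have ne: "P \<omega> \<noteq> {}" using \<omega> unfolding nice_set_def by blast
  show ?thesis
  proof
    fix c :: real assume c: "0 < c"
    let ?u = "hull_U (P \<omega>) c" and ?v = "hull_V (P \<omega>) c"
    have v: "0 < ?v" using off[OF hull_W_props(1)[OF c ne]] by (simp add: hull_W_def)
    then obtain k :: nat where "inverse (real (Suc k)) < ?v" using reals_Archimedean by blast
    moreover obtain m p where "p \<in> {0..real m} \<times> {0..1 / real (Suc k)}" "p \<in> P \<omega>"
      using \<omega> unfolding nice_set_def by blast
    ultimately have p: "p \<in> P \<omega>" "snd p < ?v" by (auto simp: inverse_eq_divide)
    \<comment> \<open>The quotient is the parameter at which p and the vertex of c lie on one line;
      beyond it the lower point p lies below the line through that vertex, which can no longer be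
      the supporting one.\<close>
    define d where "d = max (c + 1) ((fst p - ?u) / (?v - snd p) + 1)"
    have d: "c < d" "(fst p - ?u) / (?v - snd p) < d" by (auto simp: d_def)
    have "hull_V (P \<omega>) d \<noteq> ?v"
    proof
      assume eq: "hull_V (P \<omega>) d = ?v"
      then have "hull_W (P \<omega>) d = hull_W (P \<omega>) c" using hull_W_eq_iff[of d c] c d by simp
      then have "?u + d * ?v \<le> fst p + d * snd p"
        using hull_W_props(2)[of d, OF _ ne p(1)] c d by (simp add: hull_W_def)
      then have "d * (?v - snd p) \<le> fst p - ?u" by (simp add: algebra_simps)
      then show False using d(2) p(2) by (simp add: divide_less_eq)
    qed
    then show "\<exists>d>c. hull_V (P \<omega>) d \<noteq> hull_V (P \<omega>) c" using d by blast
  qed (use off in auto)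
qed

section \<open>Measurability of vertices, count and area\<close>

lemma strip_hit_measurable:
  assumes c: "0 < c"
  shows "Measurable.pred M (\<lambda>\<omega>. \<exists>p\<in>P \<omega>. fst p + c * snd p \<le> s \<and> snd p \<le> y)"
proof -
  let ?A = "{p. 0 \<le> fst p \<and> 0 \<le> snd p \<and> fst p + c * snd p \<le> s \<and> snd p \<le> y}"
  have "?A = {p\<in>space borel. 0 \<le> fst p \<and> 0 \<le> snd p \<and> fst p + c * snd p \<le> s \<and> snd p \<le> y}" by simp
  also have "\<dots> \<in> sets borel" by measurable
  finally have A1: "?A \<in> sets borel" .
  have A2: "bounded ?A"
  proof (rule bounded_subset[OF bounded_Times[OF bounded_closed_interval[of 0 s] bounded_closed_interval[of 0 y]]], rule subsetI)
    fix p assume p: "p \<in> ?A"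
    then have "0 \<le> c * snd p" using c by simp
    then have "fst p \<le> s" using p by simp
    then show "p \<in> {0..s} \<times> {0..y}" using p by (cases p) auto
  qed
  have "{\<omega>\<in>space M. \<exists>p\<in>?A. p \<in> P \<omega>} = {\<omega>\<in>space M. \<exists>p\<in>P \<omega>. fst p + c * snd p \<le> s \<and> snd p \<le> y}"
    using quadrant_config.point_nonneg[OF config] by blast
  then show ?thesis using hit_measurable[OF A1 A2] by (simp add: pred_def)
qed

lemma line_hit_measurable:
  assumes c: "0 < c"
  shows "Measurable.pred M (\<lambda>\<omega>. \<exists>p\<in>P \<omega>. fst p + c * snd p \<le> s)"
proof -
  have "snd p \<le> s / c" if "\<omega> \<in> space M" "p \<in> P \<omega>" "fst p + c * snd p \<le> s" for \<omega> p
    using that c quadrant_config.point_nonneg[OF config[OF that(1)] that(2)] by (simp add: pos_le_divide_eq mult.commute)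
  then have "{\<omega>\<in>space M. \<exists>p\<in>P \<omega>. fst p + c * snd p \<le> s} = {\<omega>\<in>space M. \<exists>p\<in>P \<omega>. fst p + c * snd p \<le> s \<and> snd p \<le> s / c}"
    by blast
  then show ?thesis using strip_hit_measurable[OF c, of s "s / c"] by (simp add: pred_def)
qed

lemma empty_measurable [measurable]: "Measurable.pred M (\<lambda>\<omega>. P \<omega> = {})"
proof -
  have "P \<omega> = {} \<longleftrightarrow> (\<forall>k::nat. \<not> (\<exists>p\<in>P \<omega>. fst p + 1 * snd p \<le> real k))" for \<omega>
    using real_arch_simple by blast
  moreover have "Measurable.pred M (\<lambda>\<omega>. \<forall>k::nat. \<not> (\<exists>p\<in>P \<omega>. fst p + 1 * snd p \<le> real k))"
    using line_hit_measurable[of 1] by (intro pred_intros_countable pred_intros_logic) simp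
  ultimately show ?thesis by simp
qed

lemma hull_V_measurable:
  assumes c: "0 < c" shows "(\<lambda>\<omega>. hull_V (P \<omega>) c) \<in> borel_measurable M"
  unfolding borel_measurable_iff_le
proof
  fix y
  note [measurable] = strip_hit_measurable[OF c] line_hit_measurable[OF c]
  \<comment> \<open>The empty configuration is split off: there the height is a fixed default
    value.\<close>
  have "{\<omega>\<in>space M. hull_V (P \<omega>) c \<le> y} = {\<omega>\<in>space M. if P \<omega> = {} then hull_V {} c \<le> y else
    (\<forall>s::rat. (\<exists>p\<in>P \<omega>. fst p + c * snd p \<le> of_rat s) \<longrightarrow> (\<exists>p\<in>P \<omega>. fst p + c * snd p \<le> of_rat s \<and> snd p \<le> y))}"
  proof (intro Collect_cong conj_cong refl)
    fix \<omega> assume \<omega>: "\<omega> \<in> space M"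
    show "hull_V (P \<omega>) c \<le> y \<longleftrightarrow> (if P \<omega> = {} then hull_V {} c \<le> y else
      (\<forall>s::rat. (\<exists>p\<in>P \<omega>. fst p + c * snd p \<le> of_rat s) \<longrightarrow> (\<exists>p\<in>P \<omega>. fst p + c * snd p \<le> of_rat s \<and> snd p \<le> y)))"
      using quadrant_config.hull_V_le_iff[OF config[OF \<omega>] c, of y] by (cases "P \<omega> = {}") simp_all
  qed
  also have "\<dots> \<in> sets M" by measurable
  finally show "{\<omega>\<in>space M. hull_V (P \<omega>) c \<le> y} \<in> sets M" .
qed

text \<open>The level U + c V is a minimum, so that being at most s is a single hitting event;
  subtracting c V leaves the abscissa.\<close>

lemma hull_U_measurable:
  assumes c: "0 < c" shows "(\<lambda>\<omega>. hull_U (P \<omega>) c) \<in> borel_measurable M"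
proof -
  note [measurable] = line_hit_measurable[OF c] hull_V_measurable[OF c]
  define k where "k \<omega> = (if P \<omega> = {} then hull_U {} c + c * hull_V {} c else hull_U (P \<omega>) c + c * hull_V (P \<omega>) c)" for \<omega>
  have "k \<in> borel_measurable M"
    unfolding borel_measurable_iff_le
  proof
    fix s
    have "k \<omega> \<le> s \<longleftrightarrow> (if P \<omega> = {} then hull_U {} c + c * hull_V {} c \<le> s else (\<exists>p\<in>P \<omega>. fst p + c * snd p \<le> s))"
      if "\<omega> \<in> space M" for \<omega>
    proof (cases "P \<omega> = {}")
      case False
      note W = quadrant_config.hull_W_props[OF config[OF that] c False]
      have "k \<omega> \<le> s \<longleftrightarrow> (\<exists>p\<in>P \<omega>. fst p + c * snd p \<le> s)"
      proof
        assume "k \<omega> \<le> s"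
        then show "\<exists>p\<in>P \<omega>. fst p + c * snd p \<le> s"
          using W(1) False by (intro bexI[of _ "hull_W (P \<omega>) c"]) (auto simp: k_def hull_W_def)
      next
        assume "\<exists>p\<in>P \<omega>. fst p + c * snd p \<le> s"
        then obtain p where "p \<in> P \<omega>" "fst p + c * snd p \<le> s" by blast
        then show "k \<omega> \<le> s" using W(2)[of p] False by (simp add: k_def)
      qed
      then show ?thesis using False by simp
    qed (simp add: k_def)
    then have "{\<omega>\<in>space M. k \<omega> \<le> s} = {\<omega>\<in>space M. if P \<omega> = {} then hull_U {} c + c * hull_V {} c \<le> s
        else (\<exists>p\<in>P \<omega>. fst p + c * snd p \<le> s)}" by blast
    also have "\<dots> \<in> sets M" by measurable
    finally show "{\<omega>\<in>space M. k \<omega> \<le> s} \<in> sets M" .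
  qed
  moreover have "hull_U (P \<omega>) c = k \<omega> - c * hull_V (P \<omega>) c" for \<omega> by (simp add: k_def)
  ultimately show ?thesis by simp
qed

end

context quadrant_poisson
begin

text \<open>Configuration and parameter may both vary with x: this serves the area on the product
  with the parameter line and the vertices at random jump times.\<close>

lemma hull_V_joint_measurable:
  assumes [measurable]: "h \<in> measurable N M" "T \<in> borel_measurable N" and pos: "\<And>x. x \<in> space N \<Longrightarrow> 0 < T x"
  shows "(\<lambda>x. hull_V (P (h x)) (T x)) \<in> borel_measurable N"
    and "(\<lambda>x. hull_U (P (h x)) (T x)) \<in> borel_measurable N"
proof -
  have h: "h x \<in> space M" if "x \<in> space N" for x using measurable_space[OF assms(1) that] .
  show "(\<lambda>x. hull_V (P (h x)) (T x)) \<in> borel_measurable N"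
  proof (rule right_const_measurable[where X="\<lambda>c x. hull_V (P (h x)) c"])
    fix c :: real assume c: "0 < c"
    show "(\<lambda>x. hull_V (P (h x)) c) \<in> borel_measurable N"
      by (rule measurable_compose[OF assms(1) hull_V_measurable[OF c]])
    fix x assume "x \<in> space N"
    show "\<exists>e>c. \<forall>d\<in>{c..<e}. hull_V (P (h x)) d = hull_V (P (h x)) c"
      by (rule quadrant_config.hull_V_right_const[OF config[OF h[OF \<open>x \<in> space N\<close>]] c])
  qed (use pos in simp_all)
  show "(\<lambda>x. hull_U (P (h x)) (T x)) \<in> borel_measurable N"
  proof (rule right_const_measurable[where X="\<lambda>c x. hull_U (P (h x)) c"])
    fix c :: real assume c: "0 < c"
    show "(\<lambda>x. hull_U (P (h x)) c) \<in> borel_measurable N"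
      by (rule measurable_compose[OF assms(1) hull_U_measurable[OF c]])
    fix x assume "x \<in> space N"
    show "\<exists>e>c. \<forall>d\<in>{c..<e}. hull_U (P (h x)) d = hull_U (P (h x)) c"
      by (rule quadrant_config.hull_U_right_const[OF config[OF h[OF \<open>x \<in> space N\<close>]] c])
  qed (use pos in simp_all)
qed

lemma jump_time_measurable:
  assumes a: "0 < a" shows "Measurable.pred M (\<lambda>\<omega>. a \<in> jump_times (P \<omega>))"
proof -
  \<comment> \<open>The maximum equals q wherever the criterion looks at q, and gives every rational
    a positive parameter.\<close>
  have [measurable]: "(\<lambda>\<omega>. hull_V (P \<omega>) (max (a / 2) (of_rat q))) \<in> borel_measurable M" for q
    using a by (intro hull_V_measurable) (simp add: less_max_iff_disj)
  have [measurable]: "(\<lambda>\<omega>. hull_V (P \<omega>) a) \<in> borel_measurable M" using a by (rule hull_V_measurable)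
  have "{\<omega>\<in>space M. a \<in> jump_times (P \<omega>)} = {\<omega>\<in>space M. \<forall>q::rat. a / 2 < of_rat q \<and> of_rat q < a \<longrightarrow>
      hull_V (P \<omega>) (max (a / 2) (of_rat q)) \<noteq> hull_V (P \<omega>) a}"
  proof (intro Collect_cong conj_cong refl)
    fix \<omega> assume "\<omega> \<in> space M"
    note J = quadrant_config.jump_time_iff[OF config[OF this] a]
    show "a \<in> jump_times (P \<omega>) \<longleftrightarrow> (\<forall>q::rat. a / 2 < of_rat q \<and> of_rat q < a \<longrightarrow>
      hull_V (P \<omega>) (max (a / 2) (of_rat q)) \<noteq> hull_V (P \<omega>) a)"
      unfolding J by (auto simp: max_def)
  qed
  also have "\<dots> \<in> sets M" by measurable
  finally show ?thesis by (simp add: pred_def)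
qed

lemma num_jumps_measurable:
  assumes a: "0 < a" and ab: "a < b"
  shows "(\<lambda>\<omega>. real (num_jumps (P \<omega>) a b)) \<in> borel_measurable M"
proof -
  define D where "D = {a} \<union> {of_rat q |q. a < of_rat q \<and> of_rat q < b} \<union> {b}"
  have cD: "countable D" "D \<noteq> {}" unfolding D_def by (auto simp: setcompr_eq_image)
  have "a \<le> x" if "x \<in> D" for x using that ab by (auto simp: D_def)
  then have pos: "0 < from_nat_into D i" for i using from_nat_into[OF cD(2), of i] a by (meson less_le_trans)
  have [measurable]: "(\<lambda>\<omega>. hull_V (P \<omega>) (from_nat_into D i)) \<in> borel_measurable M" for i
    using pos by (rule hull_V_measurable)
  note [measurable] = jump_time_measurable[OF a]
  have eq: "real (num_jumps (P \<omega>) a b) = (if a \<in> jump_times (P \<omega>) then 1 else 0) +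
    real (card {i. \<forall>j<i. hull_V (P \<omega>) (from_nat_into D j) \<noteq> hull_V (P \<omega>) (from_nat_into D i)}) - 1"
    if \<omega>: "\<omega> \<in> space M" for \<omega>
  proof -
    interpret quadrant_config "P \<omega>" by (rule config[OF \<omega>])
    have "jump_times (P \<omega>) \<inter> {a..b} = (jump_times (P \<omega>) \<inter> {a<..b}) \<union> (if a \<in> jump_times (P \<omega>) then {a} else {})"
      using ab by (auto simp: less_le)
    then have "num_jumps (P \<omega>) a b = card (jump_times (P \<omega>) \<inter> {a<..b}) + (if a \<in> jump_times (P \<omega>) then 1 else 0)"
      unfolding num_jumps_def using finite_jumps[OF a, of b] by (auto simp: card_insert_if)
    moreover have "Suc (card (jump_times (P \<omega>) \<inter> {a<..b})) =
      card {i. \<forall>j<i. hull_V (P \<omega>) (from_nat_into D j) \<noteq> hull_V (P \<omega>) (from_nat_into D i)}"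
      unfolding card_jumps_eq_card_values[OF a ab] D_def[symmetric] by (rule card_image_from_nat_into[OF cD])
    ultimately show ?thesis by simp
  qed
  have "(\<lambda>\<omega>. (if a \<in> jump_times (P \<omega>) then 1 else 0) +
    real (card {i. \<forall>j<i. hull_V (P \<omega>) (from_nat_into D j) \<noteq> hull_V (P \<omega>) (from_nat_into D i)}) - 1)
    \<in> borel_measurable M"
    by measurable
  then show ?thesis by (subst measurable_cong[OF eq])
qed

lemma triangles_area_measurable:
  assumes a: "0 < a" and ab: "a < b"
  shows "(\<lambda>\<omega>. triangles_area (P \<omega>) a b) \<in> borel_measurable M"
proof -
  have [measurable]: "(\<lambda>x. hull_V (P (fst x)) (max a (snd x))) \<in> borel_measurable (M \<Otimes>\<^sub>M lborel)"
    using a by (intro hull_V_joint_measurable) (auto simp: less_max_iff_disj)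
  have "0 < b" using a ab by simp
  note [measurable] = hull_V_measurable[OF \<open>0 < b\<close>]
  have eq: "triangles_area (P \<omega>) a b = (\<integral>c. (if a \<le> c \<and> c < b \<and> hull_V (P \<omega>) (max a c) \<noteq> hull_V (P \<omega>) b
      then (hull_V (P \<omega>) (max a c))\<^sup>2 else 0) \<partial>lborel) / 2" if \<omega>: "\<omega> \<in> space M" for \<omega>
    unfolding quadrant_config.triangles_area_eq_integral[OF config[OF \<omega>] a less_imp_le[OF ab]]
    by (intro arg_cong[where f="\<lambda>x. x / 2"] Bochner_Integration.integral_cong) (auto simp: max_def)
  have "(\<lambda>\<omega>. (\<integral>c. (if a \<le> c \<and> c < b \<and> hull_V (P \<omega>) (max a c) \<noteq> hull_V (P \<omega>) b
      then (hull_V (P \<omega>) (max a c))\<^sup>2 else 0) \<partial>lborel) / 2) \<in> borel_measurable M"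
  proof (intro borel_measurable_divide lborel.borel_measurable_lebesgue_integral)
    have "(\<lambda>x. if a \<le> snd x \<and> snd x < b \<and> hull_V (P (fst x)) (max a (snd x)) \<noteq> hull_V (P (fst x)) b
        then (hull_V (P (fst x)) (max a (snd x)))\<^sup>2 else 0) \<in> borel_measurable (M \<Otimes>\<^sub>M lborel)"
      by measurable
    then show "(\<lambda>(\<omega>, c). if a \<le> c \<and> c < b \<and> hull_V (P \<omega>) (max a c) \<noteq> hull_V (P \<omega>) b
        then (hull_V (P \<omega>) (max a c))\<^sup>2 else 0) \<in> borel_measurable (M \<Otimes>\<^sub>M lborel)"
      by (simp add: case_prod_unfold)
  qed simp
  then show ?thesis by (subst measurable_cong[OF eq])
qed

text \<open>Outside the almost sure event, where the recursion need not yield jumps, a constant is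
  used so that the variable is measurable on the whole space.\<close>

definition jump_rv :: "real \<Rightarrow> nat \<Rightarrow> 'w \<Rightarrow> real" where
  "jump_rv a i \<omega> = (if \<omega> \<in> nice_set then jump_seq (P \<omega>) a i else a)"

definition chain_rv :: "real \<Rightarrow> 'w \<Rightarrow> nat \<Rightarrow> real \<times> real" where
  "chain_rv a \<omega> i = (if \<omega> \<in> nice_set then hull_chain (P \<omega>) a i else (0, 0))"

lemma jump_rv_ge:
  assumes a: "0 < a" shows "a \<le> jump_rv a i \<omega>"
proof (cases "\<omega> \<in> nice_set")
  case True
  interpret nonstop_config "P \<omega>" by (rule nonstop[OF True])
  have "jump_seq (P \<omega>) a 0 \<le> jump_seq (P \<omega>) a i" using jump_seq_le_iff[OF a, of 0 i] by simp
  then show ?thesis using True by (simp add: jump_rv_def)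
qed (simp add: jump_rv_def)

text \<open>The next jump comes before s exactly when some rational between the current jump and s
  has a height different from the current one; the current jump is measurable by induction.\<close>

lemma jump_rv_measurable:
  assumes a: "0 < a" shows "jump_rv a i \<in> borel_measurable M"
proof (induction i)
  case 0
  have "jump_rv a 0 = (\<lambda>_. a)" by (simp add: jump_rv_def fun_eq_iff)
  then show ?case by simp
next
  case (Suc i)
  note [measurable] = Suc
  have pos: "0 < jump_rv a i \<omega>" for \<omega> using jump_rv_ge[OF a, of i \<omega>] a by linarith
  have [measurable]: "(\<lambda>\<omega>. hull_V (P \<omega>) (jump_rv a i \<omega>)) \<in> borel_measurable M"
    using pos by (intro hull_V_joint_measurable(1)[of "\<lambda>x. x"]) auto
  have [measurable]: "(\<lambda>\<omega>. hull_V (P \<omega>) (max a (of_rat q))) \<in> borel_measurable M" for q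
    using a by (intro hull_V_measurable) (simp add: less_max_iff_disj)
  show ?case
    unfolding borel_measurable_iff_less
  proof
    fix s
    have "{\<omega>\<in>space M. jump_rv a (Suc i) \<omega> < s} = {\<omega>\<in>space M. if \<omega> \<in> nice_set then
      (\<exists>q::rat. jump_rv a i \<omega> < of_rat q \<and> of_rat q < s \<and> hull_V (P \<omega>) (max a (of_rat q)) \<noteq> hull_V (P \<omega>) (jump_rv a i \<omega>))
      else a < s}"
    proof (intro Collect_cong conj_cong refl)
      fix \<omega> assume "\<omega> \<in> space M"
      show "jump_rv a (Suc i) \<omega> < s \<longleftrightarrow> (if \<omega> \<in> nice_set then
        (\<exists>q::rat. jump_rv a i \<omega> < of_rat q \<and> of_rat q < s \<and> hull_V (P \<omega>) (max a (of_rat q)) \<noteq> hull_V (P \<omega>) (jump_rv a i \<omega>))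
        else a < s)"
      proof (cases "\<omega> \<in> nice_set")
        case False
        then show ?thesis by (simp add: jump_rv_def)
      next
        case True
        interpret nonstop_config "P \<omega>" by (rule nonstop[OF True])
        let ?T = "jump_seq (P \<omega>) a"
        have T: "jump_rv a j \<omega> = ?T j" for j using True by (simp add: jump_rv_def)
        have ge: "a \<le> ?T j" for j using jump_rv_ge[OF a, of j \<omega>] by (simp add: T)
        have "?T (Suc i) < s \<longleftrightarrow> (\<exists>q::rat. ?T i < of_rat q \<and> of_rat q < s \<and> hull_V (P \<omega>) (max a (of_rat q)) \<noteq> hull_V (P \<omega>) (?T i))"
        proof
          assume "?T (Suc i) < s"
          from of_rat_dense[OF this] obtain q where q: "?T (Suc i) < of_rat q" "of_rat q < s" by blast
          have m: "max a (of_rat q) = of_rat q" using q ge[of "Suc i"] by linarith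
          have "hull_V (P \<omega>) (of_rat q) \<le> hull_V (P \<omega>) (?T (Suc i))"
            using q jump_seq_pos[OF a, of "Suc i"] by (intro hull_V_antimono) auto
          then have "hull_V (P \<omega>) (of_rat q) \<noteq> hull_V (P \<omega>) (?T i)"
            using jump_seq_V_less[OF a, of i] by linarith
          then show "\<exists>q::rat. ?T i < of_rat q \<and> of_rat q < s \<and> hull_V (P \<omega>) (max a (of_rat q)) \<noteq> hull_V (P \<omega>) (?T i)"
            using q m jump_seq_less_Suc[OF a, of i] by (intro exI[of _ q]) simp
        next
          assume "\<exists>q::rat. ?T i < of_rat q \<and> of_rat q < s \<and> hull_V (P \<omega>) (max a (of_rat q)) \<noteq> hull_V (P \<omega>) (?T i)"
          then obtain q where q: "?T i < of_rat q" "of_rat q < s" "hull_V (P \<omega>) (max a (of_rat q)) \<noteq> hull_V (P \<omega>) (?T i)"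
            by blast
          have m: "max a (of_rat q) = of_rat q" using q ge[of i] by linarith
          have "\<not> of_rat q < ?T (Suc i)"
          proof
            assume lt: "of_rat q < ?T (Suc i)"
            show False using jump_seq_V_const[OF a less_imp_le[OF q(1)] lt] q(3) m by simp
          qed
          then show "?T (Suc i) < s" using q by linarith
        qed
        then show ?thesis using True by (simp only: T if_True)
      qed
    qed
    also have "\<dots> \<in> sets M" by measurable
    finally show "{\<omega>\<in>space M. jump_rv a (Suc i) \<omega> < s} \<in> sets M" .
  qed
qed

lemma chain_rv_measurable:
  assumes a: "0 < a" shows "(\<lambda>\<omega>. chain_rv a \<omega> i) \<in> borel_measurable M"
proof -
  note [measurable] = jump_rv_measurable[OF a]
  have pos: "0 < jump_rv a i \<omega>" for \<omega> using jump_rv_ge[OF a, of i \<omega>] a by linarith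
  have [measurable]: "(\<lambda>\<omega>. hull_V (P \<omega>) (jump_rv a i \<omega>)) \<in> borel_measurable M"
    "(\<lambda>\<omega>. hull_U (P \<omega>) (jump_rv a i \<omega>)) \<in> borel_measurable M"
    using pos by (intro hull_V_joint_measurable[of "\<lambda>x. x"]; auto)+
  have "(\<lambda>\<omega>. chain_rv a \<omega> i) = (\<lambda>\<omega>. if \<omega> \<in> nice_set then (hull_U (P \<omega>) (jump_rv a i \<omega>), hull_V (P \<omega>) (jump_rv a i \<omega>)) else (0, 0))"
    by (auto simp: chain_rv_def hull_chain_def hull_W_def jump_rv_def fun_eq_iff)
  also have "\<dots> \<in> borel_measurable M" by measurable
  finally show ?thesis .
qed

lemma chain_rv_in_hull_chains: "0 < a \<Longrightarrow> \<omega> \<in> nice_set \<Longrightarrow> chain_rv a \<omega> \<in> hull_chains a n"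
proof -
  assume a: "0 < a" and \<omega>: "\<omega> \<in> nice_set"
  interpret nonstop_config "P \<omega>" by (rule nonstop[OF \<omega>])
  have "chain_rv a \<omega> = hull_chain (P \<omega>) a" using \<omega> by (simp add: chain_rv_def fun_eq_iff)
  then show ?thesis using hull_chain_in_hull_chains[OF a, of n] by simp
qed

lemma chain_rv_mem: "0 < a \<Longrightarrow> \<omega> \<in> nice_set \<Longrightarrow> chain_rv a \<omega> i \<in> P \<omega>"
proof -
  assume a: "0 < a" and \<omega>: "\<omega> \<in> nice_set"
  interpret nonstop_config "P \<omega>" by (rule nonstop[OF \<omega>])
  show ?thesis using hull_W_props(1)[OF jump_seq_pos[OF a] nonempty, of i] \<omega>
    by (simp add: chain_rv_def hull_chain_def)
qed

text \<open>No point of the configuration lies strictly below a supporting line. The first piece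
  lies below the line of parameter a, and the triangle under a vertex lies strictly below the line
  of the next jump, which passes through both vertices.\<close>

lemma swept_region_empty:
  assumes a: "0 < a" and \<omega>: "\<omega> \<in> nice_set"
  shows "P \<omega> \<inter> swept_region a n (chain_rv a \<omega>) = {}"
proof (rule ccontr)
  interpret nonstop_config "P \<omega>" by (rule nonstop[OF \<omega>])
  have c: "chain_rv a \<omega> = hull_chain (P \<omega>) a" using \<omega> by (simp add: chain_rv_def fun_eq_iff)
  let ?T = "jump_seq (P \<omega>) a"
  assume "\<not> ?thesis"
  then obtain p where p: "p \<in> P \<omega>" "p \<in> swept_region a n (hull_chain (P \<omega>) a)" unfolding c by blast
  then consider "fst p + a * snd p < hull_U (P \<omega>) a + a * hull_V (P \<omega>) a"
    | i where "p \<in> open_triangle (hull_chain (P \<omega>) a i) (?T i) (?T (Suc i))"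
    by (cases p) (auto simp: swept_region_def slope_hull_chain[OF a] hull_chain_def[of _ _ 0] hull_W_def simp del: slope.simps jump_seq.simps(2))
  then show False
  proof cases
    case 1
    then show ?thesis using hull_W_props(2)[OF a nonempty p(1)] by simp
  next
    case (2 i)
    then have "fst p + ?T (Suc i) * snd p < hull_U (P \<omega>) (?T i) + ?T (Suc i) * hull_V (P \<omega>) (?T i)"
      by (simp add: open_triangle_def case_prod_unfold hull_chain_def hull_W_def algebra_simps del: jump_seq.simps)
    then show ?thesis
      using hull_W_props(2)[OF jump_seq_pos[OF a] nonempty p(1), of "Suc i"] jump_seq_crossing[OF a, of i] by linarith
  qed
qed

end

section \<open>The law of the hull chain\<close>

abbreviation chain_space :: "nat \<Rightarrow> (nat \<Rightarrow> real \<times> real) measure" where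
  "chain_space n \<equiv> PiM {..n} (\<lambda>_. lborel)"

section \<open>Dyadic cells generate the product sigma-algebra\<close>

lemma dyadic_cell_eq:
  "dyadic_cell m (k, l) = {real_of_int k / 2 ^ m..<(real_of_int k + 1) / 2 ^ m} \<times> {real_of_int l / 2 ^ m..<(real_of_int l + 1) / 2 ^ m}"
  by (auto simp: dyadic_cell_def dyadic_code_def floor_eq_iff field_simps)

lemma dyadic_cell_props [simp]: "dyadic_cell m \<kappa> \<in> sets borel" "bounded (dyadic_cell m \<kappa>)" "dyadic_cell m \<kappa> \<noteq> {}"
proof -
  obtain k l where \<kappa>: "\<kappa> = (k, l)" by (cases \<kappa>)
  show "dyadic_cell m \<kappa> \<in> sets borel"
    unfolding \<kappa> dyadic_cell_eq borel_prod[symmetric] by (intro pair_measureI) auto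
  show "bounded (dyadic_cell m \<kappa>)"
    unfolding \<kappa> dyadic_cell_eq
    by (intro bounded_Times bounded_subset[OF bounded_closed_interval[of "real_of_int k / 2 ^ m" "(real_of_int k + 1) / 2 ^ m"]]
        bounded_subset[OF bounded_closed_interval[of "real_of_int l / 2 ^ m" "(real_of_int l + 1) / 2 ^ m"]]) auto
  have "(real_of_int k / 2 ^ m, real_of_int l / 2 ^ m) \<in> dyadic_cell m \<kappa>"
    unfolding \<kappa> dyadic_cell_eq by (auto simp: divide_strict_right_mono)
  then show "dyadic_cell m \<kappa> \<noteq> {}" by blast
qed

lemma emeasure_dyadic_cell: "emeasure lborel (dyadic_cell m \<kappa>) = ennreal (measure lborel (dyadic_cell m \<kappa>))"
  using emeasure_bounded_finite[OF dyadic_cell_props(2)[of m \<kappa>]]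
  by (intro emeasure_eq_ennreal_measure) (auto simp: less_top)

lemma dyadic_code_mono:
  assumes "m \<le> m'" "dyadic_code m' z = dyadic_code m' z'"
  shows "dyadic_code m z = dyadic_code m z'"
proof -
  have *: "\<lfloor>2 ^ m * x\<rfloor> = \<lfloor>2 ^ m' * x\<rfloor> div 2 ^ (m' - m)" for x :: real
  proof -
    have "2 ^ m * x = (2 ^ m' * x) / real_of_int (2 ^ (m' - m))"
    proof -
      have "(2::real) ^ m' = 2 ^ m * 2 ^ (m' - m)" using assms(1) by (simp flip: power_add)
      then show ?thesis by simp
    qed
    moreover have "\<lfloor>(2 ^ m' * x) / real_of_int (2 ^ (m' - m))\<rfloor> = \<lfloor>2 ^ m' * x\<rfloor> div 2 ^ (m' - m)"
      by (rule floor_divide_real_eq_div) simp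
    ultimately show ?thesis by simp
  qed
  show ?thesis using assms(2) unfolding dyadic_code_def by (simp add: *)
qed

lemma tuple_cell_nonempty: "tuple_cell n m \<beta> \<noteq> {}"
  by (simp add: tuple_cell_def PiE_eq_empty_iff)

lemma tuple_code_in: "tuple_code n m w \<in> {..n} \<rightarrow>\<^sub>E UNIV"
  by (simp add: tuple_code_def)

lemma countable_codes: "countable ({..n::nat} \<rightarrow>\<^sub>E (UNIV :: (int \<times> int) set))"
  by (intro countable_PiE) auto

lemma space_chain_space: "w \<in> space (chain_space n) \<longleftrightarrow> w \<in> extensional {..n}"
  by (simp add: space_PiM PiE_def)

lemma tuple_cell_measurable [measurable]: "tuple_cell n m \<beta> \<in> sets (chain_space n)"
  unfolding tuple_cell_def by (intro sets_PiM_I_finite) auto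

lemma mem_tuple_cell_eq_code:
  assumes "\<beta> \<in> {..n} \<rightarrow>\<^sub>E UNIV"
  shows "w \<in> tuple_cell n m \<beta> \<longleftrightarrow> w \<in> extensional {..n} \<and> tuple_code n m w = \<beta>"
  using assms by (auto simp: mem_tuple_cell_iff tuple_code_def fun_eq_iff restrict_def PiE_iff extensional_def)

lemma tuple_cell_disjoint:
  assumes "\<beta> \<in> {..n} \<rightarrow>\<^sub>E UNIV" "\<gamma> \<in> {..n} \<rightarrow>\<^sub>E UNIV" "\<beta> \<noteq> \<gamma>"
  shows "tuple_cell n m \<beta> \<inter> tuple_cell n m \<gamma> = {}"
  using assms(3) by (simp add: disjoint_iff mem_tuple_cell_eq_code[OF assms(1)] mem_tuple_cell_eq_code[OF assms(2)])

lemma tuple_cell_nested: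
  assumes "m \<le> m'" "w \<in> tuple_cell n m' \<beta>" "w' \<in> tuple_cell n m' \<beta>" "w \<in> tuple_cell n m \<gamma>"
  shows "w' \<in> tuple_cell n m \<gamma>"
  using assms dyadic_code_mono[OF assms(1)] by (metis mem_tuple_cell_iff)

lemma emeasure_tuple_cell: "emeasure (chain_space n) (tuple_cell n m \<beta>) = (\<Prod>i\<le>n. emeasure lborel (dyadic_cell m (\<beta> i)))"
proof -
  interpret product_sigma_finite "\<lambda>_::nat. lborel :: (real \<times> real) measure" by standard
  show ?thesis unfolding tuple_cell_def by (rule emeasure_PiM) auto
qed

lemma emeasure_tuple_cell_finite: "emeasure (chain_space n) (tuple_cell n m \<beta>) < \<infinity>"
  unfolding emeasure_tuple_cell emeasure_dyadic_cell by (simp add: prod_ennreal)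

lemma tuple_code_measurable [measurable]: "tuple_code n m \<in> measurable (chain_space n) (count_space ({..n} \<rightarrow>\<^sub>E UNIV))"
proof (subst measurable_count_space_eq_countable[OF countable_codes], intro conjI ballI)
  show "tuple_code n m \<in> space (chain_space n) \<rightarrow> {..n} \<rightarrow>\<^sub>E UNIV" using tuple_code_in by blast
  fix \<beta> :: "nat \<Rightarrow> int \<times> int" assume "\<beta> \<in> {..n} \<rightarrow>\<^sub>E UNIV"
  then have "tuple_code n m -` {\<beta>} \<inter> space (chain_space n) = tuple_cell n m \<beta>"
    by (auto simp: mem_tuple_cell_eq_code space_chain_space)
  then show "tuple_code n m -` {\<beta>} \<inter> space (chain_space n) \<in> sets (chain_space n)" by simp
qed

lemma code_function_measurable:
  fixes h :: "(nat \<Rightarrow> int \<times> int) \<Rightarrow> 'b"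
  assumes "\<And>\<beta>. h \<beta> \<in> space N"
  shows "(\<lambda>w. h (tuple_code n m w)) \<in> measurable (chain_space n) N"
  by (rule measurable_compose_countable'[where f="\<lambda>\<beta> _. h \<beta>" and I="{..n} \<rightarrow>\<^sub>E UNIV"])
     (use assms countable_codes in auto)

lemma sets_chain_space_eq:
  "sets (chain_space n) = sigma_sets (space (chain_space n)) {tuple_cell n m \<beta> |m \<beta>. \<beta> \<in> {..n} \<rightarrow>\<^sub>E UNIV}"
    (is "_ = sigma_sets ?S ?E")
proof (intro equalityI)
  have E: "?E \<subseteq> sets (chain_space n)" by auto
  then show "sigma_sets ?S ?E \<subseteq> sets (chain_space n)" by (rule sets.sigma_sets_subset)
  let ?N = "sigma ?S ?E"
  have EP: "?E \<subseteq> Pow ?S" using E sets.sets_into_space by blast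
  have spN: "space ?N = ?S" and sN: "sets ?N = sigma_sets ?S ?E" using EP by auto
  have code: "(\<lambda>w. h (tuple_code n m w)) \<in> borel_measurable ?N" for h :: "_ \<Rightarrow> real \<times> real" and m
  proof (rule measurable_compose_countable'[where f="\<lambda>\<beta> _. h \<beta>" and I="{..n} \<rightarrow>\<^sub>E UNIV"])
    show "tuple_code n m \<in> measurable ?N (count_space ({..n} \<rightarrow>\<^sub>E UNIV))"
    proof (subst measurable_count_space_eq_countable[OF countable_codes], intro conjI ballI)
      show "tuple_code n m \<in> space ?N \<rightarrow> {..n} \<rightarrow>\<^sub>E UNIV" using tuple_code_in by blast
      fix \<beta> :: "nat \<Rightarrow> int \<times> int" assume \<beta>: "\<beta> \<in> {..n} \<rightarrow>\<^sub>E UNIV"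
      then have "tuple_code n m -` {\<beta>} \<inter> space ?N = tuple_cell n m \<beta>"
        unfolding spN by (auto simp: mem_tuple_cell_eq_code space_chain_space)
      then show "tuple_code n m -` {\<beta>} \<inter> space ?N \<in> sets ?N"
        unfolding sN using \<beta> by (auto intro!: sigma_sets.Basic)
    qed
  qed (use countable_codes in auto)
  have "(\<lambda>w. w) \<in> measurable ?N (chain_space n)"
  proof (rule measurable_PiM_single')
    show "(\<lambda>w. w) \<in> space ?N \<rightarrow> (\<Pi>\<^sub>E i\<in>{..n}. space lborel)"
      unfolding spN by (auto simp: space_PiM)
    fix i assume i: "i \<in> {..n}"
    \<comment> \<open>The lower left corner of a square: a function of the code which tends to the
      coordinate as the cells shrink.\<close>
    define r where "r m \<kappa> = (real_of_int (fst \<kappa>) / 2 ^ m, real_of_int (snd \<kappa>) / 2 ^ m)" for m :: nat and \<kappa> :: "int \<times> int"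
    have r: "dyadic_code m (r m \<kappa>) = \<kappa>" for m \<kappa> by (simp add: dyadic_code_def r_def)
    have "(\<lambda>w. w i) \<in> borel_measurable ?N"
    proof (rule borel_measurable_LIMSEQ_metric)
      show "(\<lambda>w. r m (tuple_code n m w i)) \<in> borel_measurable ?N" for m
        by (rule code[of "\<lambda>\<beta>. r m (\<beta> i)"])
      fix w assume "w \<in> space ?N"
      show "(\<lambda>m. r m (tuple_code n m w i)) \<longlonglongrightarrow> w i"
        using i by (intro dyadic_code_tendsto) (simp add: r tuple_code_def)
    qed
    then show "(\<lambda>w. w i) \<in> measurable ?N lborel" by simp
  qed
  then show "sets (chain_space n) \<subseteq> sigma_sets ?S ?E"
    using measurable_sets[of "\<lambda>w. w" ?N "chain_space n"] sets.sets_into_space[of _ "chain_space n"]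
    by (fastforce simp: spN sN[symmetric] Int_absorb2)
qed

section \<open>The density of the chain and its approximation on cells\<close>

definition chain_density :: "real \<Rightarrow> nat \<Rightarrow> (nat \<Rightarrow> real \<times> real) \<Rightarrow> ennreal" where
  "chain_density a n w = indicator (hull_chains a n) w * ennreal (exp (- (\<Sum>i\<le>n. area_coord a w i)))"

lemma chain_density_measurable [measurable]: "chain_density a n \<in> borel_measurable (chain_space n)"
proof -
  have "(\<lambda>w. \<Sum>i\<le>n. area_coord a w i) \<in> borel_measurable (chain_space n)"
    by (intro borel_measurable_sum coords_measurable) auto
  then show ?thesis unfolding chain_density_def by measurable
qed

text \<open>An upper bound for the density on the dyadic cells of level $m$, which decreases to it.\<close>

definition cell_density :: "real \<Rightarrow> nat \<Rightarrow> nat \<Rightarrow> (nat \<Rightarrow> int \<times> int) \<Rightarrow> ennreal" where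
  "cell_density a n m \<beta> = (if tuple_cell n m \<beta> \<subseteq> hull_chains a n then ennreal (exp (- measure lborel (core_region a n m \<beta>))) else 0)"

lemma core_region_measurable: "core_region a n m \<beta> \<in> sets borel"
proof -
  have "(\<Union>i\<le>n. dyadic_cell m (\<beta> i)) \<in> sets borel" by (rule sets.finite_UN) auto
  then show ?thesis unfolding core_region_def by (intro sets.Diff[OF borel_open[OF open_interior]])
qed

lemma core_region_props:
  assumes "tuple_cell n m \<beta> \<subseteq> hull_chains a n" "0 < a"
  shows "core_region a n m \<beta> \<in> sets borel" "bounded (core_region a n m \<beta>)" "core_region a n m \<beta> \<subseteq> first_quadrant"
    "\<And>w. w \<in> tuple_cell n m \<beta> \<Longrightarrow> core_region a n m \<beta> \<subseteq> swept_region a n w"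
proof -
  show sub: "core_region a n m \<beta> \<subseteq> swept_region a n w" if "w \<in> tuple_cell n m \<beta>" for w
    using interior_subset[of "\<Inter>w\<in>tuple_cell n m \<beta>. swept_region a n w"] that unfolding core_region_def by blast
  obtain w where w: "w \<in> tuple_cell n m \<beta>" using tuple_cell_nonempty by blast
  then have w': "w \<in> hull_chains a n" using assms(1) by blast
  note b = swept_region_bounded[OF w' assms(2)]
  show "bounded (core_region a n m \<beta>)" using bounded_subset[OF b(1) sub[OF w]] .
  have "{(x, y). 0 < x \<and> 0 < y} \<subseteq> first_quadrant" by (auto simp: first_quadrant_def)
  then show "core_region a n m \<beta> \<subseteq> first_quadrant" using sub[OF w] b(2) by blast
  show "core_region a n m \<beta> \<in> sets borel" by (rule core_region_measurable)
qed

text \<open>Almost every point of the swept region lies eventually in the core regions, so by Fatou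
  their areas are in the limit at least the swept area. Off the set of chains every cell around w is
  bad and contributes 0.\<close>

lemma limsup_cell_density:
  assumes w: "w \<in> extensional {..n}" and a: "0 < a"
  shows "limsup (\<lambda>m. cell_density a n m (tuple_code n m w)) \<le> chain_density a n w"
proof (cases "w \<in> hull_chains a n")
  case False
  have "cell_density a n m (tuple_code n m w) = 0" for m
    using False mem_tuple_cell_code[OF w] by (auto simp: cell_density_def)
  then show ?thesis by (simp add: Limsup_const)
next
  case True
  let ?Q = "\<lambda>m. core_region a n m (tuple_code n m w)"
  let ?A = "\<Sum>i\<le>n. area_coord a w i"
  have good: "\<forall>\<^sub>F m in sequentially. tuple_cell n m (tuple_code n m w) \<subseteq> hull_chains a n"
    by (rule eventually_cell_subset_hull_chains[OF True w])
  have A0: "0 \<le> ?A" using hull_chains_coords(1)[OF True a] by (intro sum_nonneg) (auto intro: less_imp_le)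
  have sets: "?Q m \<in> sets lborel" for m
    by (simp add: core_region_measurable)
  have "ennreal ?A = emeasure lborel (swept_region a n w)"
    by (rule emeasure_swept_region[OF True a, symmetric])
  also have "\<dots> = (\<integral>\<^sup>+z. indicator (swept_region a n w) z \<partial>lborel)" by simp
  also have "\<dots> \<le> (\<integral>\<^sup>+z. liminf (\<lambda>m. indicator (?Q m) z) \<partial>lborel)"
  proof (rule nn_integral_mono_AE)
    \<comment> \<open>The exceptional points are the vertices, which the core regions always
      omit.\<close>
    have "AE z in lborel. \<forall>i\<in>{..n}. z \<noteq> w i"
      by (intro AE_finite_allI AE_lborel_singleton) auto
    then show "AE z in lborel. indicator (swept_region a n w) z \<le> liminf (\<lambda>m. indicator (?Q m) z :: ennreal)"
    proof eventually_elim
      case (elim z)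
      show ?case
      proof (cases "z \<in> swept_region a n w")
        case z: True
        have "\<forall>\<^sub>F m in sequentially. z \<in> ?Q m"
          using elim by (intro eventually_core_region[OF True w z]) auto
        then have "\<forall>\<^sub>F m in sequentially. (1 :: ennreal) \<le> indicator (?Q m) z"
          by eventually_elim simp
        then have "1 \<le> liminf (\<lambda>m. indicator (?Q m) z :: ennreal)" by (rule Liminf_bounded)
        then show ?thesis using z by simp
      qed simp
    qed
  qed
  also have "\<dots> \<le> liminf (\<lambda>m. \<integral>\<^sup>+z. indicator (?Q m) z \<partial>lborel)"
    by (rule nn_integral_liminf) (use sets in simp)
  also have "\<dots> = liminf (\<lambda>m. emeasure lborel (?Q m))" using sets by simp
  finally have lim: "ennreal ?A \<le> liminf (\<lambda>m. emeasure lborel (?Q m))" .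
  \<comment> \<open>The core areas eventually exceed every b below the swept area; b is sent to that
    area at the end.\<close>
  have ub: "limsup (\<lambda>m. cell_density a n m (tuple_code n m w)) \<le> ennreal (exp (- b))" if b: "b < ?A" "0 \<le> b" for b
  proof (rule Limsup_bounded)
    have "ennreal b < liminf (\<lambda>m. emeasure lborel (?Q m))"
      using lim ennreal_lessI[of ?A b] b A0 by (meson le_less_trans less_le_trans ennreal_less_iff)
    then have "\<forall>\<^sub>F m in sequentially. ennreal b < emeasure lborel (?Q m)" by (rule less_LiminfD)
    with good show "\<forall>\<^sub>F m in sequentially. cell_density a n m (tuple_code n m w) \<le> ennreal (exp (- b))"
    proof eventually_elim
      case (elim m)
      have "emeasure lborel (?Q m) = ennreal (measure lborel (?Q m))"
        using emeasure_bounded_finite[OF core_region_props(2)[OF elim(1) a]]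
        by (intro emeasure_eq_ennreal_measure) (auto simp: less_top)
      then have "b < measure lborel (?Q m)" using elim(2) b by (simp add: ennreal_less_iff)
      then show ?case using elim(1) by (simp add: cell_density_def ennreal_leI)
    qed
  qed
  have "limsup (\<lambda>m. cell_density a n m (tuple_code n m w)) \<le> ennreal (exp (- ?A))"
  proof (rule tendsto_lowerbound)
    show "((\<lambda>b. ennreal (exp (- b))) \<longlongrightarrow> ennreal (exp (- ?A))) (at_left ?A)"
      by (intro tendsto_ennrealI tendsto_intros)
    have pos: "0 < ?A" using hull_chains_coords(1)[OF True a] by (intro sum_pos) auto
    show "\<forall>\<^sub>F b in at_left ?A. limsup (\<lambda>m. cell_density a n m (tuple_code n m w)) \<le> ennreal (exp (- b))"
      unfolding eventually_at_left_field using pos ub by (intro exI[of _ 0]) auto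
  qed simp
  then show ?thesis using True by (simp add: chain_density_def)
qed

lemma chain_density_integral:
  fixes A B :: "nat \<Rightarrow> real set"
  assumes [measurable]: "\<And>i. A i \<in> sets borel" "\<And>i. B i \<in> sets borel" and a: "0 < a"
  shows "(\<integral>\<^sup>+w. chain_density a n w * indicator {w. \<forall>i\<le>n. area_coord a w i \<in> A i \<and> height_coord a w i \<in> B i} w \<partial>chain_space n) =
    (\<Prod>i\<le>n. (\<integral>\<^sup>+e. ennreal (exponential_density 1 e) * indicator (A i) e \<partial>lborel) *
       (\<integral>\<^sup>+t. ennreal (height_density i t) * indicator (B i) t \<partial>lborel))"
proof -
  define \<phi> where "\<phi> i e = ennreal (exp (- e)) * indicator (A i) e" for i e
  define \<psi> where "\<psi> i t = (indicator (B i) t :: ennreal)" for i t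
  have [measurable]: "\<phi> i \<in> borel_measurable borel" "\<psi> i \<in> borel_measurable borel" for i
    unfolding \<phi>_def \<psi>_def by measurable
  have "(\<integral>\<^sup>+w. chain_density a n w * indicator {w. \<forall>i\<le>n. area_coord a w i \<in> A i \<and> height_coord a w i \<in> B i} w \<partial>chain_space n) =
    (\<integral>\<^sup>+w. (\<Prod>i\<le>n. \<phi> i (area_coord a w i) * \<psi> i (height_coord a w i)) * indicator (hull_chains a n) w \<partial>chain_space n)"
  proof (rule nn_integral_cong)
    fix w
    have "(\<Prod>i\<le>n. \<phi> i (area_coord a w i) * \<psi> i (height_coord a w i)) =
        (\<Prod>i\<le>n. ennreal (exp (- area_coord a w i))) * (\<Prod>i\<le>n. indicator (A i) (area_coord a w i) * indicator (B i) (height_coord a w i))"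
      by (simp add: \<phi>_def \<psi>_def prod.distrib[symmetric] mult.assoc)
    also have "(\<Prod>i\<le>n. ennreal (exp (- area_coord a w i))) = ennreal (exp (- (\<Sum>i\<le>n. area_coord a w i)))"
      by (simp add: prod_ennreal exp_sum sum_negf[symmetric])
    also have "(\<Prod>i\<le>n. indicator (A i) (area_coord a w i) * indicator (B i) (height_coord a w i) :: ennreal) =
        indicator {w. \<forall>i\<le>n. area_coord a w i \<in> A i \<and> height_coord a w i \<in> B i} w"
    proof (cases "\<forall>i\<le>n. area_coord a w i \<in> A i \<and> height_coord a w i \<in> B i")
      case False
      then obtain i where "i \<le> n" "area_coord a w i \<notin> A i \<or> height_coord a w i \<notin> B i" by blast
      then have "(\<Prod>i\<le>n. indicator (A i) (area_coord a w i) * indicator (B i) (height_coord a w i) :: ennreal) = 0"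
        by (intro prod_zero bexI[of _ i]) auto
      then show ?thesis using False by simp
    qed simp
    finally show "chain_density a n w * indicator {w. \<forall>i\<le>n. area_coord a w i \<in> A i \<and> height_coord a w i \<in> B i} w =
      (\<Prod>i\<le>n. \<phi> i (area_coord a w i) * \<psi> i (height_coord a w i)) * indicator (hull_chains a n) w"
      by (simp add: chain_density_def mult_ac)
  qed
  also have "\<dots> = (\<Prod>i\<le>n. (\<integral>\<^sup>+e. \<phi> i e * indicator {0<..} e \<partial>lborel) * (\<integral>\<^sup>+t. \<psi> i t * ennreal (height_density i t) \<partial>lborel))"
    using a by (intro chain_change_of_variables) auto
  also have "\<dots> = (\<Prod>i\<le>n. (\<integral>\<^sup>+e. ennreal (exponential_density 1 e) * indicator (A i) e \<partial>lborel) *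
       (\<integral>\<^sup>+t. ennreal (height_density i t) * indicator (B i) t \<partial>lborel))"
  proof (intro prod.cong refl arg_cong2[where f="(*)"])
    fix i
    show "(\<integral>\<^sup>+e. \<phi> i e * indicator {0<..} e \<partial>lborel) = (\<integral>\<^sup>+e. ennreal (exponential_density 1 e) * indicator (A i) e \<partial>lborel)"
    proof (rule nn_integral_cong_AE)
      show "AE e in lborel. \<phi> i e * indicator {0<..} e = ennreal (exponential_density 1 e) * indicator (A i) e"
        using AE_lborel_singleton[of 0]
        by eventually_elim (auto simp: \<phi>_def exponential_density_def indicator_def)
    qed
  qed (simp add: \<psi>_def mult.commute)
  finally show ?thesis .
qed

lemma nn_integral_exponential_density: "(\<integral>\<^sup>+e. ennreal (exponential_density 1 e) \<partial>lborel) = 1"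
  using prob_space.emeasure_space_1[OF prob_space_exponential_density[of 1]]
  by (simp add: emeasure_density)

lemma nn_integral_height_density: "(\<integral>\<^sup>+t. ennreal (height_density i t) \<partial>lborel) = 1"
proof -
  have "(\<integral>\<^sup>+t. ennreal (height_density i t) \<partial>lborel) = (\<integral>\<^sup>+t. ennreal (if i = 0 then 1 else 2 * (1 - t)) * indicator {0..1} t \<partial>lborel)"
  proof (rule nn_integral_cong_AE)
    show "AE t in lborel. ennreal (height_density i t) = ennreal (if i = 0 then 1 else 2 * (1 - t)) * indicator {0..1} t"
      using AE_lborel_singleton[of 0] AE_lborel_singleton[of 1]
      by eventually_elim (auto simp: height_density_def indicator_def)
  qed
  also have "\<dots> = ennreal ((if i = 0 then 1 else 2 * 1 - 1\<^sup>2) - (if i = 0 then 0 else 2 * 0 - 0\<^sup>2))"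
    by (rule nn_integral_FTC_Icc[where F="\<lambda>t. if i = 0 then t else 2 * t - t\<^sup>2"])
       (auto intro!: derivative_eq_intros)
  finally show ?thesis by (auto split: if_splits)
qed

lemma coords_cong:
  assumes "\<And>i. i \<le> n \<Longrightarrow> w i = w' i" "i \<le> n"
  shows "slope a w i = slope a w' i" "area_coord a w i = area_coord a w' i" "height_coord a w i = height_coord a w' i"
proof -
  have *: "slope a w i = slope a w' i" if "i \<le> n" for i using that assms(1) by (cases i) auto
  show "slope a w i = slope a w' i" "area_coord a w i = area_coord a w' i" "height_coord a w i = height_coord a w' i"
    using assms * by (cases i; simp)+
qed

lemma hull_chains_cong:
  assumes "\<And>i. i \<le> n \<Longrightarrow> w i = w' i"
  shows "w \<in> hull_chains a n \<longleftrightarrow> w' \<in> hull_chains a n"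
proof -
  have "slope a w i = slope a w' i" if "i \<le> n" for i by (rule coords_cong[OF assms that])
  then show ?thesis using assms by (simp add: hull_chains_def Suc_le_eq less_imp_le del: slope.simps)
qed

lemma swept_region_cong:
  assumes "\<And>i. i \<le> n \<Longrightarrow> w i = w' i"
  shows "swept_region a n w = swept_region a n w'"
proof -
  have "slope a w i = slope a w' i" if "i \<le> n" for i by (rule coords_cong[OF assms that])
  then show ?thesis using assms by (simp add: swept_region_def Suc_le_eq less_imp_le del: slope.simps)
qed

section \<open>Bounds on cells and identification of the law\<close>

context quadrant_poisson
begin

context
  fixes a :: real and n :: nat
  assumes a: "0 < a"
begin

definition chain_tuple :: "'w \<Rightarrow> nat \<Rightarrow> real \<times> real" where
  "chain_tuple \<omega> = restrict (chain_rv a \<omega>) {..n}"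

lemma chain_tuple_measurable [measurable]: "chain_tuple \<in> measurable M (chain_space n)"
  unfolding chain_tuple_def restrict_def[abs_def]
  using chain_rv_measurable[OF a] by (intro measurable_restrict[unfolded restrict_def]) simp

definition chain_law :: "(nat \<Rightarrow> real \<times> real) measure" where
  "chain_law = distr M (chain_space n) chain_tuple"

lemma sets_chain_law [measurable_cong, simp]: "sets chain_law = sets (chain_space n)"
  and space_chain_law [simp]: "space chain_law = space (chain_space n)"
  by (simp_all add: chain_law_def)

lemma prob_space_chain_law: "prob_space chain_law"
  unfolding chain_law_def by (rule prob_space_distr) measurable

lemma chain_tuple_in_hull_chains: "\<omega> \<in> nice_set \<Longrightarrow> chain_tuple \<omega> \<in> hull_chains a n"
  using chain_rv_in_hull_chains[OF a, of \<omega> n]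
  by (subst hull_chains_cong[of _ _ "chain_rv a \<omega>"]) (auto simp: chain_tuple_def)

lemma AE_chain_law: "AE w in chain_law. w \<in> hull_chains a n"
proof -
  have "AE \<omega> in M. chain_tuple \<omega> \<in> hull_chains a n"
    using AE_nice by eventually_elim (rule chain_tuple_in_hull_chains)
  then show ?thesis unfolding chain_law_def by (subst AE_distr_iff) (auto intro: hull_chains_measurable[unfolded pred_def])
qed

text \<open>If the hull chain falls into the cell, each of the n + 1 dyadic squares contains a point
  and the core region is empty. That the squares are disjoint and lie in the quadrant follows
  because every tuple of the cell is a chain.\<close>

lemma cell_bound:
  assumes good: "tuple_cell n m \<beta> \<subseteq> hull_chains a n"
  shows "emeasure chain_law (tuple_cell n m \<beta>) \<le> cell_density a n m \<beta> * emeasure (chain_space n) (tuple_cell n m \<beta>)"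
proof -
  let ?B = "\<lambda>i. dyadic_cell m (\<beta> i)"
  let ?Q = "core_region a n m \<beta>"
  let ?H = "{\<omega>\<in>space M. (\<forall>i\<le>n. P \<omega> \<inter> ?B i \<noteq> {}) \<and> P \<omega> \<inter> ?Q = {}}"
  note Q = core_region_props[OF good a]
  obtain w0 where w0: "w0 \<in> tuple_cell n m \<beta>" using tuple_cell_nonempty by blast
  \<comment> \<open>One coordinate can be varied freely in its square, so every point of a square is
    a vertex of some chain.\<close>
  have upd: "w0(i := z) \<in> tuple_cell n m \<beta>" if "i \<le> n" "z \<in> ?B i" for i z
    using w0 that unfolding tuple_cell_def by (auto simp: PiE_iff extensional_def)
  have quad: "?B i \<subseteq> first_quadrant" if "i \<le> n" for i
  proof
    fix z assume z: "z \<in> ?B i"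
    let ?w = "w0(i := z)"
    have "?w \<in> hull_chains a n" using upd[OF that z] good by blast
    then have h: "0 < fst (?w 0)" "\<And>j. j \<le> n \<Longrightarrow> 0 < snd (?w j)"
      "\<And>j. j < n \<Longrightarrow> snd (?w (Suc j)) < snd (?w j) \<and> slope a ?w j < slope a ?w (Suc j)"
      by (auto simp: hull_chains_def simp del: fun_upd_apply slope.simps)
    have "0 < fst (?w j)" if "j \<le> n" for j
      using that
    proof (induction j)
      case (Suc j)
      have "a \<le> slope a ?w (Suc j)"
        by (rule hull_chains_coords(6)[OF \<open>?w \<in> hull_chains a n\<close> a Suc.prems])
      then have "0 < slope a ?w (Suc j) * (snd (?w j) - snd (?w (Suc j)))"
        using a h(3)[of j] Suc.prems by (intro mult_pos_pos) auto
      also have "\<dots> = fst (?w (Suc j)) - fst (?w j)"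
        using h(3)[of j] Suc.prems by (simp del: fun_upd_apply)
      finally show ?case using Suc by (simp del: fun_upd_apply)
    qed (rule h)
    from this[OF that] h(2)[OF that] show "z \<in> first_quadrant"
      by (cases z) (simp add: first_quadrant_def)
  qed
  \<comment> \<open>If two indices shared a square, the later point could be put in place of the
    earlier one, giving a chain with two vertices of equal height.\<close>
  have disj: "?B i \<inter> ?B j = {}" if ij: "i < j" "j \<le> n" for i j
  proof (rule ccontr)
    assume "?B i \<inter> ?B j \<noteq> {}"
    then have eq: "\<beta> i = \<beta> j" by (auto simp: dyadic_cell_def)
    have "w0 j \<in> ?B i" using w0 ij unfolding eq by (auto simp: tuple_cell_def PiE_iff)
    then have "w0(i := w0 j) \<in> hull_chains a n" using upd[of i "w0 j"] ij good by auto
    then have dec: "snd ((w0(i := w0 j)) (Suc k)) < snd ((w0(i := w0 j)) k)" if "k < n" for k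
      using that by (auto simp: hull_chains_def simp del: fun_upd_apply)
    define u where "u = w0(i := w0 j)"
    have "snd (u l) < snd (u i)" if "i < l" "l \<le> n" for l
      using that
    proof (induction l)
      case (Suc l)
      then show ?case using dec[of l] unfolding u_def[symmetric] by (cases "l = i") auto
    qed simp
    from this[OF ij] show False using ij by (simp add: u_def)
  qed
  have dB: "?B i \<inter> ?B j = {}" if "i \<le> n" "j \<le> n" "i \<noteq> j" for i j
    using disj[of i j] disj[of j i] that by (cases "i < j") auto
  have H: "?H \<in> sets M"
  proof -
    have [measurable]: "Measurable.pred M (\<lambda>\<omega>. \<exists>p\<in>?B i. p \<in> P \<omega>)" for i by (rule hit_measurable) auto
    have [measurable]: "Measurable.pred M (\<lambda>\<omega>. \<exists>p\<in>?Q. p \<in> P \<omega>)" by (rule hit_measurable[OF Q(1,2)])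
    have "?H = {\<omega>\<in>space M. (\<forall>i\<in>{..n}. \<exists>p\<in>?B i. p \<in> P \<omega>) \<and> \<not> (\<exists>p\<in>?Q. p \<in> P \<omega>)}"
      by blast
    also have "\<dots> \<in> sets M" by measurable
    finally show ?thesis .
  qed
  have "emeasure chain_law (tuple_cell n m \<beta>) = emeasure M (chain_tuple -` tuple_cell n m \<beta> \<inter> space M)"
    unfolding chain_law_def by (rule emeasure_distr) auto
  also have "\<dots> \<le> emeasure M ?H"
  proof (rule emeasure_mono_AE[OF _ H])
    show "AE \<omega> in M. \<omega> \<in> chain_tuple -` tuple_cell n m \<beta> \<inter> space M \<longrightarrow> \<omega> \<in> ?H"
      using AE_nice
    proof eventually_elim
      case (elim \<omega>)
      show ?case
      proof
        assume "\<omega> \<in> chain_tuple -` tuple_cell n m \<beta> \<inter> space M"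
        then have cell: "chain_tuple \<omega> \<in> tuple_cell n m \<beta>" and sp: "\<omega> \<in> space M" by auto
        have "P \<omega> \<inter> ?B i \<noteq> {}" if "i \<le> n" for i
        proof -
          have "chain_rv a \<omega> i \<in> ?B i" using cell that by (auto simp: chain_tuple_def tuple_cell_def)
          then show ?thesis using chain_rv_mem[OF a elim, of i] by blast
        qed
        moreover have "P \<omega> \<inter> ?Q = {}"
        proof -
          have "swept_region a n (chain_tuple \<omega>) = swept_region a n (chain_rv a \<omega>)"
            by (rule swept_region_cong) (simp add: chain_tuple_def)
          then show ?thesis using swept_region_empty[OF a elim, of n] Q(4)[OF cell] by blast
        qed
        ultimately show "\<omega> \<in> ?H" using sp by blast
      qed
    qed
  qed
  also have "\<dots> = ennreal (prob ?H)" by (rule emeasure_eq_measure)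
  also have "\<dots> \<le> ennreal ((\<Prod>i\<le>n. measure lborel (?B i)) * exp (- measure lborel ?Q))"
  proof (intro ennreal_leI hit_void_prob_le)
    show "?B i \<inter> ?Q = {}" if "i \<le> n" for i using that by (auto simp: core_region_def)
  qed (use quad dB Q in auto)
  also have "\<dots> = cell_density a n m \<beta> * emeasure (chain_space n) (tuple_cell n m \<beta>)"
    using good by (simp add: cell_density_def emeasure_tuple_cell emeasure_dyadic_cell prod_ennreal ennreal_mult prod_nonneg mult.commute)
  finally show ?thesis .
qed

text \<open>Finer cells consisting of chains eventually contain almost every tuple of the given
  cell. Their bounds are summed at each level; Fatou on the side of the law and reverse Fatou on the
  side of the cell densities give the claim in the limit.\<close>

lemma chain_law_cell_le:
  "emeasure chain_law (tuple_cell n m0 \<beta>0) \<le> emeasure (density (chain_space n) (chain_density a n)) (tuple_cell n m0 \<beta>0)"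
proof -
  let ?C = "tuple_cell n m0 \<beta>0"
  let ?L = "chain_space n"
  define h where "h m w = cell_density a n m (tuple_code n m w)" for m w
  have h [measurable]: "h m \<in> borel_measurable ?L" for m
    unfolding h_def by (rule code_function_measurable) simp
  define G where "G m = {w\<in>?C. tuple_cell n m (tuple_code n m w) \<subseteq> hull_chains a n}" for m
  have C_ext: "w \<in> extensional {..n}" if "w \<in> tuple_cell n m \<beta>" for w m \<beta> using that by (simp add: mem_tuple_cell_iff)
  have G [measurable]: "G m \<in> sets ?L" for m
  proof -
    have "Measurable.pred ?L (\<lambda>w. tuple_cell n m (tuple_code n m w) \<subseteq> hull_chains a n)"
      by (rule code_function_measurable) simp
    then have "{w\<in>space ?L. tuple_cell n m (tuple_code n m w) \<subseteq> hull_chains a n} \<in> sets ?L" by (simp add: pred_def)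
    moreover have "G m = {w\<in>space ?L. tuple_cell n m (tuple_code n m w) \<subseteq> hull_chains a n} \<inter> ?C"
      using C_ext by (auto simp: G_def space_chain_space)
    ultimately show ?thesis by simp
  qed
  have bound: "emeasure chain_law (G m) \<le> (\<integral>\<^sup>+w. h m w * indicator ?C w \<partial>?L)" if m: "m0 \<le> m" for m
  proof -
    define I where "I = {\<beta> \<in> {..n} \<rightarrow>\<^sub>E UNIV. tuple_cell n m \<beta> \<subseteq> ?C \<and> tuple_cell n m \<beta> \<subseteq> hull_chains a n}"
    have cI: "countable I" unfolding I_def by (rule countable_subset[OF _ countable_codes[of n]]) blast
    have GI: "G m = (\<Union>\<beta>\<in>I. tuple_cell n m \<beta>)"
    proof (intro equalityI subsetI)
      fix w assume w: "w \<in> G m"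
      then have wC: "w \<in> ?C" by (simp add: G_def)
      have "tuple_cell n m (tuple_code n m w) \<subseteq> ?C"
        using tuple_cell_nested[OF m mem_tuple_cell_code[OF C_ext[OF wC]] _ wC] by blast
      then have "tuple_code n m w \<in> I" using w tuple_code_in unfolding I_def G_def by blast
      then show "w \<in> (\<Union>\<beta>\<in>I. tuple_cell n m \<beta>)" using mem_tuple_cell_code[OF C_ext[OF wC]] by blast
    next
      fix w assume "w \<in> (\<Union>\<beta>\<in>I. tuple_cell n m \<beta>)"
      then obtain \<beta> where \<beta>: "\<beta> \<in> I" "w \<in> tuple_cell n m \<beta>" by blast
      then have "tuple_code n m w = \<beta>" by (simp add: I_def mem_tuple_cell_eq_code)
      then show "w \<in> G m" using \<beta> by (auto simp: I_def G_def)
    qed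
    have dI: "disjoint_family_on (tuple_cell n m) I"
      unfolding disjoint_family_on_def
    proof (intro ballI impI)
      fix \<beta> \<gamma> assume "\<beta> \<in> I" "\<gamma> \<in> I" "\<beta> \<noteq> \<gamma>"
      then show "tuple_cell n m \<beta> \<inter> tuple_cell n m \<gamma> = {}"
        unfolding I_def by (intro tuple_cell_disjoint) blast+
    qed
    have cell: "emeasure (density ?L (h m)) (tuple_cell n m \<beta>) = cell_density a n m \<beta> * emeasure ?L (tuple_cell n m \<beta>)" if "\<beta> \<in> I" for \<beta>
    proof -
      have "emeasure (density ?L (h m)) (tuple_cell n m \<beta>) = (\<integral>\<^sup>+w. h m w * indicator (tuple_cell n m \<beta>) w \<partial>?L)"
        by (rule emeasure_density) auto
      also have "\<dots> = (\<integral>\<^sup>+w. cell_density a n m \<beta> * indicator (tuple_cell n m \<beta>) w \<partial>?L)"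
        using that by (intro nn_integral_cong) (auto simp: h_def I_def mem_tuple_cell_eq_code indicator_def)
      finally show ?thesis by (simp add: nn_integral_cmult_indicator)
    qed
    have "emeasure chain_law (G m) = (\<integral>\<^sup>+\<beta>. emeasure chain_law (tuple_cell n m \<beta>) \<partial>count_space I)"
      unfolding GI by (rule emeasure_UN_countable) (use cI dI in auto)
    also have "\<dots> \<le> (\<integral>\<^sup>+\<beta>. emeasure (density ?L (h m)) (tuple_cell n m \<beta>) \<partial>count_space I)"
      using cell cell_bound by (intro nn_integral_mono) (simp add: I_def)
    also have "\<dots> = emeasure (density ?L (h m)) (G m)"
      unfolding GI by (rule emeasure_UN_countable[symmetric]) (use cI dI in auto)
    also have "\<dots> \<le> emeasure (density ?L (h m)) ?C"
      by (rule emeasure_mono) (auto simp: G_def)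
    also have "\<dots> = (\<integral>\<^sup>+w. h m w * indicator ?C w \<partial>?L)" by (rule emeasure_density) auto
    finally show ?thesis .
  qed
  have "emeasure chain_law ?C = (\<integral>\<^sup>+w. indicator ?C w \<partial>chain_law)" by simp
  also have "\<dots> \<le> (\<integral>\<^sup>+w. liminf (\<lambda>m. indicator (G m) w) \<partial>chain_law)"
  proof (rule nn_integral_mono_AE)
    show "AE w in chain_law. indicator ?C w \<le> liminf (\<lambda>m. indicator (G m) w :: ennreal)"
      using AE_chain_law
    proof eventually_elim
      case (elim w)
      show ?case
      proof (cases "w \<in> ?C")
        case True
        have "\<forall>\<^sub>F m in sequentially. (1 :: ennreal) \<le> indicator (G m) w"
          using eventually_cell_subset_hull_chains[OF elim C_ext[OF True]] True
          by (auto elim!: eventually_mono simp: G_def)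
        then have "1 \<le> liminf (\<lambda>m. indicator (G m) w :: ennreal)" by (rule Liminf_bounded)
        then show ?thesis using True by simp
      qed simp
    qed
  qed
  also have "\<dots> \<le> liminf (\<lambda>m. \<integral>\<^sup>+w. indicator (G m) w \<partial>chain_law)"
    by (rule nn_integral_liminf) simp
  also have "\<dots> = liminf (\<lambda>m. emeasure chain_law (G m))" by simp
  also have "\<dots> \<le> limsup (\<lambda>m. emeasure chain_law (G m))" by (rule Liminf_le_Limsup) simp
  also have "\<dots> \<le> limsup (\<lambda>m. \<integral>\<^sup>+w. h m w * indicator ?C w \<partial>?L)"
    by (rule Limsup_mono) (use bound in \<open>auto simp: eventually_sequentially\<close>)
  also have "\<dots> \<le> (\<integral>\<^sup>+w. limsup (\<lambda>m. h m w * indicator ?C w) \<partial>?L)"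
  proof (rule nn_integral_limsup[where w="indicator ?C"])
    \<comment> \<open>The cell densities are at most 1 and the cell has finite volume: the
      domination required for reverse Fatou.\<close>
    show "AE w in ?L. h m w * indicator ?C w \<le> indicator ?C w" for m
      by (intro AE_I2) (auto simp: h_def cell_density_def indicator_def)
    show "(\<integral>\<^sup>+w. indicator ?C w \<partial>?L) < \<infinity>" using emeasure_tuple_cell_finite[of n m0 \<beta>0] by simp
  qed auto
  also have "\<dots> \<le> (\<integral>\<^sup>+w. chain_density a n w * indicator ?C w \<partial>?L)"
  proof (rule nn_integral_mono)
    fix w
    show "limsup (\<lambda>m. h m w * indicator ?C w) \<le> chain_density a n w * indicator ?C w"
    proof (cases "w \<in> ?C")
      case True
      then show ?thesis using limsup_cell_density[OF C_ext[OF True] a] by (simp add: h_def)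
    qed (simp add: Limsup_const)
  qed
  also have "\<dots> = emeasure (density ?L (chain_density a n)) ?C" by (rule emeasure_density[symmetric]) auto
  finally show ?thesis .
qed

lemma chain_law_eq_density: "chain_law = density (chain_space n) (chain_density a n)"
proof (rule measure_eqI_generator_eq_countable)
  let ?\<rho> = "density (chain_space n) (chain_density a n)"
  let ?cells = "{tuple_cell n m \<beta> |m \<beta>. \<beta> \<in> {..n} \<rightarrow>\<^sub>E UNIV} :: (nat \<Rightarrow> real \<times> real) set set"
  let ?E = "insert {} ?cells"
  let ?A = "tuple_cell n 0 ` ({..n} \<rightarrow>\<^sub>E UNIV)"
  interpret mu: prob_space chain_law by (rule prob_space_chain_law)
  \<comment> \<open>That the density has total mass 1 comes out of the change of variables.\<close>
  have "emeasure ?\<rho> (space ?\<rho>) = (\<integral>\<^sup>+w. chain_density a n w \<partial>chain_space n)"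
    by (subst emeasure_density) (auto intro!: nn_integral_cong simp: indicator_def)
  also have "\<dots> = 1"
    using chain_density_integral[of "\<lambda>_. UNIV" "\<lambda>_. UNIV" a n] a
    by (simp add: nn_integral_exponential_density nn_integral_height_density)
  finally have total: "emeasure ?\<rho> (space ?\<rho>) = 1" .
  interpret rho: prob_space ?\<rho> by (rule prob_spaceI) (rule total)
  have cover: "(\<Union>\<beta>\<in>{..n} \<rightarrow>\<^sub>E UNIV. tuple_cell n m \<beta>) = space (chain_space n)" for m
    using tuple_code_in by (auto simp: space_chain_space mem_tuple_cell_eq_code)
  have eq: "emeasure chain_law X = emeasure ?\<rho> X" if "X \<in> ?cells" for X
  proof (rule antisym)
    from that obtain m \<beta> where X: "X = tuple_cell n m \<beta>" and \<beta>: "\<beta> \<in> {..n} \<rightarrow>\<^sub>E UNIV" by blast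
    show "emeasure chain_law X \<le> emeasure ?\<rho> X" unfolding X by (rule chain_law_cell_le)
    let ?I = "({..n} \<rightarrow>\<^sub>E UNIV) - {\<beta>}"
    \<comment> \<open>The complement is a countable union of cells of the same level and obeys the
      same inequality; with total mass 1 on both sides this reverses the inequality for X.\<close>
    have comp: "space (chain_space n) - X = (\<Union>\<gamma>\<in>?I. tuple_cell n m \<gamma>)"
      using tuple_code_in \<beta> unfolding X by (auto simp: space_chain_space mem_tuple_cell_eq_code)
    have cI: "countable ?I" using countable_codes[of n] by (rule countable_subset[rotated]) blast
    have dI: "disjoint_family_on (tuple_cell n m) ?I"
      unfolding disjoint_family_on_def by (intro ballI impI tuple_cell_disjoint) blast+
    have "emeasure chain_law (space (chain_space n) - X) = (\<integral>\<^sup>+\<gamma>. emeasure chain_law (tuple_cell n m \<gamma>) \<partial>count_space ?I)"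
      unfolding comp by (rule emeasure_UN_countable) (use cI dI in auto)
    also have "\<dots> \<le> (\<integral>\<^sup>+\<gamma>. emeasure ?\<rho> (tuple_cell n m \<gamma>) \<partial>count_space ?I)"
      by (intro nn_integral_mono chain_law_cell_le)
    also have "\<dots> = emeasure ?\<rho> (space (chain_space n) - X)"
      unfolding comp by (rule emeasure_UN_countable[symmetric]) (use cI dI in auto)
    finally have "mu.prob (space chain_law - X) \<le> rho.prob (space ?\<rho> - X)"
      by (simp add: mu.emeasure_eq_measure rho.emeasure_eq_measure)
    moreover have "X \<in> sets (chain_space n)" unfolding X by simp
    ultimately have "rho.prob X \<le> mu.prob X"
      using mu.prob_compl[of X] rho.prob_compl[of X] by simp
    then show "emeasure ?\<rho> X \<le> emeasure chain_law X"
      by (simp add: mu.emeasure_eq_measure rho.emeasure_eq_measure)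
  qed
  show "emeasure chain_law X = emeasure ?\<rho> X" if "X \<in> ?E" for X
    using that eq[of X] by (cases "X = {}") auto
  have E_sets: "?E \<subseteq> sets (chain_space n)" by auto
  then show "?E \<subseteq> Pow (space (chain_space n))" using sets.sets_into_space by blast
  have gen: "sets (chain_space n) = sigma_sets (space (chain_space n)) ?E"
  proof (rule equalityI)
    show "sets (chain_space n) \<subseteq> sigma_sets (space (chain_space n)) ?E"
      unfolding sets_chain_space_eq by (rule sigma_sets_mono') blast
  qed (rule sets.sigma_sets_subset[OF E_sets])
  show "sets chain_law = sigma_sets (space (chain_space n)) ?E"
    "sets ?\<rho> = sigma_sets (space (chain_space n)) ?E" by (simp_all only: sets_chain_law sets_density gen)
  show "?A \<subseteq> ?E" by blast
  show "\<Union> ?A = space (chain_space n)" using cover[of 0] by simp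
  show "countable ?A" using countable_codes by (rule countable_image)
  show "emeasure chain_law X \<noteq> \<infinity>" if "X \<in> ?A" for X by (simp add: mu.emeasure_eq_measure)
  \<comment> \<open>Dyadic cells are nested or disjoint; the empty set is in the generator for the
    disjoint case.\<close>
  show "Int_stable ?E"
  proof (rule Int_stableI)
    fix X Y assume XY: "X \<in> ?E" "Y \<in> ?E"
    show "X \<inter> Y \<in> ?E"
    proof (cases "X \<inter> Y = {}")
      case False
      then obtain w where w: "w \<in> X" "w \<in> Y" by blast
      have "X \<in> ?cells" "Y \<in> ?cells" using XY w by auto
      then obtain m \<beta> m' \<gamma> where X: "X = tuple_cell n m \<beta>" and Y: "Y = tuple_cell n m' \<gamma>"
        by (elim CollectE exE conjE)
      have "Y \<subseteq> X" if "m \<le> m'" using tuple_cell_nested[OF that] w unfolding X Y by blast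
      moreover have "X \<subseteq> Y" if "m' \<le> m" using tuple_cell_nested[OF that] w unfolding X Y by blast
      ultimately have "X \<subseteq> Y \<or> Y \<subseteq> X" using nat_le_linear[of m m'] by blast
      then have "X \<inter> Y = X \<or> X \<inter> Y = Y" by blast
      then show ?thesis using XY by (elim disjE) simp_all
    qed simp
  qed
qed

lemma coords_prob:
  fixes A B :: "nat \<Rightarrow> real set"
  assumes A: "\<And>i. A i \<in> sets borel" and B: "\<And>i. B i \<in> sets borel"
  shows "emeasure M {\<omega>\<in>space M. \<forall>i\<le>n. area_coord a (chain_rv a \<omega>) i \<in> A i \<and> height_coord a (chain_rv a \<omega>) i \<in> B i} =
    (\<Prod>i\<le>n. (\<integral>\<^sup>+e. ennreal (exponential_density 1 e) * indicator (A i) e \<partial>lborel) *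
       (\<integral>\<^sup>+t. ennreal (height_density i t) * indicator (B i) t \<partial>lborel))"
proof -
  let ?X = "{w. \<forall>i\<le>n. area_coord a w i \<in> A i \<and> height_coord a w i \<in> B i}"
  have "{w\<in>space (chain_space n). \<forall>i\<in>{..n}. area_coord a w i \<in> A i \<and> height_coord a w i \<in> B i} \<in> sets (chain_space n)"
  proof (intro sets.sets_Collect_finite_All sets.sets_Collect_conj)
    fix i assume i: "i \<in> {..n}"
    then show "{w\<in>space (chain_space n). area_coord a w i \<in> A i} \<in> sets (chain_space n)"
      using measurable_sets[OF coords_measurable(2) A, of i n a i] by (simp add: vimage_def Int_def conj_commute)
    show "{w\<in>space (chain_space n). height_coord a w i \<in> B i} \<in> sets (chain_space n)"
      using measurable_sets[OF coords_measurable(3) B, of i n a i] i by (simp add: vimage_def Int_def conj_commute)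
  qed auto
  moreover have "{w\<in>space (chain_space n). \<forall>i\<in>{..n}. area_coord a w i \<in> A i \<and> height_coord a w i \<in> B i} = ?X \<inter> space (chain_space n)"
    by auto
  ultimately have X: "?X \<inter> space (chain_space n) \<in> sets (chain_space n)" by (simp only:)
  have "{\<omega>\<in>space M. \<forall>i\<le>n. area_coord a (chain_rv a \<omega>) i \<in> A i \<and> height_coord a (chain_rv a \<omega>) i \<in> B i} =
      chain_tuple -` (?X \<inter> space (chain_space n)) \<inter> space M"
  proof (rule set_eqI)
    fix \<omega>
    have *: "chain_tuple \<omega> i = chain_rv a \<omega> i" if "i \<le> n" for i using that by (simp add: chain_tuple_def)
    have eqs: "area_coord a (chain_tuple \<omega>) i = area_coord a (chain_rv a \<omega>) i"
      "height_coord a (chain_tuple \<omega>) i = height_coord a (chain_rv a \<omega>) i" if "i \<le> n" for i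
      by (rule coords_cong[OF * that]; assumption)+
    have "chain_tuple \<omega> \<in> ?X \<longleftrightarrow>
        (\<forall>i\<le>n. area_coord a (chain_rv a \<omega>) i \<in> A i \<and> height_coord a (chain_rv a \<omega>) i \<in> B i)"
      unfolding mem_Collect_eq by (intro all_cong1 imp_cong refl) (simp only: eqs)
    moreover have "chain_tuple \<omega> \<in> space (chain_space n)" by (simp add: chain_tuple_def space_chain_space)
    ultimately show "\<omega> \<in> {\<omega>\<in>space M. \<forall>i\<le>n. area_coord a (chain_rv a \<omega>) i \<in> A i \<and> height_coord a (chain_rv a \<omega>) i \<in> B i} \<longleftrightarrow>
      \<omega> \<in> chain_tuple -` (?X \<inter> space (chain_space n)) \<inter> space M"
      by (simp only: vimage_eq Int_iff mem_Collect_eq) blast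
  qed
  then have "emeasure M {\<omega>\<in>space M. \<forall>i\<le>n. area_coord a (chain_rv a \<omega>) i \<in> A i \<and> height_coord a (chain_rv a \<omega>) i \<in> B i} =
      emeasure chain_law (?X \<inter> space (chain_space n))"
    unfolding chain_law_def emeasure_distr[OF chain_tuple_measurable X] by (simp only:)
  also have "\<dots> = (\<integral>\<^sup>+w. chain_density a n w * indicator (?X \<inter> space (chain_space n)) w \<partial>chain_space n)"
    unfolding chain_law_eq_density by (rule emeasure_density[OF chain_density_measurable X])
  also have "\<dots> = (\<integral>\<^sup>+w. chain_density a n w * indicator ?X w \<partial>chain_space n)"
    by (intro nn_integral_cong) (simp add: indicator_def)
  also have "\<dots> = (\<Prod>i\<le>n. (\<integral>\<^sup>+e. ennreal (exponential_density 1 e) * indicator (A i) e \<partial>lborel) *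
       (\<integral>\<^sup>+t. ennreal (height_density i t) * indicator (B i) t \<partial>lborel))"
    by (rule chain_density_integral[OF A B a])
  finally show ?thesis .
qed

end

end

section \<open>The coordinates as one independent family\<close>

fun step_density :: "nat \<times> bool \<Rightarrow> real \<Rightarrow> real" where
  "step_density (i, b) = (if b then exponential_density 1 else height_density i)"

lemma step_density_measurable [measurable]: "step_density j \<in> borel_measurable borel"
  by (cases j) simp

text \<open>The flag separates the two kinds of coordinates, \<open>True\<close> for areas and
  \<open>False\<close> for ratios of heights. With a common index set the independence of all of
  them is a single statement.\<close>

definition step_law :: "nat \<times> bool \<Rightarrow> real measure" where
  "step_law j = density lborel (\<lambda>x. ennreal (step_density j x))"

lemma sets_step_law [measurable_cong, simp]: "sets (step_law j) = sets borel"
  and space_step_law [simp]: "space (step_law j) = UNIV"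
  by (simp_all add: step_law_def)

lemma prob_space_step_law: "prob_space (step_law j)"
proof
  show "emeasure (step_law j) (space (step_law j)) = 1"
    by (cases j) (simp add: step_law_def emeasure_density nn_integral_exponential_density nn_integral_height_density)
qed

context quadrant_poisson
begin

definition step_rv :: "real \<Rightarrow> nat \<times> bool \<Rightarrow> 'w \<Rightarrow> real" where
  "step_rv a j \<omega> = (if snd j then area_coord a (chain_rv a \<omega>) (fst j) else height_coord a (chain_rv a \<omega>) (fst j))"

context
  fixes a :: real
  assumes a: "0 < a"
begin

lemma step_rv_measurable [measurable]: "step_rv a j \<in> borel_measurable M"
proof -
  obtain i b where j: "j = (i, b)" by (cases j)
  have "area_coord a (chain_tuple a i \<omega>) i = area_coord a (chain_rv a \<omega>) i"
    "height_coord a (chain_tuple a i \<omega>) i = height_coord a (chain_rv a \<omega>) i" for \<omega>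
    by (rule coords_cong[of i]; simp add: chain_tuple_def[OF a])+
  moreover have "(\<lambda>\<omega>. area_coord a (chain_tuple a i \<omega>) i) \<in> borel_measurable M"
    "(\<lambda>\<omega>. height_coord a (chain_tuple a i \<omega>) i) \<in> borel_measurable M"
    by (rule measurable_compose[OF chain_tuple_measurable[OF a]], rule coords_measurable, simp)+
  ultimately show ?thesis unfolding j step_rv_def[abs_def] by (cases b) simp_all
qed

lemma step_rv_joint:
  assumes C: "\<And>j. C j \<in> sets borel"
  shows "emeasure M {\<omega>\<in>space M. \<forall>j\<in>{..n} \<times> UNIV. step_rv a j \<omega> \<in> C j} = (\<Prod>j\<in>{..n} \<times> UNIV. emeasure (step_law j) (C j))"
proof -
  have "{\<omega>\<in>space M. \<forall>j\<in>{..n} \<times> UNIV. step_rv a j \<omega> \<in> C j} =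
    {\<omega>\<in>space M. \<forall>i\<le>n. area_coord a (chain_rv a \<omega>) i \<in> C (i, True) \<and> height_coord a (chain_rv a \<omega>) i \<in> C (i, False)}"
    by (auto simp: step_rv_def)
  also have "emeasure M \<dots> = (\<Prod>i\<le>n. (\<integral>\<^sup>+e. ennreal (exponential_density 1 e) * indicator (C (i, True)) e \<partial>lborel) *
       (\<integral>\<^sup>+t. ennreal (height_density i t) * indicator (C (i, False)) t \<partial>lborel))"
    by (rule coords_prob[OF a]) (rule C)+
  also have "\<dots> = (\<Prod>i\<le>n. \<Prod>b\<in>UNIV. emeasure (step_law (i, b)) (C (i, b)))"
    using C by (simp add: UNIV_bool step_law_def emeasure_density mult.commute)
  also have "\<dots> = (\<Prod>j\<in>{..n} \<times> UNIV. emeasure (step_law j) (C j))"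
    by (subst prod.cartesian_product) (simp add: case_prod_unfold)
  finally show ?thesis .
qed

lemma step_rv_marginal:
  assumes C: "C \<in> sets borel"
  shows "emeasure M (step_rv a j -` C \<inter> space M) = emeasure (step_law j) C"
proof -
  obtain i b where j: "j = (i, b)" by (cases j)
  have "step_rv a j -` C \<inter> space M = {\<omega>\<in>space M. \<forall>k\<in>{..i} \<times> UNIV. step_rv a k \<omega> \<in> (if k = j then C else UNIV)}"
    by (auto simp: j split: if_splits)
  also have "emeasure M \<dots> = (\<Prod>k\<in>{..i} \<times> UNIV. emeasure (step_law k) (if k = j then C else UNIV))"
    by (rule step_rv_joint) (use C in auto)
  also have "\<dots> = (\<Prod>k\<in>{..i} \<times> UNIV. if k = j then emeasure (step_law j) C else 1)"
    using prob_space.emeasure_space_1[OF prob_space_step_law] by (intro prod.cong) auto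
  also have "\<dots> = emeasure (step_law j) C" by (subst prod.delta) (auto simp: j)
  finally show ?thesis .
qed

lemma distr_step_rv: "distr M borel (step_rv a j) = step_law j"
  by (rule measure_eqI) (simp_all add: emeasure_distr step_rv_marginal)

lemma indep_step_rv: "indep_vars (\<lambda>_. borel) (step_rv a) UNIV"
  unfolding indep_vars_def2
proof (intro conjI ballI indep_setsI)
  fix X J
  assume J: "J \<noteq> {}" "finite J" and X: "\<forall>j\<in>J. X j \<in> {step_rv a j -` A \<inter> space M |A. A \<in> sets borel}"
  then have "\<forall>j\<in>J. \<exists>A. A \<in> sets borel \<and> X j = step_rv a j -` A \<inter> space M" by blast
  then obtain A where A: "\<And>j. j \<in> J \<Longrightarrow> A j \<in> sets borel" "\<And>j. j \<in> J \<Longrightarrow> X j = step_rv a j -` A j \<inter> space M"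
    by metis
  define n where "n = Max (fst ` J)"
  have "fst j \<le> n" if "j \<in> J" for j
    unfolding n_def using J(2) that by (intro Max_ge finite_imageI imageI)
  then have sub: "J \<subseteq> {..n} \<times> UNIV" by force
  \<comment> \<open>A finite set of indices is filled up to a full block of coordinates, with no
    condition on the added ones.\<close>
  let ?C = "\<lambda>j. if j \<in> J then A j else UNIV"
  have "(\<Inter>j\<in>J. X j) = {\<omega>\<in>space M. \<forall>j\<in>{..n} \<times> UNIV. step_rv a j \<omega> \<in> ?C j}"
    using A(2) J(1) sub by (auto split: if_splits)
  then have "emeasure M (\<Inter>j\<in>J. X j) = (\<Prod>j\<in>{..n} \<times> UNIV. emeasure (step_law j) (?C j))"
    using A(1) by (simp only:) (rule step_rv_joint, auto)
  also have "\<dots> = (\<Prod>j\<in>{..n} \<times> UNIV. if j \<in> J then emeasure (step_law j) (A j) else 1)"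
    using prob_space.emeasure_space_1[OF prob_space_step_law] by (intro prod.cong) auto
  also have "\<dots> = (\<Prod>j\<in>J. emeasure (step_law j) (A j))"
    using sub by (subst prod.inter_restrict[symmetric]) (auto simp: Int_absorb1)
  also have "\<dots> = (\<Prod>j\<in>J. emeasure M (X j))"
    using A step_rv_marginal by (intro prod.cong) auto
  also have "\<dots> = ennreal (\<Prod>j\<in>J. prob (X j))"
    by (simp add: emeasure_eq_measure prod_ennreal)
  finally show "prob (\<Inter>j\<in>J. X j) = (\<Prod>j\<in>J. prob (X j))"
    by (simp add: emeasure_eq_measure prod_nonneg)
qed auto

end

end

section \<open>Renewal counts\<close>

text \<open>These values give -2 ln t the mean 3 and the second moment 14, hence the variance
  5.\<close>

lemma ln_moments:
  "integrable lborel (\<lambda>x. height_density (Suc i) x * (- ln x))"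
  "(\<integral>x. height_density (Suc i) x * (- ln x) \<partial>lborel) = 3 / 2"
  "integrable lborel (\<lambda>x. height_density (Suc i) x * (ln x)\<^sup>2)"
  "(\<integral>x. height_density (Suc i) x * (ln x)\<^sup>2 \<partial>lborel) = 7 / 2"
proof -
  have eint: "einterval 0 1 = {0<..<1::real}" by (auto simp: einterval_def zero_ereal_def one_ereal_def)
  have one: "(1::ereal) = ereal 1" and zero: "(0::ereal) = ereal 0" by (simp_all add: one_ereal_def zero_ereal_def)
  have range: "0 < x \<and> x < 1" if "(0::ereal) < ereal x" "ereal x < 1" for x
    using that by (simp add: one_ereal_def zero_ereal_def)
  \<comment> \<open>F and H are antiderivatives of f and h found by parts; both tend to 0 at 0, and
    to 3/2 and 7/2 at 1.\<close>
  define F where "F x = - 2 * x * ln x + 2 * x + x\<^sup>2 * ln x - x\<^sup>2 / 2" for x :: real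
  define f where "f x = 2 * (1 - x) * (- ln x)" for x :: real
  define H where "H x = 2 * x * (ln x)\<^sup>2 - 4 * x * ln x + 4 * x - x\<^sup>2 * (ln x)\<^sup>2 + x\<^sup>2 * ln x - x\<^sup>2 / 2" for x :: real
  define h where "h x = 2 * (1 - x) * (ln x)\<^sup>2" for x :: real
  have F: "set_integrable lborel (einterval 0 1) f" "(LBINT x=0..1. f x) = 3 / 2 - 0"
  proof -
    have D: "DERIV F x :> f x" if "(0::ereal) < ereal x" "ereal x < 1" for x
      using range[OF that] unfolding F_def f_def
      by (auto intro!: derivative_eq_intros simp: field_simps power2_eq_square)
    have c: "isCont f x" if "(0::ereal) < ereal x" "ereal x < 1" for x
      using range[OF that] unfolding f_def by (intro continuous_intros) auto
    have nn: "AE x in lborel. (0::ereal) < ereal x \<longrightarrow> ereal x < 1 \<longrightarrow> 0 \<le> f x"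
    proof (intro AE_I2 impI)
      fix x assume "(0::ereal) < ereal x" "ereal x < 1"
      from range[OF this] show "0 \<le> f x" unfolding f_def by (intro mult_nonneg_nonneg) auto
    qed
    have A: "((F \<circ> real_of_ereal) \<longlongrightarrow> 0) (at_right 0)"
      unfolding zero ereal_tendsto_simps F_def by real_asymp
    have B: "((F \<circ> real_of_ereal) \<longlongrightarrow> 3 / 2) (at_left 1)"
      unfolding one ereal_tendsto_simps F_def by real_asymp
    show "set_integrable lborel (einterval 0 1) f" "(LBINT x=0..1. f x) = 3 / 2 - 0"
      using interval_integral_FTC_nonneg[OF _ D c nn A B] by simp_all
  qed
  have H: "set_integrable lborel (einterval 0 1) h" "(LBINT x=0..1. h x) = 7 / 2 - 0"
  proof -
    have D: "DERIV H x :> h x" if "(0::ereal) < ereal x" "ereal x < 1" for x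
      using range[OF that] unfolding H_def h_def
      by (auto intro!: derivative_eq_intros simp: field_simps power2_eq_square)
    have c: "isCont h x" if "(0::ereal) < ereal x" "ereal x < 1" for x
      using range[OF that] unfolding h_def by (intro continuous_intros) auto
    have nn: "AE x in lborel. (0::ereal) < ereal x \<longrightarrow> ereal x < 1 \<longrightarrow> 0 \<le> h x"
    proof (intro AE_I2 impI)
      fix x assume "(0::ereal) < ereal x" "ereal x < 1"
      from range[OF this] show "0 \<le> h x" unfolding h_def by (intro mult_nonneg_nonneg) auto
    qed
    have A: "((H \<circ> real_of_ereal) \<longlongrightarrow> 0) (at_right 0)"
      unfolding zero ereal_tendsto_simps H_def by real_asymp
    have B: "((H \<circ> real_of_ereal) \<longlongrightarrow> 7 / 2) (at_left 1)"
      unfolding one ereal_tendsto_simps H_def by real_asymp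
    show "set_integrable lborel (einterval 0 1) h" "(LBINT x=0..1. h x) = 7 / 2 - 0"
      using interval_integral_FTC_nonneg[OF _ D c nn A B] by simp_all
  qed
  have f: "height_density (Suc i) x * (- ln x) = indicator (einterval 0 1) x *\<^sub>R f x" for x
    unfolding eint by (simp add: f_def height_density_def indicator_def)
  have h: "height_density (Suc i) x * (ln x)\<^sup>2 = indicator (einterval 0 1) x *\<^sub>R h x" for x
    unfolding eint by (simp add: h_def height_density_def indicator_def)
  show "integrable lborel (\<lambda>x. height_density (Suc i) x * (- ln x))"
    using F(1) unfolding f set_integrable_def .
  show "integrable lborel (\<lambda>x. height_density (Suc i) x * (ln x)\<^sup>2)"
    using H(1) unfolding h set_integrable_def .
  show "(\<integral>x. height_density (Suc i) x * (- ln x) \<partial>lborel) = 3 / 2"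
    using F(2) unfolding f interval_lebesgue_integral_def set_lebesgue_integral_def by simp
  show "(\<integral>x. height_density (Suc i) x * (ln x)\<^sup>2 \<partial>lborel) = 7 / 2"
    using H(2) unfolding h interval_lebesgue_integral_def set_lebesgue_integral_def by simp
qed

text \<open>The logarithm of the ratio of the $i$-th jump time to the initial time.\<close>

definition log_time :: "(nat \<Rightarrow> real) \<Rightarrow> (nat \<Rightarrow> real) \<Rightarrow> nat \<Rightarrow> real" where
  "log_time e t i = ln (scaled_height e t i) - ln (scaled_height e t 0) - 2 * (\<Sum>j=1..i. ln (t j))"

definition renewal_count :: "(nat \<Rightarrow> real) \<Rightarrow> (nat \<Rightarrow> real) \<Rightarrow> real \<Rightarrow> nat" where
  "renewal_count e t L = card {i. 1 \<le> i \<and> log_time e t i \<le> L}"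

definition renewal_area :: "(nat \<Rightarrow> real) \<Rightarrow> (nat \<Rightarrow> real) \<Rightarrow> real \<Rightarrow> real" where
  "renewal_area e t L = (\<Sum>i=1..renewal_count e t L. e i)"

text \<open>By monotonicity of the count it suffices to control the random walk at finitely many grid times.\<close>

definition grid :: "real \<Rightarrow> real \<Rightarrow> int \<Rightarrow> nat" where
  "grid \<epsilon> L j = nat \<lfloor>L / 3 + real_of_int j * \<epsilon> * sqrt L\<rfloor>"

context
  fixes e t :: "nat \<Rightarrow> real"
  assumes pos: "\<And>i. 0 < e i" "\<And>i. 0 < t i" "\<And>i. t i < 1"
begin

lemma scaled_height_pos: "0 < scaled_height e t i"
proof (induction i)
  case 0
  then show ?case using pos(1)[of 0] pos(2)[of 0] by simp
next
  case (Suc i)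
  then show ?case using pos(1)[of "Suc i"] pos(2)[of "Suc i"] by (simp add: add_pos_pos)
qed

text \<open>Crude bounds suffice, since the logarithm of this quantity only has to be negligible
  against sqrt L. Here the squared ratios, all below 1, are dropped.\<close>

lemma scaled_height_le: "scaled_height e t i \<le> 2 * (\<Sum>j\<le>i. e j)"
proof (induction i)
  case 0
  have "(t 0)\<^sup>2 \<le> 1" using pos[of 0] by (intro power_le_one) (auto intro: less_imp_le)
  then show ?case using pos(1)[of 0] by simp
next
  case (Suc i)
  have "(t (Suc i))\<^sup>2 \<le> 1" using pos[of "Suc i"] by (intro power_le_one) (auto intro: less_imp_le)
  moreover have "0 \<le> scaled_height e t i + 2 * e (Suc i)"
    using scaled_height_pos[of i] pos(1)[of "Suc i"] by simp
  ultimately have "scaled_height e t (Suc i) \<le> scaled_height e t i + 2 * e (Suc i)"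
    by (simp add: mult_left_le)
  then show ?case using Suc by simp
qed

lemma scaled_height_ge: "2 * e i * (t i)\<^sup>2 \<le> scaled_height e t i"
proof (cases i)
  case (Suc j)
  then show ?thesis using scaled_height_pos[of j] by (simp add: mult_right_mono)
qed simp

text \<open>The factor \<open>(t (Suc i))\<^sup>2\<close> of the recursion cancels against the new
  term of the walk; what remains is the gain from the positive area.\<close>

lemma log_time_less_Suc: "log_time e t i < log_time e t (Suc i)"
proof -
  have X: "0 < scaled_height e t i" by (rule scaled_height_pos)
  have "ln (scaled_height e t (Suc i)) = ln (scaled_height e t i + 2 * e (Suc i)) + 2 * ln (t (Suc i))"
    using X pos[of "Suc i"] by (simp add: ln_mult ln_realpow add_pos_pos)
  moreover have "ln (scaled_height e t i) < ln (scaled_height e t i + 2 * e (Suc i))"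
    using X pos(1)[of "Suc i"] by simp
  ultimately show ?thesis by (simp add: log_time_def del: scaled_height.simps)
qed

lemma log_time_strict_mono: "strict_mono (log_time e t)"
  by (rule strict_monoI_Suc) (rule log_time_less_Suc)

text \<open>The index K makes the counted set finite, so that its \<open>card\<close> is the true
  number of indices; for an infinite set \<open>card\<close> is 0.\<close>

lemma log_time_le_iff_count:
  assumes K: "L < log_time e t K" and i: "1 \<le> i"
  shows "log_time e t i \<le> L \<longleftrightarrow> i \<le> renewal_count e t L"
proof -
  let ?A = "{i. 1 \<le> i \<and> log_time e t i \<le> L}"
  note lt = strict_mono_less[OF log_time_strict_mono] and le = strict_mono_less_eq[OF log_time_strict_mono]
  have "?A \<subseteq> {..K}"
  proof
    fix j assume "j \<in> ?A"
    then have "log_time e t j < log_time e t K" using K by simp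
    then show "j \<in> {..K}" by (simp add: lt)
  qed
  then have fin: "finite ?A" by (rule finite_subset) simp
  show ?thesis
  proof
    assume a: "log_time e t i \<le> L"
    have "{1..i} \<subseteq> ?A"
    proof
      fix j assume "j \<in> {1..i}"
      then have "1 \<le> j" "log_time e t j \<le> log_time e t i" by (simp_all add: le)
      then show "j \<in> ?A" using a by simp
    qed
    from card_mono[OF fin this] show "i \<le> renewal_count e t L" by (simp add: renewal_count_def)
  next
    assume a: "i \<le> renewal_count e t L"
    show "log_time e t i \<le> L"
    proof (rule ccontr)
      assume n: "\<not> log_time e t i \<le> L"
      have "?A \<subseteq> {1..<i}"
      proof
        fix j assume "j \<in> ?A"
        then have "1 \<le> j" "log_time e t j < log_time e t i" using n by simp_all
        then show "j \<in> {1..<i}" by (simp add: lt)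
      qed
      from card_mono[OF _ this] show False using a i by (simp add: renewal_count_def)
    qed
  qed
qed

text \<open>The count lies between two neighbouring grid times, at most
  \<open>\<epsilon> * s + 1 \<le> 2 * \<epsilon> * s\<close> apart, at which the walk is below and
  above L. As the walk there is 3 times the index plus S up to \<open>\<epsilon> * s\<close>, this
  locates the count, and the area, monotone in the count, is squeezed likewise. The condition on J
  puts the outermost grid times on either side of L despite S, the error and the rounding, which
  costs at most 3 \<le> s.\<close>

lemma renewal_grid_estimate:
  fixes L \<epsilon> C S :: real and J :: int and H :: "nat \<Rightarrow> real"
  defines "s \<equiv> sqrt L" and "N \<equiv> renewal_count e t L"
  assumes L: "0 < L" and \<epsilon>: "0 < \<epsilon>" and big: "1 \<le> \<epsilon> * s" "1 \<le> L / 3 - real_of_int J * \<epsilon> * s"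
    and J: "0 < J" "C + 2 + 4 * \<epsilon> < 3 * real_of_int J * \<epsilon>" and s1: "3 \<le> s"
    and S: "\<bar>S\<bar> \<le> C * s"
    and time: "\<And>j. - J \<le> j \<Longrightarrow> j \<le> J \<Longrightarrow> \<bar>log_time e t (grid \<epsilon> L j) - 3 * real (grid \<epsilon> L j) - S\<bar> \<le> \<epsilon> * s"
    and area: "\<And>j. - J \<le> j \<Longrightarrow> j \<le> J \<Longrightarrow> \<bar>H (grid \<epsilon> L j) - h\<bar> \<le> \<epsilon> * s"
    and H: "\<And>k. H k = (\<Sum>i=1..k. e i - 1)"
  shows "\<bar>real N - L / 3 + S / 3\<bar> \<le> 4 * \<epsilon> * s" "\<bar>renewal_area e t L - real N - h\<bar> \<le> 4 * \<epsilon> * s"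
proof -
  have Ls: "L = s * s" using L by (simp add: s_def)
  let ?y = "\<lambda>j. L / 3 + real_of_int j * \<epsilon> * s"
  let ?k = "grid \<epsilon> L"
  have es: "0 \<le> \<epsilon> * s" using big by linarith
  have y: "1 \<le> ?y j" if "- J \<le> j" for j
  proof -
    have "real_of_int (- J) * (\<epsilon> * s) \<le> real_of_int j * (\<epsilon> * s)"
      using that es by (intro mult_right_mono) auto
    then show ?thesis using big(2) by (simp add: mult.assoc)
  qed
  have k: "real (?k j) \<le> ?y j" "?y j - 1 < real (?k j)" "1 \<le> ?k j" if "- J \<le> j" for j
  proof -
    have "(1::int) \<le> \<lfloor>?y j\<rfloor>" using y[OF that] by simp
    moreover from this have "1 \<le> nat \<lfloor>?y j\<rfloor>" by linarith
    ultimately have "real (?k j) = of_int \<lfloor>?y j\<rfloor>" "1 \<le> ?k j" by (simp_all only: grid_def s_def of_nat_nat)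
    then show "real (?k j) \<le> ?y j" "?y j - 1 < real (?k j)" "1 \<le> ?k j" by linarith+
  qed
  have Jeps: "(C + 2 + 4 * \<epsilon>) * s < 3 * real_of_int J * \<epsilon> * s" using J(2) s1 by (intro mult_strict_right_mono) auto
  have top: "L < log_time e t (?k J)"
    using time[of J] k(2)[of J] S Jeps J(1) s1 es by (simp add: algebra_simps abs_le_iff)
  note iff = log_time_le_iff_count[OF top, folded N_def]
  have upper: "N < ?k J" using iff[OF k(3)[of J]] top J by auto
  have bottom: "log_time e t (?k (- J)) \<le> L"
    using time[of "- J"] k(1)[of "- J"] S Jeps J(1) s1 es by (simp add: algebra_simps abs_le_iff)
  then have lower: "?k (- J) \<le> N" using iff[OF k(3)[of "- J"]] by auto
  \<comment> \<open>Otherwise, climbing the grid from -J, the count would be at least every grid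
    time, including the last.\<close>
  have "\<exists>j. - J \<le> j \<and> j < J \<and> ?k j \<le> N \<and> N < ?k (j + 1)"
  proof (rule ccontr)
    assume no: "\<not> ?thesis"
    have "?k (- J + int m) \<le> N" if "int m \<le> 2 * J" for m
      using that
    proof (induction m)
      case (Suc m)
      then have "?k (- J + int m) \<le> N" by simp
      moreover have "\<not> (- J \<le> - J + int m \<and> - J + int m < J \<and> ?k (- J + int m) \<le> N \<and> N < ?k (- J + int m + 1))"
        using no by blast
      ultimately have "?k (- J + int m + 1) \<le> N" using Suc.prems by linarith
      moreover have "- J + int (Suc m) = - J + int m + 1" by simp
      ultimately show ?case by (simp only:)
    qed (use lower in simp)
    from this[of "nat (2 * J)"] show False using upper J by simp
  qed
  then obtain j where j: "- J \<le> j" "j < J" "?k j \<le> N" "N < ?k (j + 1)" by blast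
  have tj: "log_time e t (?k j) \<le> L" using iff[OF k(3)[OF j(1)]] j by simp
  have tj1: "L < log_time e t (?k (j + 1))" using iff[OF k(3)[of "j + 1"]] j by simp
  have step: "?y (j + 1) = ?y j + \<epsilon> * s" by (simp add: algebra_simps)
  have gap: "real (?k (j + 1)) - real (?k j) \<le> \<epsilon> * s + 1"
    using k(1)[of "j + 1"] k(2)[of j] step j by simp
  have 1: "3 * real (?k j) + S - \<epsilon> * s \<le> L" using time[of j] tj j by simp
  have 2: "L < 3 * real (?k (j + 1)) + S + \<epsilon> * s" using time[of "j + 1"] tj1 j by simp
  have N: "real (?k j) \<le> real N" "real N \<le> real (?k (j + 1))" using j by simp_all
  show "\<bar>real N - L / 3 + S / 3\<bar> \<le> 4 * \<epsilon> * s"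
    using 1 2 N gap big(1) by (simp add: abs_le_iff)
  have split: "(\<Sum>i=1..k. e i) = H k + real k" for k by (simp add: H sum_subtractf)
  have mono: "(\<Sum>i=1..k. e i) \<le> (\<Sum>i=1..k'. e i)" if "k \<le> k'" for k k'
    using that pos(1) by (intro sum_mono2) (auto intro: less_imp_le)
  have "(\<Sum>i=1..?k j. e i) \<le> renewal_area e t L" "renewal_area e t L \<le> (\<Sum>i=1..?k (j + 1). e i)"
    unfolding renewal_area_def N_def[symmetric] using mono[of "?k j" N] mono[of N "?k (j + 1)"] j by simp_all
  then have "H (?k j) + real (?k j) \<le> renewal_area e t L" "renewal_area e t L \<le> H (?k (j + 1)) + real (?k (j + 1))"
    by (simp_all only: split)
  then show "\<bar>renewal_area e t L - real N - h\<bar> \<le> 4 * \<epsilon> * s"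
    using area[of j] area[of "j + 1"] j N gap big(1) by (simp add: abs_le_iff)
qed

end

section \<open>Second moments of sums of independent variables\<close>

context prob_space
begin

lemma indep_vars_reindex:
  assumes ind: "indep_vars M' X I" and f: "inj_on f L" "f ` L \<subseteq> I"
  shows "indep_vars (\<lambda>j. M' (f j)) (\<lambda>j. X (f j)) L"
proof -
  have "indep_vars (\<lambda>j. PiM {f j} M') (\<lambda>j \<omega>. restrict (\<lambda>i. X i \<omega>) {f j}) L"
    using f by (intro indep_vars_restrict[OF ind]) (auto simp: disjoint_family_on_def inj_on_def)
  then have "indep_vars (\<lambda>j. M' (f j)) (\<lambda>j \<omega>. (\<lambda>w. w (f j)) (restrict (\<lambda>i. X i \<omega>) {f j})) L"
    by (rule indep_vars_compose2) (auto intro!: measurable_component_singleton)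
  then show ?thesis by simp
qed

lemma indep_second_moment:
  fixes X :: "nat \<Rightarrow> 'a \<Rightarrow> real"
  assumes ind: "indep_vars (\<lambda>_. borel) X UNIV" and mean: "\<And>i. expectation (X i) = 0"
    and sq: "\<And>i. integrable M (\<lambda>\<omega>. (X i \<omega>)\<^sup>2)" "\<And>i. expectation (\<lambda>\<omega>. (X i \<omega>)\<^sup>2) = v" and J: "finite J"
  shows "integrable M (\<lambda>\<omega>. (\<Sum>i\<in>J. X i \<omega>)\<^sup>2) \<and> expectation (\<lambda>\<omega>. (\<Sum>i\<in>J. X i \<omega>)\<^sup>2) = real (card J) * v"
  using J
proof (induction J rule: finite_induct)
  case (insert j J)
  have rv: "random_variable borel (X i)" for i using ind by (simp add: indep_vars_def)
  have int: "integrable M (X i)" for i by (rule square_integrable_imp_integrable[OF rv sq(1)])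
  let ?S = "\<lambda>\<omega>. \<Sum>i\<in>J. X i \<omega>"
  have intS: "integrable M ?S" using int by simp
  have iv: "indep_var borel (X j) borel ?S"
    using insert by (intro indep_vars_sum indep_vars_subset[OF ind]) auto
  have prod: "integrable M (\<lambda>\<omega>. X j \<omega> * ?S \<omega>)" "expectation (\<lambda>\<omega>. X j \<omega> * ?S \<omega>) = 0"
    using indep_var_integrable[OF iv int intS] indep_var_lebesgue_integral[OF iv int intS] mean by auto
  have eq: "(\<Sum>i\<in>insert j J. X i \<omega>)\<^sup>2 = (X j \<omega>)\<^sup>2 + 2 * (X j \<omega> * ?S \<omega>) + (?S \<omega>)\<^sup>2" for \<omega>
    using insert by (simp add: power2_eq_square algebra_simps)
  show ?case unfolding eq using insert sq prod by (simp add: algebra_simps)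
qed simp

text \<open>Chebyshev for the increment between two times, in either order: the variance is v times
  the number of steps between them.\<close>

lemma indep_sum_deviation:
  fixes X :: "nat \<Rightarrow> 'a \<Rightarrow> real"
  assumes ind: "indep_vars (\<lambda>_. borel) X UNIV" and mean: "\<And>i. expectation (X i) = 0"
    and sq: "\<And>i. integrable M (\<lambda>\<omega>. (X i \<omega>)\<^sup>2)" "\<And>i. expectation (\<lambda>\<omega>. (X i \<omega>)\<^sup>2) = v" and \<delta>: "0 < \<delta>"
  shows "prob {\<omega>\<in>space M. \<delta> \<le> \<bar>(\<Sum>i<k. X i \<omega>) - (\<Sum>i<n. X i \<omega>)\<bar>} \<le> v * \<bar>real k - real n\<bar> / \<delta>\<^sup>2"
proof -
  have rv [measurable]: "random_variable borel (X i)" for i using ind by (simp add: indep_vars_def)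
  have main: "prob {\<omega>\<in>space M. \<delta> \<le> \<bar>\<Sum>i\<in>{p..<q}. X i \<omega>\<bar>} \<le> v * (real q - real p) / \<delta>\<^sup>2" if "p \<le> q" for p q
  proof -
    note sm = indep_second_moment[OF ind mean sq, of "{p..<q}"]
    have "prob {\<omega>\<in>space M. \<bar>\<Sum>i\<in>{p..<q}. X i \<omega>\<bar> \<ge> \<delta>} \<le> expectation (\<lambda>\<omega>. (\<Sum>i\<in>{p..<q}. X i \<omega>)\<^sup>2) / \<delta>\<^sup>2"
      using sm \<delta> by (intro second_moment_method) auto
    then show ?thesis using sm that by (simp add: of_nat_diff mult.commute)
  qed
  show ?thesis
  proof (cases "n \<le> k")
    case True
    have "(\<Sum>i<k. X i \<omega>) - (\<Sum>i<n. X i \<omega>) = (\<Sum>i\<in>{n..<k}. X i \<omega>)" for \<omega>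
      using True sum_diff_nat_ivl[of 0 n k "\<lambda>i. X i \<omega>"] by (simp add: atLeast0LessThan)
    then show ?thesis using main[OF True] True by simp
  next
    case False
    then have le: "k \<le> n" by simp
    have "\<bar>(\<Sum>i<k. X i \<omega>) - (\<Sum>i<n. X i \<omega>)\<bar> = \<bar>\<Sum>i\<in>{k..<n}. X i \<omega>\<bar>" for \<omega>
      using le sum_diff_nat_ivl[of 0 k n "\<lambda>i. X i \<omega>"] by (simp add: atLeast0LessThan)
    then show ?thesis using main[OF le] le by simp
  qed
qed

end

section \<open>Renewal statistics of independent steps\<close>

lemma log_time_measurable [measurable]:
  "(\<lambda>z. log_time (\<lambda>i. z (i, True)) (\<lambda>i. z (i, False)) i) \<in> borel_measurable (PiM UNIV (\<lambda>_. borel))"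
proof -
  have [measurable]: "(\<lambda>z. z j) \<in> borel_measurable (PiM UNIV (\<lambda>_::nat \<times> bool. borel :: real measure))" for j
    by (rule measurable_component_singleton) simp
  have [measurable]: "(\<lambda>z. scaled_height (\<lambda>i. z (i, True)) (\<lambda>i. z (i, False)) i) \<in> borel_measurable (PiM UNIV (\<lambda>_. borel))" for i
    by (induction i) simp_all
  show ?thesis unfolding log_time_def by measurable
qed

lemma renewal_measurable [measurable]:
  "(\<lambda>z. real (renewal_count (\<lambda>i. z (i, True)) (\<lambda>i. z (i, False)) L)) \<in> borel_measurable (PiM UNIV (\<lambda>_. borel))"
  "(\<lambda>z. renewal_area (\<lambda>i. z (i, True)) (\<lambda>i. z (i, False)) L) \<in> borel_measurable (PiM UNIV (\<lambda>_. borel))"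
proof -
  have [measurable]: "(\<lambda>z. z j) \<in> borel_measurable (PiM UNIV (\<lambda>_::nat \<times> bool. borel :: real measure))" for j
    by (rule measurable_component_singleton) simp
  have c: "(\<lambda>z. renewal_count (\<lambda>i. z (i, True)) (\<lambda>i. z (i, False)) L) \<in> measurable (PiM UNIV (\<lambda>_. borel)) (count_space UNIV)"
    unfolding renewal_count_def by measurable
  then show "(\<lambda>z. real (renewal_count (\<lambda>i. z (i, True)) (\<lambda>i. z (i, False)) L)) \<in> borel_measurable (PiM UNIV (\<lambda>_. borel))"
    by (rule measurable_compose) simp
  show "(\<lambda>z. renewal_area (\<lambda>i. z (i, True)) (\<lambda>i. z (i, False)) L) \<in> borel_measurable (PiM UNIV (\<lambda>_. borel))"
    unfolding renewal_area_def
    by (rule measurable_compose_countable[where f="\<lambda>n z. \<Sum>i=1..n. z (i, True)", OF _ c]) measurable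
qed

text \<open>The limit theorem uses only the joint law of the coordinates, so it is proved for any
  variables having that law.\<close>

locale renewal_steps = prob_space M for M :: "'a measure" +
  fixes Z :: "nat \<times> bool \<Rightarrow> 'a \<Rightarrow> real"
  assumes indep: "indep_vars (\<lambda>_. borel) Z UNIV"
    and law: "\<And>j. distr M borel (Z j) = step_law j"
begin

abbreviation "area_steps \<omega> \<equiv> (\<lambda>i. Z (i, True) \<omega>)"
abbreviation "height_steps \<omega> \<equiv> (\<lambda>i. Z (i, False) \<omega>)"

lemma Z_measurable [measurable]: "Z j \<in> borel_measurable M"
  using indep unfolding indep_vars_def by blast

lemma Z_seq_measurable: "(\<lambda>\<omega> j. Z j \<omega>) \<in> measurable M (PiM UNIV (\<lambda>_. borel))"
  by (rule measurable_PiM_single') auto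

lemma count_area_measurable [measurable]:
  "(\<lambda>\<omega>. real (renewal_count (area_steps \<omega>) (height_steps \<omega>) L)) \<in> borel_measurable M"
  "(\<lambda>\<omega>. renewal_area (area_steps \<omega>) (height_steps \<omega>) L) \<in> borel_measurable M"
  "(\<lambda>\<omega>. log_time (area_steps \<omega>) (height_steps \<omega>) i) \<in> borel_measurable M"
  using measurable_compose[OF Z_seq_measurable renewal_measurable(1)]
    measurable_compose[OF Z_seq_measurable renewal_measurable(2)]
    measurable_compose[OF Z_seq_measurable log_time_measurable] by auto

lemma distributed_Z: "distributed M lborel (Z j) (step_density j)"
  unfolding distributed_def
proof (intro conjI)
  have "distr M lborel (Z j) = distr M borel (Z j)" by (rule distr_cong) auto
  then show "distr M lborel (Z j) = density lborel (\<lambda>x. ennreal (step_density j x))"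
    by (simp add: law step_law_def)
qed auto

lemma AE_steps: "AE \<omega> in M. \<forall>i. 0 < Z (i, True) \<omega> \<and> 0 < Z (i, False) \<omega> \<and> Z (i, False) \<omega> < 1"
proof -
  have e: "AE \<omega> in M. 0 < Z (i, True) \<omega>" for i
  proof -
    have "AE x in step_law (i, True). 0 < x"
      unfolding step_law_def using AE_lborel_singleton[of 0]
      by (subst AE_density) (auto simp: exponential_density_def elim!: eventually_mono)
    then have "AE x in distr M borel (Z (i, True)). 0 < x" by (simp only: law)
    then show ?thesis by (rule AE_distrD[rotated]) simp
  qed
  have t: "AE \<omega> in M. 0 < Z (i, False) \<omega> \<and> Z (i, False) \<omega> < 1" for i
  proof -
    have "AE x in step_law (i, False). 0 < x \<and> x < 1"
      unfolding step_law_def by (subst AE_density) (auto simp: height_density_def)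
    then have "AE x in distr M borel (Z (i, False)). 0 < x \<and> x < 1" by (simp only: law)
    then show ?thesis by (rule AE_distrD[rotated]) simp
  qed
  show ?thesis unfolding AE_all_countable using e t by auto
qed

text \<open>All step densities are bounded by 2 and vanish on the negative axis.\<close>

lemma prob_small_step:
  assumes u: "0 \<le> u" shows "prob {\<omega>\<in>space M. Z j \<omega> < u} \<le> 2 * u"
proof -
  have "emeasure M {\<omega>\<in>space M. Z j \<omega> < u} = emeasure (distr M borel (Z j)) {..<u}"
    by (subst emeasure_distr) (auto intro!: arg_cong[where f="emeasure M"])
  also have "\<dots> = (\<integral>\<^sup>+x. ennreal (step_density j x) * indicator {..<u} x \<partial>lborel)"
    unfolding law step_law_def by (rule emeasure_density) auto
  also have "\<dots> \<le> (\<integral>\<^sup>+x. 2 * indicator {0..u} x \<partial>lborel)"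
  proof (rule nn_integral_mono)
    fix x
    obtain i b where j: "j = (i, b)" by (cases j)
    consider "x < 0" | "u \<le> x" | "0 \<le> x" "x < u" by linarith
    then show "ennreal (step_density j x) * indicator {..<u} x \<le> 2 * indicator {0..u} x"
    proof cases
      case 1
      then have "step_density j x = 0" by (simp add: j height_density_def exponential_density_def)
      then show ?thesis by simp
    next
      case 3
      have "exp (- x) \<le> 1" using 3 by simp
      then have "exp (- x) \<le> 2" by linarith
      then have "exponential_density 1 x \<le> 2" using 3 by (simp add: exponential_density_def)
      moreover have "height_density i x \<le> 2" using 3 by (simp add: height_density_def)
      ultimately have "step_density j x \<le> 2" by (simp add: j)
      then have "ennreal (step_density j x) \<le> ennreal 2" by (rule ennreal_leI)
      then show ?thesis using 3 by simp
    qed simp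
  qed
  also have "\<dots> = ennreal (2 * u)"
    using u by (simp add: nn_integral_cmult_indicator ennreal_mult ennreal_numeral[symmetric] del: ennreal_numeral)
  finally show ?thesis using u by (simp add: emeasure_eq_measure)
qed

text \<open>The shift to \<open>Suc i\<close> leaves out index 0, whose ratio has a different law; 3
  is the mean of -2 ln t.\<close>

definition height_noise :: "nat \<Rightarrow> 'a \<Rightarrow> real" where
  "height_noise i \<omega> = - 2 * ln (Z (Suc i, False) \<omega>) - 3"

definition area_noise :: "nat \<Rightarrow> 'a \<Rightarrow> real" where
  "area_noise i \<omega> = Z (Suc i, True) \<omega> - 1"

lemma noise_measurable [measurable]:
  "height_noise i \<in> borel_measurable M" "area_noise i \<in> borel_measurable M"
  unfolding height_noise_def area_noise_def by measurable

lemma height_noise_moments: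
  "expectation (height_noise i) = 0" "integrable M (\<lambda>\<omega>. (height_noise i \<omega>)\<^sup>2)"
  "expectation (\<lambda>\<omega>. (height_noise i \<omega>)\<^sup>2) = 5"
proof -
  note D = distributed_Z[of "(Suc i, False)"]
  have d: "step_density (Suc i, False) = height_density (Suc i)" by (simp add: fun_eq_iff)
  have i1: "integrable M (\<lambda>\<omega>. ln (Z (Suc i, False) \<omega>))"
    using distributed_integrable[OF D, of "\<lambda>x. - ln x"] ln_moments(1)[of i] by (simp add: d height_density_nonneg del: step_density.simps)
  have e1: "expectation (\<lambda>\<omega>. - ln (Z (Suc i, False) \<omega>)) = 3 / 2"
    using distributed_integral[OF D, of "\<lambda>x. - ln x"] ln_moments(2)[of i] by (simp add: d height_density_nonneg del: step_density.simps)
  have i2: "integrable M (\<lambda>\<omega>. (ln (Z (Suc i, False) \<omega>))\<^sup>2)"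
    using distributed_integrable[OF D, of "\<lambda>x. (ln x)\<^sup>2"] ln_moments(3)[of i] by (simp add: d height_density_nonneg del: step_density.simps)
  have e2: "expectation (\<lambda>\<omega>. (ln (Z (Suc i, False) \<omega>))\<^sup>2) = 7 / 2"
    using distributed_integral[OF D, of "\<lambda>x. (ln x)\<^sup>2"] ln_moments(4)[of i] by (simp add: d height_density_nonneg del: step_density.simps)
  show "expectation (height_noise i) = 0"
    unfolding height_noise_def using i1 e1 by (simp add: prob_space)
  have sq: "(height_noise i \<omega>)\<^sup>2 = 4 * (ln (Z (Suc i, False) \<omega>))\<^sup>2 + 12 * ln (Z (Suc i, False) \<omega>) + 9" for \<omega>
    by (simp add: height_noise_def power2_eq_square algebra_simps)
  show "integrable M (\<lambda>\<omega>. (height_noise i \<omega>)\<^sup>2)" unfolding sq using i1 i2 by simp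
  show "expectation (\<lambda>\<omega>. (height_noise i \<omega>)\<^sup>2) = 5" unfolding sq using i1 i2 e1 e2 by (simp add: prob_space)
qed

lemma Z_area_moment:
  "integrable M (Z (i, True))" "expectation (Z (i, True)) = 1"
  "integrable M (\<lambda>\<omega>. (Z (i, True) \<omega>)\<^sup>2)" "expectation (\<lambda>\<omega>. (Z (i, True) \<omega>)\<^sup>2) = 2"
proof -
  have D: "distributed M lborel (Z (i, True)) (exponential_density 1)" using distributed_Z[of "(i, True)"] by simp
  show "integrable M (Z (i, True))" using erlang_ith_moment_integrable[OF _ D, of 1] by simp
  show "expectation (Z (i, True)) = 1" using erlang_ith_moment[OF _ D, of 1] by simp
  show "integrable M (\<lambda>\<omega>. (Z (i, True) \<omega>)\<^sup>2)" using erlang_ith_moment_integrable[OF _ D, of 2] by simp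
  show "expectation (\<lambda>\<omega>. (Z (i, True) \<omega>)\<^sup>2) = 2" using erlang_ith_moment[OF _ D, of 2] by (simp add: fact_numeral)
qed

lemma area_noise_moments:
  "expectation (area_noise i) = 0" "integrable M (\<lambda>\<omega>. (area_noise i \<omega>)\<^sup>2)"
  "expectation (\<lambda>\<omega>. (area_noise i \<omega>)\<^sup>2) = 1"
proof -
  note m = Z_area_moment[of "Suc i"]
  show "expectation (area_noise i) = 0" unfolding area_noise_def using m by (simp add: prob_space)
  have sq: "(area_noise i \<omega>)\<^sup>2 = (Z (Suc i, True) \<omega>)\<^sup>2 - 2 * Z (Suc i, True) \<omega> + 1" for \<omega>
    by (simp add: area_noise_def power2_eq_square algebra_simps)
  show "integrable M (\<lambda>\<omega>. (area_noise i \<omega>)\<^sup>2)" unfolding sq using m by simp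
  show "expectation (\<lambda>\<omega>. (area_noise i \<omega>)\<^sup>2) = 1" unfolding sq using m by (simp add: prob_space)
qed

lemma indep_height_noise: "indep_vars (\<lambda>_. borel) height_noise UNIV"
proof -
  have "indep_vars (\<lambda>_. borel) (\<lambda>i. Z (Suc i, False)) UNIV"
    by (rule indep_vars_reindex[OF indep, of "\<lambda>i. (Suc i, False)"]) (auto simp: inj_on_def)
  from indep_vars_compose2[OF this, of "\<lambda>_ x. - 2 * ln x - 3" "\<lambda>_. borel"]
  show ?thesis by (simp add: height_noise_def[abs_def])
qed

lemma indep_area_noise: "indep_vars (\<lambda>_. borel) area_noise UNIV"
proof -
  have "indep_vars (\<lambda>_. borel) (\<lambda>i. Z (Suc i, True)) UNIV"
    by (rule indep_vars_reindex[OF indep, of "\<lambda>i. (Suc i, True)"]) (auto simp: inj_on_def)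
  from indep_vars_compose2[OF this, of "\<lambda>_ x. x - 1" "\<lambda>_. borel"]
  show ?thesis by (simp add: area_noise_def[abs_def])
qed

text \<open>A large value forces a large sum of areas, which Markov controls. A small value forces
  the last area or the last ratio below exp (- u / 3), because area times squared ratio is a lower
  bound and three such factors make exp (- u).\<close>

lemma prob_log_scaled_height:
  assumes u: "0 < u"
  shows "prob {\<omega>\<in>space M. u < \<bar>ln (scaled_height (area_steps \<omega>) (height_steps \<omega>) k)\<bar>} \<le>
    2 * (real k + 1) * exp (- u) + 4 * exp (- u / 3)"
proof -
  let ?X = "\<lambda>\<omega>. scaled_height (area_steps \<omega>) (height_steps \<omega>) k"
  have [measurable]: "(\<lambda>\<omega>. scaled_height (area_steps \<omega>) (height_steps \<omega>) i) \<in> borel_measurable M" for i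
    by (induction i) simp_all
  let ?A = "{\<omega>\<in>space M. exp u \<le> 2 * (\<Sum>j\<le>k. Z (j, True) \<omega>)}"
  let ?B = "\<lambda>b. {\<omega>\<in>space M. Z (k, b) \<omega> < exp (- u / 3)}"
  have int: "integrable M (\<lambda>\<omega>. 2 * (\<Sum>j\<le>k. Z (j, True) \<omega>))" using Z_area_moment by simp
  have "prob {\<omega>\<in>space M. u < \<bar>ln (?X \<omega>)\<bar>} \<le> prob (?A \<union> (?B True \<union> ?B False))"
  proof (rule finite_measure_mono_AE)
    show "AE \<omega> in M. \<omega> \<in> {\<omega>\<in>space M. u < \<bar>ln (?X \<omega>)\<bar>} \<longrightarrow> \<omega> \<in> ?A \<union> (?B True \<union> ?B False)"
      using AE_steps
    proof (eventually_elim, intro impI)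
      fix \<omega> assume pos: "\<forall>i. 0 < Z (i, True) \<omega> \<and> 0 < Z (i, False) \<omega> \<and> Z (i, False) \<omega> < 1"
        and \<omega>: "\<omega> \<in> {\<omega>\<in>space M. u < \<bar>ln (?X \<omega>)\<bar>}"
      have X: "0 < ?X \<omega>" using pos by (intro scaled_height_pos) auto
      from \<omega> have "u < \<bar>ln (?X \<omega>)\<bar>" by simp
      then consider "u < ln (?X \<omega>)" | "ln (?X \<omega>) < - u" by linarith
      then show "\<omega> \<in> ?A \<union> (?B True \<union> ?B False)"
      proof cases
        case 1
        then have "exp u < exp (ln (?X \<omega>))" by (simp only: exp_less_cancel_iff)
          then have "exp u < ?X \<omega>" using X by (simp only: exp_ln)
        also have "\<dots> \<le> 2 * (\<Sum>j\<le>k. Z (j, True) \<omega>)" using pos by (intro scaled_height_le) auto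
        finally show ?thesis using \<omega> by simp
      next
        case 2
        show ?thesis
        proof (rule ccontr)
          assume "\<not> ?thesis"
          then have e: "exp (- u / 3) \<le> Z (k, True) \<omega>" and t: "exp (- u / 3) \<le> Z (k, False) \<omega>" using \<omega> by auto
          have "exp (- u) = exp (- u / 3) * (exp (- u / 3))\<^sup>2"
            by (simp add: power2_eq_square flip: exp_add)
          also have "\<dots> \<le> Z (k, True) \<omega> * (Z (k, False) \<omega>)\<^sup>2"
            using e t pos by (intro mult_mono power_mono) (auto intro: less_imp_le)
          also have "\<dots> \<le> 2 * Z (k, True) \<omega> * (Z (k, False) \<omega>)\<^sup>2"
            using pos[rule_format, of k] by (intro mult_right_mono) auto
          also have "\<dots> \<le> ?X \<omega>" using pos by (intro scaled_height_ge) auto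
          finally have "- u \<le> ln (?X \<omega>)" using X by (simp add: ln_ge_iff)
          then show False using 2 by simp
        qed
      qed
    qed
  qed measurable
  also have "\<dots> \<le> prob ?A + (prob (?B True) + prob (?B False))"
    by (intro order_trans[OF measure_Un_le] add_left_mono measure_Un_le) measurable
  also have "prob ?A \<le> expectation (\<lambda>\<omega>. 2 * (\<Sum>j\<le>k. Z (j, True) \<omega>)) / exp u"
  proof (rule integral_Markov_inequality_measure[where A="{}", simplified])
    show "AE \<omega> in M. 0 \<le> 2 * (\<Sum>j\<le>k. Z (j, True) \<omega>)"
      using AE_steps by eventually_elim (simp add: sum_nonneg less_imp_le)
  qed (use int in simp_all)
  also have "expectation (\<lambda>\<omega>. 2 * (\<Sum>j\<le>k. Z (j, True) \<omega>)) / exp u = 2 * (real k + 1) * exp (- u)"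
    using Z_area_moment by (simp add: exp_minus divide_inverse)
  also have "prob (?B True) + prob (?B False) \<le> 2 * exp (- u / 3) + 2 * exp (- u / 3)"
    by (intro add_mono prob_small_step) auto
  finally show ?thesis by simp
qed

end

section \<open>Slutsky's lemma and the renewal approximation\<close>

lemma (in prob_space) converges_in_distribution_close:
  fixes X Y :: "'i \<Rightarrow> 'a \<Rightarrow> 'b::euclidean_space"
  assumes Y: "converges_in_distribution M Y N F"
    and N: "prob_space N" "sets N = sets borel"
    and X: "\<forall>\<^sub>F i in F. X i \<in> borel_measurable M"
    and close: "\<And>\<delta> \<rho>. 0 < \<delta> \<Longrightarrow> 0 < \<rho> \<Longrightarrow> \<forall>\<^sub>F i in F. prob {\<omega>\<in>space M. \<delta> \<le> norm (X i \<omega> - Y i \<omega>)} < \<rho>"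
  shows "converges_in_distribution M X N F"
  unfolding converges_in_distribution_def
proof (intro conjI allI impI)
  interpret N: prob_space N by (rule N)
  have spN: "space N = UNIV" using sets_eq_imp_space_eq[OF N(2)] by simp
  have Yconv: "((\<lambda>i. \<integral>\<omega>. g (Y i \<omega>) \<partial>M) \<longlongrightarrow> (\<integral>x. g x \<partial>N)) F" if "continuous_on UNIV g" "bounded (range g)" for g :: "'b \<Rightarrow> real"
    using Y that by (simp add: converges_in_distribution_def)
  have Ymeas: "\<forall>\<^sub>F i in F. Y i \<in> borel_measurable M" using Y by (simp add: converges_in_distribution_def)
  fix f :: "'b \<Rightarrow> real"
  assume f: "continuous_on UNIV f \<and> bounded (range f)"
  then obtain B where B: "0 < B" "\<And>x. \<bar>f x\<bar> \<le> B" by (auto simp: bounded_pos)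
  have fm [measurable]: "f \<in> borel_measurable borel" using f by (intro borel_measurable_continuous_onI) simp
  have diff: "((\<lambda>i. (\<integral>\<omega>. f (X i \<omega>) \<partial>M) - (\<integral>\<omega>. f (Y i \<omega>) \<partial>M)) \<longlongrightarrow> 0) F"
  proof (rule tendstoI)
    fix \<eta> :: real assume \<eta>: "0 < \<eta>"
    \<comment> \<open>Two error terms of at most \<open>2 * B * \<rho>\<close> each will appear,
      together half of \<eta>.\<close>
    define \<rho> where "\<rho> = \<eta> / (8 * B)"
    have \<rho>: "0 < \<rho>" using \<eta> B by (simp add: \<rho>_def)
    have "(\<lambda>n. N.prob {x. real n \<le> norm x}) \<longlonglongrightarrow> N.prob (\<Inter>n. {x. real n \<le> norm x})"
    proof (rule N.finite_Lim_measure_decseq)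
      show "range (\<lambda>n. {x. real n \<le> norm x}) \<subseteq> sets N" unfolding N(2) by auto
      show "decseq (\<lambda>n. {x. real n \<le> norm x})" by (auto simp: decseq_def)
    qed
    moreover have "(\<Inter>n. {x :: 'b. real n \<le> norm x}) = {}"
    proof (rule equals0I)
      fix x :: 'b assume x: "x \<in> (\<Inter>n. {x. real n \<le> norm x})"
      obtain n where "norm x < real n" using reals_Archimedean2 by blast
      moreover have "real n \<le> norm x" using x by blast
      ultimately show False by simp
    qed
    ultimately have "(\<lambda>n. N.prob {x. real n \<le> norm x}) \<longlonglongrightarrow> 0" by simp
    from order_tendstoD(2)[OF this \<rho>] obtain K where K: "N.prob {x. real K \<le> norm x} < \<rho>"
      by (auto simp: eventually_sequentially)
    \<comment> \<open>A continuous substitute for the indicator of large norms, 0 up to K and 1 from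
      K + 1 on; through it the tail bound of the limit passes to Y.\<close>
    define cut where "cut x = min 1 (max 0 (norm x - real K))" for x :: 'b
    have cut: "continuous_on UNIV cut" "bounded (range cut)" "\<And>x. 0 \<le> cut x" "\<And>x. cut x \<le> 1"
      unfolding cut_def by (auto intro!: continuous_intros boundedI[of _ 1])
    have cutm [measurable]: "cut \<in> borel_measurable borel" using cut by (intro borel_measurable_continuous_onI)
    have "(\<integral>x. cut x \<partial>N) \<le> (\<integral>x. indicator {x. real K \<le> norm x} x \<partial>N)"
    proof (rule integral_mono)
      show "integrable N cut"
        using cut(3,4) by (intro N.integrable_const_bound[of _ 1]) (auto simp: N(2) cong: measurable_cong_sets)
      show "integrable N (\<lambda>x. indicator {x. real K \<le> norm x} x :: real)"
        by (intro integrable_real_indicator) (auto simp: N(2) N.emeasure_eq_measure)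
      show "cut x \<le> indicator {x. real K \<le> norm x} x" for x
        by (auto simp: cut_def indicator_def)
    qed
    also have "\<dots> = N.prob {x. real K \<le> norm x}" by (simp add: spN)
    finally have "(\<integral>x. cut x \<partial>N) < \<rho>" using K by simp
    then have ecut: "\<forall>\<^sub>F i in F. (\<integral>\<omega>. cut (Y i \<omega>) \<partial>M) < \<rho>"
      using order_tendstoD(2)[OF Yconv[OF cut(1,2)]] by blast
    \<comment> \<open>The radius K + 2 holds both points: Y within K + 1, and X within distance 1 of
      Y.\<close>
    have "uniformly_continuous_on (cball 0 (real K + 2)) f"
      using f by (intro compact_uniformly_continuous) (auto intro: continuous_on_subset)
    then have "\<exists>d>0. \<forall>x\<in>cball 0 (real K + 2). \<forall>x'\<in>cball 0 (real K + 2). dist x' x < d \<longrightarrow> dist (f x') (f x) < \<eta> / 4"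
      unfolding uniformly_continuous_on_def using \<eta> by (elim allE[of _ "\<eta> / 4"]) simp
    then obtain \<delta> where \<delta>: "0 < \<delta>" "\<And>x y. x \<in> cball 0 (real K + 2) \<Longrightarrow> y \<in> cball 0 (real K + 2) \<Longrightarrow> dist x y < \<delta> \<Longrightarrow> \<bar>f x - f y\<bar> < \<eta> / 4"
      unfolding dist_real_def by blast
    define d where "d = min \<delta> 1"
    have d: "0 < d" using \<delta> by (simp add: d_def)
    show "\<forall>\<^sub>F i in F. dist ((\<integral>\<omega>. f (X i \<omega>) \<partial>M) - (\<integral>\<omega>. f (Y i \<omega>) \<partial>M)) 0 < \<eta>"
      using ecut close[OF d \<rho>] X Ymeas
    proof eventually_elim
      case (elim i)
      note [measurable] = elim(3,4)
      let ?D = "{\<omega>\<in>space M. d \<le> norm (X i \<omega> - Y i \<omega>)}"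
      have pt: "\<bar>f (X i \<omega>) - f (Y i \<omega>)\<bar> \<le> \<eta> / 4 + 2 * B * cut (Y i \<omega>) + 2 * B * indicator ?D \<omega>" if "\<omega> \<in> space M" for \<omega>
      proof -
        have b: "\<bar>f (X i \<omega>) - f (Y i \<omega>)\<bar> \<le> 2 * B" using B(2)[of "X i \<omega>"] B(2)[of "Y i \<omega>"] by linarith
        have nn: "0 \<le> 2 * B * cut (Y i \<omega>)" "0 \<le> 2 * B * (indicator ?D \<omega> :: real)" using B cut(3) by auto
        consider "\<omega> \<in> ?D" | "real K + 1 \<le> norm (Y i \<omega>)" | "\<omega> \<notin> ?D" "norm (Y i \<omega>) < real K + 1" by linarith
        then show ?thesis
        proof cases
          case 1
          then have "2 * B * (indicator ?D \<omega> :: real) = 2 * B" by simp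
          then show ?thesis using b nn \<eta> by linarith
        next
          case 2
          then have "2 * B * cut (Y i \<omega>) = 2 * B" by (simp add: cut_def)
          then show ?thesis using b nn \<eta> by linarith
        next
          case 3
          then have dd: "norm (X i \<omega> - Y i \<omega>) < d" using that by simp
          have "norm (X i \<omega>) \<le> norm (Y i \<omega>) + norm (X i \<omega> - Y i \<omega>)" by (rule norm_triangle_sub)
          then have "X i \<omega> \<in> cball 0 (real K + 2)" "Y i \<omega> \<in> cball 0 (real K + 2)" using 3 dd by (auto simp: d_def)
          moreover have "dist (X i \<omega>) (Y i \<omega>) < \<delta>" using dd by (simp add: d_def dist_norm)
          ultimately show ?thesis using \<delta>(2) nn by fastforce
        qed
      qed
      have intf: "integrable M (\<lambda>\<omega>. f (X i \<omega>))" "integrable M (\<lambda>\<omega>. f (Y i \<omega>))"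
        using B(2) by (intro integrable_const_bound[of _ B]; simp)+
      have intcut: "integrable M (\<lambda>\<omega>. cut (Y i \<omega>))"
        using cut(3,4) by (intro integrable_const_bound[of _ 1]) auto
      have intD: "integrable M (\<lambda>\<omega>. indicator ?D \<omega> :: real)"
        by (intro integrable_real_indicator) (auto simp: emeasure_eq_measure)
      have "\<bar>(\<integral>\<omega>. f (X i \<omega>) \<partial>M) - (\<integral>\<omega>. f (Y i \<omega>) \<partial>M)\<bar> = \<bar>\<integral>\<omega>. f (X i \<omega>) - f (Y i \<omega>) \<partial>M\<bar>"
        using intf by simp
      also have "\<dots> \<le> (\<integral>\<omega>. \<bar>f (X i \<omega>) - f (Y i \<omega>)\<bar> \<partial>M)" by (rule integral_abs_bound)
      also have "\<dots> \<le> (\<integral>\<omega>. \<eta> / 4 + 2 * B * cut (Y i \<omega>) + 2 * B * indicator ?D \<omega> \<partial>M)"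
        using intf intcut intD pt by (intro integral_mono) auto
      also have "\<dots> = \<eta> / 4 + 2 * B * (\<integral>\<omega>. cut (Y i \<omega>) \<partial>M) + 2 * B * prob ?D"
        using intcut intD by (simp add: prob_space)
      also have "\<dots> < \<eta> / 4 + 2 * B * \<rho> + 2 * B * \<rho>"
        using elim(1,2) B by (intro add_strict_mono add_strict_left_mono mult_strict_left_mono) auto
      also have "\<dots> \<le> \<eta>" using B \<eta> by (simp add: \<rho>_def)
      finally show ?case by (simp add: dist_real_def)
    qed
  qed
  show "((\<lambda>i. \<integral>\<omega>. f (X i \<omega>) \<partial>M) \<longlongrightarrow> (\<integral>x. f x \<partial>N)) F"
    using tendsto_add[OF diff Yconv[of f]] f by simp
qed (rule X)

context renewal_steps
begin

abbreviation "height_sum k \<omega> \<equiv> (\<Sum>i<k. height_noise i \<omega>)"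
abbreviation "area_sum k \<omega> \<equiv> (\<Sum>i<k. area_noise i \<omega>)"
abbreviation "crossings L \<omega> \<equiv> renewal_count (area_steps \<omega>) (height_steps \<omega>) L"
abbreviation "crossed_area L \<omega> \<equiv> renewal_area (area_steps \<omega>) (height_steps \<omega>) L"
abbreviation "base L \<equiv> nat \<lfloor>L / 3 :: real\<rfloor>"

lemma log_time_eq:
  "log_time (area_steps \<omega>) (height_steps \<omega>) k = 3 * real k + height_sum k \<omega>
    + ln (scaled_height (area_steps \<omega>) (height_steps \<omega>) k) - ln (scaled_height (area_steps \<omega>) (height_steps \<omega>) 0)"
proof -
  have "(\<Sum>j=1..k. ln (Z (j, False) \<omega>)) = (\<Sum>i<k. ln (Z (Suc i, False) \<omega>))"
    using sum.atLeast1_atMost_eq[of "\<lambda>j. ln (Z (j, False) \<omega>)" k] by simp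
  moreover have "height_sum k \<omega> = - 2 * (\<Sum>i<k. ln (Z (Suc i, False) \<omega>)) - 3 * real k"
    by (simp add: height_noise_def sum_subtractf sum_distrib_left)
  ultimately show ?thesis by (simp add: log_time_def del: scaled_height.simps)
qed

lemma grid_bounds:
  assumes "0 \<le> L" "0 \<le> \<epsilon>"
  shows "\<bar>real (grid \<epsilon> L j) - real (base L)\<bar> \<le> \<bar>real_of_int j\<bar> * \<epsilon> * sqrt L + 1"
    and "real (grid \<epsilon> L j) \<le> L / 3 + \<bar>real_of_int j\<bar> * \<epsilon> * sqrt L"
proof -
  let ?d = "real_of_int j * \<epsilon> * sqrt L"
  have d: "\<bar>?d\<bar> = \<bar>real_of_int j\<bar> * \<epsilon> * sqrt L" using assms by (simp add: abs_mult)
  have "\<bar>real (nat \<lfloor>L / 3 + ?d\<rfloor>) - real (nat \<lfloor>L / 3\<rfloor>)\<bar> \<le> \<bar>?d\<bar> + 1"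
    using assms(1) by linarith
  then show "\<bar>real (grid \<epsilon> L j) - real (base L)\<bar> \<le> \<bar>real_of_int j\<bar> * \<epsilon> * sqrt L + 1"
    unfolding grid_def d .
  have "real (nat \<lfloor>L / 3 + ?d\<rfloor>) \<le> L / 3 + \<bar>?d\<bar>" using assms(1) by linarith
  then show "real (grid \<epsilon> L j) \<le> L / 3 + \<bar>real_of_int j\<bar> * \<epsilon> * sqrt L" unfolding grid_def d .
qed

text \<open>Three errors of a third each make up the one that \<open>renewal_grid_estimate\<close>
  allows for the time: the increment of the walk and the two logarithms of
  \<open>scaled_height\<close>. The increment of the areas is controlled alongside.\<close>

definition deviation_event :: "real \<Rightarrow> real \<Rightarrow> int \<Rightarrow> 'a set" where
  "deviation_event \<epsilon> L j = {\<omega>\<in>space M. \<epsilon> * sqrt L / 3 \<le> \<bar>height_sum (grid \<epsilon> L j) \<omega> - height_sum (base L) \<omega>\<bar>} \<union>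
    {\<omega>\<in>space M. \<epsilon> * sqrt L / 3 \<le> \<bar>area_sum (grid \<epsilon> L j) \<omega> - area_sum (base L) \<omega>\<bar>} \<union>
    {\<omega>\<in>space M. \<epsilon> * sqrt L / 3 < \<bar>ln (scaled_height (area_steps \<omega>) (height_steps \<omega>) (grid \<epsilon> L j))\<bar>} \<union>
    {\<omega>\<in>space M. \<epsilon> * sqrt L / 3 < \<bar>ln (scaled_height (area_steps \<omega>) (height_steps \<omega>) 0)\<bar>}"

lemma scaled_height_rv [measurable]:
  "(\<lambda>\<omega>. scaled_height (area_steps \<omega>) (height_steps \<omega>) i) \<in> borel_measurable M"
  by (induction i) simp_all

lemma deviation_event_sets [measurable]: "deviation_event \<epsilon> L j \<in> sets M"
  unfolding deviation_event_def by measurable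

lemma deviation_event_bound:
  assumes L: "0 < L" and \<epsilon>: "0 < \<epsilon>"
  shows "prob (deviation_event \<epsilon> L j) \<le> 54 * (\<bar>real_of_int j\<bar> * \<epsilon> * sqrt L + 1) / (\<epsilon> * sqrt L)\<^sup>2 +
    (2 * (L / 3 + \<bar>real_of_int j\<bar> * \<epsilon> * sqrt L + 1) + 2) * exp (- (\<epsilon> * sqrt L / 3)) + 8 * exp (- (\<epsilon> * sqrt L / 3) / 3)"
proof -
  let ?u = "\<epsilon> * sqrt L / 3" and ?k = "grid \<epsilon> L j"
  let ?A = "{\<omega>\<in>space M. ?u \<le> \<bar>height_sum ?k \<omega> - height_sum (base L) \<omega>\<bar>}"
  let ?B = "{\<omega>\<in>space M. ?u \<le> \<bar>area_sum ?k \<omega> - area_sum (base L) \<omega>\<bar>}"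
  let ?C = "\<lambda>k. {\<omega>\<in>space M. ?u < \<bar>ln (scaled_height (area_steps \<omega>) (height_steps \<omega>) k)\<bar>}"
  have u: "0 < ?u" using L \<epsilon> by simp
  note g = grid_bounds[OF less_imp_le[OF L] less_imp_le[OF \<epsilon>], of j]
  have "prob (deviation_event \<epsilon> L j) \<le> prob ?A + prob ?B + prob (?C ?k) + prob (?C 0)"
    unfolding deviation_event_def by (intro order_trans[OF measure_Un_le] add_right_mono) measurable
  also have "prob ?A \<le> 5 * \<bar>real ?k - real (base L)\<bar> / ?u\<^sup>2"
    by (rule indep_sum_deviation[OF indep_height_noise height_noise_moments u])
  also have "prob ?B \<le> 1 * \<bar>real ?k - real (base L)\<bar> / ?u\<^sup>2"
    by (rule indep_sum_deviation[OF indep_area_noise area_noise_moments u])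
  also have "prob (?C ?k) \<le> 2 * (real ?k + 1) * exp (- ?u) + 4 * exp (- ?u / 3)"
    by (rule prob_log_scaled_height[OF u])
  also have "prob (?C 0) \<le> 2 * (real 0 + 1) * exp (- ?u) + 4 * exp (- ?u / 3)"
    by (rule prob_log_scaled_height[OF u])
  also have "5 * \<bar>real ?k - real (base L)\<bar> / ?u\<^sup>2 \<le> 5 * (\<bar>real_of_int j\<bar> * \<epsilon> * sqrt L + 1) / ?u\<^sup>2"
    using g(1) by (intro divide_right_mono mult_left_mono) auto
  also have "1 * \<bar>real ?k - real (base L)\<bar> / ?u\<^sup>2 \<le> 1 * (\<bar>real_of_int j\<bar> * \<epsilon> * sqrt L + 1) / ?u\<^sup>2"
    using g(1) by (intro divide_right_mono mult_left_mono) auto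
  also have "2 * (real ?k + 1) * exp (- ?u) \<le> 2 * (L / 3 + \<bar>real_of_int j\<bar> * \<epsilon> * sqrt L + 1) * exp (- ?u)"
    using g(2) by (intro mult_right_mono mult_left_mono) auto
  finally have bd: "prob (deviation_event \<epsilon> L j) \<le> 5 * (\<bar>real_of_int j\<bar> * \<epsilon> * sqrt L + 1) / ?u\<^sup>2 +
      1 * (\<bar>real_of_int j\<bar> * \<epsilon> * sqrt L + 1) / ?u\<^sup>2 +
      (2 * (L / 3 + \<bar>real_of_int j\<bar> * \<epsilon> * sqrt L + 1) * exp (- ?u) + 4 * exp (- ?u / 3)) +
      (2 * (real 0 + 1) * exp (- ?u) + 4 * exp (- ?u / 3))" by simp
  \<comment> \<open>Dividing by the square of a third multiplies by 9, so the variances 5 and 1 give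
    45 + 9 = 54.\<close>
  define A where "A = (\<bar>real_of_int j\<bar> * \<epsilon> * sqrt L + 1) / (\<epsilon> * sqrt L)\<^sup>2"
  have f: "5 * (\<bar>real_of_int j\<bar> * \<epsilon> * sqrt L + 1) / ?u\<^sup>2 = 45 * A" "1 * (\<bar>real_of_int j\<bar> * \<epsilon> * sqrt L + 1) / ?u\<^sup>2 = 9 * A"
    "54 * (\<bar>real_of_int j\<bar> * \<epsilon> * sqrt L + 1) / (\<epsilon> * sqrt L)\<^sup>2 = 54 * A"
    unfolding A_def power_divide by simp_all
  have "prob (deviation_event \<epsilon> L j) \<le> 45 * A + 9 * A +
      (2 * (L / 3 + \<bar>real_of_int j\<bar> * \<epsilon> * sqrt L + 1) * exp (- ?u) + 4 * exp (- ?u / 3)) +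
      (2 * exp (- ?u) + 4 * exp (- ?u / 3))"
    using bd unfolding f by simp
  also have "\<dots> = 54 * A + (2 * (L / 3 + \<bar>real_of_int j\<bar> * \<epsilon> * sqrt L + 1) + 2) * exp (- ?u) + 8 * exp (- ?u / 3)"
    by (simp add: distrib_right)
  finally show ?thesis unfolding f(3) by simp
qed

text \<open>A grid time differs from L / 3 by order sqrt L, so the increments have standard
  deviation of order L^(1/4), below the allowed order sqrt L; the terms from
  \<open>scaled_height\<close> decay exponentially in sqrt L.\<close>

lemma deviation_event_tendsto:
  assumes \<epsilon>: "0 < \<epsilon>" shows "((\<lambda>L. prob (deviation_event \<epsilon> L j)) \<longlongrightarrow> 0) at_top"
proof (rule tendsto_sandwich[OF _ _ tendsto_const])
  define c where "c = \<bar>real_of_int j\<bar> * \<epsilon>"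
  have c: "0 \<le> c" using \<epsilon> by (simp add: c_def)
  show "\<forall>\<^sub>F L in at_top. prob (deviation_event \<epsilon> L j) \<le> 54 * (c * sqrt L + 1) / (\<epsilon> * sqrt L)\<^sup>2 +
    (2 * (L / 3 + c * sqrt L + 1) + 2) * exp (- (\<epsilon> * sqrt L / 3)) + 8 * exp (- (\<epsilon> * sqrt L / 3) / 3)"
    using eventually_gt_at_top[of 0]
    by eventually_elim (use deviation_event_bound[OF _ \<epsilon>] in \<open>simp add: c_def\<close>)
  show "((\<lambda>L. 54 * (c * sqrt L + 1) / (\<epsilon> * sqrt L)\<^sup>2 +
    (2 * (L / 3 + c * sqrt L + 1) + 2) * exp (- (\<epsilon> * sqrt L / 3)) + 8 * exp (- (\<epsilon> * sqrt L / 3) / 3)) \<longlongrightarrow> 0) at_top"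
    using \<epsilon> by real_asymp
qed simp

lemma renewal_approximation:
  assumes \<epsilon>: "0 < \<epsilon>" and \<rho>: "0 < \<rho>"
  shows "\<forall>\<^sub>F L in at_top. prob {\<omega>\<in>space M. \<not> (\<bar>real (crossings L \<omega>) - L / 3 + height_sum (base L) \<omega> / 3\<bar> \<le> 4 * \<epsilon> * sqrt L \<and>
    \<bar>crossed_area L \<omega> - real (crossings L \<omega>) - area_sum (base L) \<omega>\<bar> \<le> 4 * \<epsilon> * sqrt L)} < \<rho>"
proof -
  \<comment> \<open>With this C, Chebyshev bounds the probability that the walk at the base time
    exceeds C sqrt L by 5 / (3 C^2), that is, \<open>5 * \<rho> / 12\<close>.\<close>
  define C where "C = 2 / sqrt \<rho>"
  have C: "0 < C" "5 / (3 * C\<^sup>2) < \<rho> / 2" using \<rho> by (simp_all add: C_def power_divide field_simps)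
  obtain J :: int where J: "max 0 ((C + 2 + 4 * \<epsilon>) / (3 * \<epsilon>)) < real_of_int J" using ex_less_of_int by blast
  then have J': "0 < J" "C + 2 + 4 * \<epsilon> < 3 * real_of_int J * \<epsilon>" using \<epsilon> by (auto simp: pos_divide_less_eq mult_ac)
  \<comment> \<open>J depends on \<epsilon> and \<rho> but not on L, so a fixed finite number of
    vanishing terms is added.\<close>
  have "((\<lambda>L. \<Sum>j\<in>{-J..J}. prob (deviation_event \<epsilon> L j)) \<longlongrightarrow> (\<Sum>j\<in>{-J..J}. 0)) at_top"
    by (intro tendsto_sum deviation_event_tendsto \<epsilon>)
  then have small: "\<forall>\<^sub>F L in at_top. (\<Sum>j\<in>{-J..J}. prob (deviation_event \<epsilon> L j)) < \<rho> / 2"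
    using order_tendstoD(2)[of _ 0 at_top "\<rho> / 2"] \<rho> by simp
  have "filterlim (\<lambda>L. \<epsilon> * sqrt L) at_top at_top" using \<epsilon> by real_asymp
  then have e1: "\<forall>\<^sub>F L in at_top. 1 \<le> \<epsilon> * sqrt L" by (simp add: filterlim_at_top)
  define JJ where "JJ = real_of_int J * \<epsilon>"
  have "filterlim (\<lambda>L. L / 3 - JJ * sqrt L) at_top at_top" by real_asymp
  then have e2: "\<forall>\<^sub>F L in at_top. 1 \<le> L / 3 - JJ * sqrt L" by (simp add: filterlim_at_top)
  have "filterlim (\<lambda>L::real. sqrt L) at_top at_top" by real_asymp
  then have e3: "\<forall>\<^sub>F L in at_top. (3::real) \<le> sqrt L" by (simp add: filterlim_at_top)
  show ?thesis
    using small e1 e2 e3 eventually_gt_at_top[of "0::real"]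
  proof eventually_elim
    case (elim L)
    let ?bad = "{\<omega>\<in>space M. \<not> (\<bar>real (crossings L \<omega>) - L / 3 + height_sum (base L) \<omega> / 3\<bar> \<le> 4 * \<epsilon> * sqrt L \<and>
      \<bar>crossed_area L \<omega> - real (crossings L \<omega>) - area_sum (base L) \<omega>\<bar> \<le> 4 * \<epsilon> * sqrt L)}"
    let ?U = "{\<omega>\<in>space M. C * sqrt L \<le> \<bar>height_sum (base L) \<omega> - height_sum 0 \<omega>\<bar>}"
    let ?V = "\<Union>j\<in>{-J..J}. deviation_event \<epsilon> L j"
    have "prob ?bad \<le> prob (?U \<union> ?V)"
    proof (rule finite_measure_mono_AE)
      show "AE \<omega> in M. \<omega> \<in> ?bad \<longrightarrow> \<omega> \<in> ?U \<union> ?V"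
        using AE_steps
      proof (eventually_elim, intro impI)
        fix \<omega> assume pos: "\<forall>i. 0 < Z (i, True) \<omega> \<and> 0 < Z (i, False) \<omega> \<and> Z (i, False) \<omega> < 1" and bad: "\<omega> \<in> ?bad"
        show "\<omega> \<in> ?U \<union> ?V"
        proof (rule ccontr)
          assume out: "\<omega> \<notin> ?U \<union> ?V"
          have \<omega>: "\<omega> \<in> space M" using bad by simp
          have S: "\<bar>height_sum (base L) \<omega>\<bar> \<le> C * sqrt L" using out \<omega> by auto
          have dev: "\<bar>height_sum (grid \<epsilon> L j) \<omega> - height_sum (base L) \<omega>\<bar> < \<epsilon> * sqrt L / 3"
            "\<bar>area_sum (grid \<epsilon> L j) \<omega> - area_sum (base L) \<omega>\<bar> < \<epsilon> * sqrt L / 3"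
            "\<bar>ln (scaled_height (area_steps \<omega>) (height_steps \<omega>) (grid \<epsilon> L j))\<bar> \<le> \<epsilon> * sqrt L / 3"
            "\<bar>ln (scaled_height (area_steps \<omega>) (height_steps \<omega>) 0)\<bar> \<le> \<epsilon> * sqrt L / 3" if "- J \<le> j" "j \<le> J" for j
          proof -
            have "\<omega> \<notin> deviation_event \<epsilon> L j" using out that by auto
            then show "\<bar>height_sum (grid \<epsilon> L j) \<omega> - height_sum (base L) \<omega>\<bar> < \<epsilon> * sqrt L / 3"
            "\<bar>area_sum (grid \<epsilon> L j) \<omega> - area_sum (base L) \<omega>\<bar> < \<epsilon> * sqrt L / 3"
            "\<bar>ln (scaled_height (area_steps \<omega>) (height_steps \<omega>) (grid \<epsilon> L j))\<bar> \<le> \<epsilon> * sqrt L / 3"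
            "\<bar>ln (scaled_height (area_steps \<omega>) (height_steps \<omega>) 0)\<bar> \<le> \<epsilon> * sqrt L / 3"
              using \<omega> unfolding deviation_event_def by (simp_all add: not_le not_less del: scaled_height.simps)
          qed
          have "\<bar>real (crossings L \<omega>) - L / 3 + height_sum (base L) \<omega> / 3\<bar> \<le> 4 * \<epsilon> * sqrt L"
            "\<bar>crossed_area L \<omega> - real (crossings L \<omega>) - area_sum (base L) \<omega>\<bar> \<le> 4 * \<epsilon> * sqrt L"
          proof (rule_tac [!] renewal_grid_estimate[where J=J and C=C and H="\<lambda>k. area_sum k \<omega>"])
            show "area_sum k \<omega> = (\<Sum>i=1..k. Z (i, True) \<omega> - 1)" for k
              using sum.atLeast1_atMost_eq[of "\<lambda>j. Z (j, True) \<omega> - 1" k] by (simp add: area_noise_def)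
            then show "area_sum k \<omega> = (\<Sum>i=1..k. Z (i, True) \<omega> - 1)" for k .
            have t: "\<bar>log_time (area_steps \<omega>) (height_steps \<omega>) (grid \<epsilon> L j) - 3 * real (grid \<epsilon> L j) - height_sum (base L) \<omega>\<bar> \<le> \<epsilon> * sqrt L"
              if "- J \<le> j" "j \<le> J" for j
              using dev(1,3,4)[OF that] unfolding log_time_eq abs_le_iff abs_less_iff by (simp del: scaled_height.simps)
            then show "\<bar>log_time (area_steps \<omega>) (height_steps \<omega>) (grid \<epsilon> L j) - 3 * real (grid \<epsilon> L j) - height_sum (base L) \<omega>\<bar> \<le> \<epsilon> * sqrt L"
              if "- J \<le> j" "j \<le> J" for j using that .
            show "\<bar>log_time (area_steps \<omega>) (height_steps \<omega>) (grid \<epsilon> L j) - 3 * real (grid \<epsilon> L j) - height_sum (base L) \<omega>\<bar> \<le> \<epsilon> * sqrt L"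
              if "- J \<le> j" "j \<le> J" for j using t that .
            have h: "\<bar>area_sum (grid \<epsilon> L j) \<omega> - area_sum (base L) \<omega>\<bar> \<le> \<epsilon> * sqrt L" if "- J \<le> j" "j \<le> J" for j
              using dev(2)[OF that] elim(2) by linarith
            then show "\<bar>area_sum (grid \<epsilon> L j) \<omega> - area_sum (base L) \<omega>\<bar> \<le> \<epsilon> * sqrt L" if "- J \<le> j" "j \<le> J" for j using that .
            show "\<bar>area_sum (grid \<epsilon> L j) \<omega> - area_sum (base L) \<omega>\<bar> \<le> \<epsilon> * sqrt L" if "- J \<le> j" "j \<le> J" for j using h that .
          qed (use pos elim J' S \<epsilon> in \<open>auto simp: JJ_def mult.assoc\<close>)
          then show False using bad by simp
        qed
      qed
    qed measurable
    also have "\<dots> \<le> prob ?U + prob ?V" by (intro measure_Un_le) measurable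
    also have "prob ?U \<le> 5 * \<bar>real (base L) - real 0\<bar> / (C * sqrt L)\<^sup>2"
      using C elim by (intro indep_sum_deviation[OF indep_height_noise height_noise_moments]) auto
    also have "5 * \<bar>real (base L) - real 0\<bar> / (C * sqrt L)\<^sup>2 \<le> 5 * (L / 3) / (C * sqrt L)\<^sup>2"
    proof (intro divide_right_mono mult_left_mono)
      show "\<bar>real (base L) - real 0\<bar> \<le> L / 3" using elim(5) of_int_floor_le[of "L / 3"] by simp
    qed auto
    also have "5 * (L / 3) / (C * sqrt L)\<^sup>2 = 5 / (3 * C\<^sup>2)" using C elim(5) by (simp add: power_mult_distrib field_simps)
    also have "5 / (3 * C\<^sup>2) < \<rho> / 2" by (rule C)
    also have "prob ?V \<le> (\<Sum>j\<in>{-J..J}. prob (deviation_event \<epsilon> L j))"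
      by (rule finite_measure_subadditive_finite) auto
    also have "\<dots> < \<rho> / 2" by (rule elim(1))
    finally show ?case by simp
  qed
qed

end

section \<open>The central limit theorem\<close>

text \<open>A linear combination of unit vectors, for which measurability and limits are immediate;
  it agrees with \<open>vector\<close>.\<close>

definition vec2 :: "real \<Rightarrow> real \<Rightarrow> real ^ 2" where
  "vec2 x y = x *\<^sub>R axis 1 1 + y *\<^sub>R axis 2 1"

lemma vec2_nth [simp]: "vec2 x y $ 1 = x" "vec2 x y $ 2 = y"
  by (simp_all add: vec2_def axis_def)

lemma vector_eq_vec2: "(vector [x, y] :: real ^ 2) = vec2 x y"
  by (simp add: vec_eq_iff forall_2)

lemma vec2_measurable [measurable (raw)]:
  "f \<in> borel_measurable N \<Longrightarrow> g \<in> borel_measurable N \<Longrightarrow> (\<lambda>x. vec2 (f x) (g x)) \<in> borel_measurable N"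
  unfolding vec2_def by (intro borel_measurable_add borel_measurable_scaleR borel_measurable_const)

lemma tendsto_vec2: "(f \<longlongrightarrow> x) F \<Longrightarrow> (g \<longlongrightarrow> y) F \<Longrightarrow> ((\<lambda>k. vec2 (f k) (g k)) \<longlongrightarrow> vec2 x y) F"
  unfolding vec2_def by (intro tendsto_intros)

lemma lborel_vec2: "(lborel :: (real ^ 2) measure) = distr (lborel \<Otimes>\<^sub>M lborel) borel (\<lambda>p. vec2 (fst p) (snd p))"
proof (rule lborel_eqI)
  fix l u :: "real ^ 2" assume le: "\<And>b. b \<in> Basis \<Longrightarrow> l \<bullet> b \<le> u \<bullet> b"
  have B: "(Basis :: (real ^ 2) set) = {axis 1 1, axis 2 1}"
    by (auto simp: Basis_vec_def UNIV_2)
  have ne: "(axis 1 1 :: real ^ 2) \<noteq> axis 2 1" by (simp add: axis_eq_axis)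
  have pre: "(\<lambda>p. vec2 (fst p) (snd p)) -` box l u \<inter> space (lborel \<Otimes>\<^sub>M lborel) = {l $ 1<..<u $ 1} \<times> {l $ 2<..<u $ 2}"
    by (auto simp: mem_box_cart forall_2 space_pair_measure)
  have le': "l $ 1 \<le> u $ 1" "l $ 2 \<le> u $ 2"
    using le[of "axis 1 1"] le[of "axis 2 1"] by (simp_all add: B inner_axis)
  have "emeasure (distr (lborel \<Otimes>\<^sub>M lborel) borel (\<lambda>p. vec2 (fst p) (snd p))) (box l u) =
      emeasure (lborel \<Otimes>\<^sub>M lborel) ({l $ 1<..<u $ 1} \<times> {l $ 2<..<u $ 2})"
    by (subst emeasure_distr) (simp_all add: pre)
  also have "\<dots> = ennreal (u $ 1 - l $ 1) * ennreal (u $ 2 - l $ 2)"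
    using le' by (subst lborel.emeasure_pair_measure_Times) auto
  also have "\<dots> = ennreal (\<Prod>b\<in>Basis. (u - l) \<bullet> b)"
    using le' ne by (simp add: B inner_axis ennreal_mult)
  finally show "emeasure (distr (lborel \<Otimes>\<^sub>M lborel) borel (\<lambda>p. vec2 (fst p) (snd p))) (box l u) = ennreal (\<Prod>b\<in>Basis. (u - l) \<bullet> b)" .
qed simp

lemma norming:
  fixes L :: real
  assumes "0 < L" shows "(5 / 27 * L) powr (- 1 / 2) = sqrt (27 / 5 / L)"
  using assms by (simp add: powr_minus powr_half_sqrt real_sqrt_divide real_sqrt_mult field_simps)

abbreviation "limit_covariance \<equiv> (vector [vector [1, 1], vector [1, 14 / 5]] :: real ^ 2 ^ 2)"

lemma limit_covariance_inverse:
  "matrix_inv limit_covariance = vector [vector [14 / 9, - 5 / 9], vector [- 5 / 9, 5 / 9]]" (is "_ = ?B")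
proof -
  have B: "limit_covariance ** ?B = mat 1" "?B ** limit_covariance = mat 1"
    by (simp_all add: vec_eq_iff forall_2 matrix_matrix_mult_def sum_2 mat_def)
  have inv: "limit_covariance ** matrix_inv limit_covariance = mat 1 \<and> matrix_inv limit_covariance ** limit_covariance = mat 1"
    unfolding matrix_inv_def by (rule someI[of _ ?B]) (use B in simp)
  have "matrix_inv limit_covariance = (matrix_inv limit_covariance ** limit_covariance) ** ?B"
    by (simp only: matrix_mul_assoc[symmetric] B matrix_mul_rid)
  also have "\<dots> = ?B"
    using inv by (simp only: matrix_mul_lid)
  finally show ?thesis .
qed

text \<open>Completing the square in the quadratic form shows that the first coordinate is standard
  normal and the difference of the two is independent of it with variance 9/5.\<close>

lemma limit_density:
  "exp (- ((vec2 x y - 0) \<bullet> (matrix_inv limit_covariance *v (vec2 x y - 0))) / 2) /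
     sqrt ((2 * pi) ^ CARD(2) * det limit_covariance) =
   exp (- (x\<^sup>2 + 5 / 9 * (y - x)\<^sup>2) / 2) / (2 * pi * sqrt (9 / 5))"
proof -
  have quad: "(vec2 x y - 0) \<bullet> (matrix_inv limit_covariance *v (vec2 x y - 0)) = x\<^sup>2 + 5 / 9 * (y - x)\<^sup>2"
    unfolding limit_covariance_inverse
    by (simp add: inner_vec_def sum_2 matrix_vector_mult_def power2_eq_square field_simps)
  have det: "det limit_covariance = 9 / 5" by (simp add: det_2)
  have root: "sqrt ((2 * pi)\<^sup>2 * (9 / 5)) = 2 * pi * sqrt (9 / 5)" by (simp only: real_sqrt_mult real_sqrt_abs) simp
  have "CARD(2) = 2" by simp
  then show ?thesis by (simp only: quad det root)
qed

text \<open>With independent standard X and Y the limit is (X, X + sqrt (9/5) Y), the shape in which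
  count and area arise; the entry 14/5 is 1 + 9/5.\<close>

lemma normal_measure_eq_distr:
  "normal_measure 0 limit_covariance =
    distr (std_normal_distribution \<Otimes>\<^sub>M std_normal_distribution) borel (\<lambda>p. vec2 (fst p) (fst p + sqrt (9 / 5) * snd p))"
proof (rule measure_eqI)
  let ?c = "sqrt (9 / 5) :: real"
  define d where "d x y = exp (- (x\<^sup>2 + 5 / 9 * (y - x)\<^sup>2) / 2) / (2 * pi * ?c)" for x y :: real
  define D where "D v = exp (- ((v - 0) \<bullet> (matrix_inv limit_covariance *v (v - 0))) / 2) /
     sqrt ((2 * pi) ^ CARD(2) * det limit_covariance)" for v :: "real ^ 2"
  have Dm [measurable]: "D \<in> borel_measurable borel"
    unfolding D_def
    by (intro borel_measurable_continuous_onI continuous_intros linear_continuous_on linear_conv_bounded_linear[THEN iffD1] matrix_vector_mul_linear)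
      (auto simp: det_2)
  have dm [measurable]: "(\<lambda>p. d (fst p) (snd p)) \<in> borel_measurable (lborel \<Otimes>\<^sub>M lborel)"
    unfolding d_def by measurable
  have Dd: "D (vec2 x y) = d x y" for x y unfolding D_def d_def by (rule limit_density)
  have pair: "std_normal_distribution \<Otimes>\<^sub>M std_normal_distribution =
      density (lborel \<Otimes>\<^sub>M lborel) (\<lambda>(x, y). ennreal (std_normal_density x) * ennreal (std_normal_density y))"
    by (rule pair_measure_density) (auto intro!: lborel.sigma_finite_measure_axioms prob_space_imp_sigma_finite prob_space_normal_density)
  fix A assume "A \<in> sets (normal_measure 0 limit_covariance)"
  then have A [measurable]: "A \<in> sets borel" by (simp add: normal_measure_def)
  have "emeasure (normal_measure 0 limit_covariance) A = (\<integral>\<^sup>+v. ennreal (D v) * indicator A v \<partial>lborel)"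
    unfolding normal_measure_def D_def[symmetric] by (rule emeasure_density) auto
  also have "\<dots> = (\<integral>\<^sup>+p. ennreal (d (fst p) (snd p)) * indicator A (vec2 (fst p) (snd p)) \<partial>(lborel \<Otimes>\<^sub>M lborel))"
    by (subst lborel_vec2, subst nn_integral_distr) (simp_all add: Dd)
  also have "\<dots> = (\<integral>\<^sup>+x. \<integral>\<^sup>+y. ennreal (d x y) * indicator A (vec2 x y) \<partial>lborel \<partial>lborel)"
    by (subst lborel.nn_integral_fst[symmetric]) auto
  also have "\<dots> = (\<integral>\<^sup>+x. \<integral>\<^sup>+y. (ennreal (std_normal_density x) * ennreal (std_normal_density y)) * indicator A (vec2 x (x + ?c * y)) \<partial>lborel \<partial>lborel)"
  proof (rule nn_integral_cong)
    fix x
    have m [measurable]: "(\<lambda>y. ennreal (d x y) * indicator A (vec2 x y)) \<in> borel_measurable borel"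
      unfolding d_def by measurable
    have "(\<integral>\<^sup>+y. ennreal (d x y) * indicator A (vec2 x y) \<partial>lborel) =
        ennreal \<bar>?c\<bar> * (\<integral>\<^sup>+y. ennreal (d x (x + ?c * y)) * indicator A (vec2 x (x + ?c * y)) \<partial>lborel)"
      by (rule nn_integral_real_affine) (use m in simp_all)
    also have "\<dots> = (\<integral>\<^sup>+y. ennreal \<bar>?c\<bar> * (ennreal (d x (x + ?c * y)) * indicator A (vec2 x (x + ?c * y))) \<partial>lborel)"
      by (rule nn_integral_cmult[symmetric]) (unfold d_def, measurable)
    also have "\<dots> = (\<integral>\<^sup>+y. (ennreal (std_normal_density x) * ennreal (std_normal_density y)) * indicator A (vec2 x (x + ?c * y)) \<partial>lborel)"
    proof (rule nn_integral_cong)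
      fix y
      have "?c * d x (x + ?c * y) = std_normal_density x * std_normal_density y"
      proof -
        have sq: "(?c * y)\<^sup>2 = 9 / 5 * y\<^sup>2" by (simp add: power_mult_distrib)
        have "d x (x + ?c * y) = exp (- (x\<^sup>2 + y\<^sup>2) / 2) / (2 * pi * ?c)"
          unfolding d_def by (simp add: sq)
        then have "?c * d x (x + ?c * y) = exp (- (x\<^sup>2 + y\<^sup>2) / 2) / (2 * pi)" by simp
        also have "exp (- (x\<^sup>2 + y\<^sup>2) / 2) = exp (- x\<^sup>2 / 2) * exp (- y\<^sup>2 / 2)"
          by (simp add: exp_add[symmetric] add_divide_distrib[symmetric])
        also have "2 * pi = sqrt (2 * pi) * sqrt (2 * pi)" by simp
        finally show ?thesis unfolding std_normal_density_def by simp
      qed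
      moreover have "0 \<le> d x (x + ?c * y)" by (simp add: d_def)
      ultimately have "ennreal \<bar>?c\<bar> * ennreal (d x (x + ?c * y)) = ennreal (std_normal_density x) * ennreal (std_normal_density y)"
        by (simp add: ennreal_mult[symmetric])
      then show "ennreal \<bar>?c\<bar> * (ennreal (d x (x + ?c * y)) * indicator A (vec2 x (x + ?c * y))) =
          (ennreal (std_normal_density x) * ennreal (std_normal_density y)) * indicator A (vec2 x (x + ?c * y))"
        by (simp only: mult.assoc[symmetric])
    qed
    finally show "(\<integral>\<^sup>+y. ennreal (d x y) * indicator A (vec2 x y) \<partial>lborel) =
      (\<integral>\<^sup>+y. (ennreal (std_normal_density x) * ennreal (std_normal_density y)) * indicator A (vec2 x (x + ?c * y)) \<partial>lborel)" .
  qed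
  also have "\<dots> = (\<integral>\<^sup>+p. (ennreal (std_normal_density (fst p)) * ennreal (std_normal_density (snd p))) *
      indicator A (vec2 (fst p) (fst p + ?c * snd p)) \<partial>(lborel \<Otimes>\<^sub>M lborel))"
    by (subst lborel.nn_integral_fst[symmetric]) auto
  also have "\<dots> = (\<integral>\<^sup>+p. indicator A (vec2 (fst p) (fst p + ?c * snd p)) \<partial>(std_normal_distribution \<Otimes>\<^sub>M std_normal_distribution))"
    unfolding pair by (subst nn_integral_density) (auto simp: case_prod_unfold)
  also have "\<dots> = emeasure (distr (std_normal_distribution \<Otimes>\<^sub>M std_normal_distribution) borel (\<lambda>p. vec2 (fst p) (fst p + ?c * snd p))) A"
  proof -
    let ?S = "std_normal_distribution \<Otimes>\<^sub>M std_normal_distribution" and ?h = "\<lambda>p. vec2 (fst p) (fst p + ?c * snd p)"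
    have "(\<integral>\<^sup>+p. indicator A (?h p) \<partial>?S) = (\<integral>\<^sup>+v. indicator A v \<partial>distr ?S borel ?h)"
      by (rule nn_integral_distr[symmetric]) auto
    then show ?thesis by simp
  qed
  finally show "emeasure (normal_measure 0 limit_covariance) A =
    emeasure (distr (std_normal_distribution \<Otimes>\<^sub>M std_normal_distribution) borel (\<lambda>p. vec2 (fst p) (fst p + ?c * snd p))) A" .
qed (simp add: normal_measure_def)

lemma prob_space_limit: "prob_space (normal_measure 0 limit_covariance)"
proof -
  interpret std: prob_space std_normal_distribution by (rule prob_space_normal_density) simp
  interpret pair_prob_space std_normal_distribution std_normal_distribution ..
  show ?thesis unfolding normal_measure_eq_distr by (rule prob_space_distr) measurable
qed

context renewal_steps
begin

lemma distr_Z_Suc: "distr M borel (Z (Suc i, b)) = distr M borel (Z (Suc 0, b))"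
proof -
  have "height_density (Suc i) = height_density (Suc 0)" by (simp add: fun_eq_iff height_density_def)
  then show ?thesis by (cases b) (simp_all add: law step_law_def)
qed

text \<open>The sign is reversed because large steps of the walk lower the count.\<close>

lemma height_clt:
  "weak_conv_m (\<lambda>n. distr M borel (\<lambda>\<omega>. (\<Sum>i<n. - height_noise i \<omega>) / sqrt (real n * (sqrt 5)\<^sup>2))) std_normal_distribution"
proof (rule central_limit_theorem_zero_mean)
  show "indep_vars (\<lambda>_. borel) (\<lambda>i \<omega>. - height_noise i \<omega>) UNIV"
    by (rule indep_vars_compose2[OF indep_height_noise]) simp
  show "expectation (\<lambda>\<omega>. - height_noise n \<omega>) = 0" "integrable M (\<lambda>\<omega>. (- height_noise n \<omega>)\<^sup>2)"
    "variance (\<lambda>\<omega>. - height_noise n \<omega>) = (sqrt 5)\<^sup>2" for n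
    using height_noise_moments[of n] by simp_all
  show "distr M borel (\<lambda>\<omega>. - height_noise n \<omega>) = distr M borel (\<lambda>\<omega>. - height_noise 0 \<omega>)" for n
  proof -
    have "distr M borel (\<lambda>\<omega>. - height_noise n \<omega>) = distr (distr M borel (Z (Suc n, False))) borel (\<lambda>x. - (- 2 * ln x - 3))" for n
      by (subst distr_distr) (auto simp: height_noise_def comp_def)
    then show ?thesis by (simp only: distr_Z_Suc[of n])
  qed
qed simp

lemma area_clt:
  "weak_conv_m (\<lambda>n. distr M borel (\<lambda>\<omega>. area_sum n \<omega> / sqrt (real n * 1\<^sup>2))) std_normal_distribution"
proof (rule central_limit_theorem_zero_mean)
  show "expectation (area_noise n) = 0" "integrable M (\<lambda>\<omega>. (area_noise n \<omega>)\<^sup>2)"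
    "variance (area_noise n) = 1\<^sup>2" for n
    using area_noise_moments[of n] by simp_all
  show "distr M borel (area_noise n) = distr M borel (area_noise 0)" for n
  proof -
    have "distr M borel (area_noise n) = distr (distr M borel (Z (Suc n, True))) borel (\<lambda>x. x - 1)" for n
      by (subst distr_distr) (auto simp: area_noise_def[abs_def] comp_def)
    then show ?thesis by (simp only: distr_Z_Suc[of n])
  qed
qed (simp_all add: indep_area_noise)

lemma indep_sums: "indep_var borel (height_sum n) borel (area_sum n)"
proof -
  let ?A = "(\<lambda>i::nat. (Suc i, False)) ` {..<n}" and ?B = "(\<lambda>i::nat. (Suc i, True)) ` {..<n}"
  have iv: "indep_var (PiM ?A (\<lambda>_. borel)) (\<lambda>\<omega>. restrict (\<lambda>j. Z j \<omega>) ?A) (PiM ?B (\<lambda>_. borel)) (\<lambda>\<omega>. restrict (\<lambda>j. Z j \<omega>) ?B)"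
    by (rule indep_var_restrict[OF indep]) auto
  have m: "(\<lambda>w. \<Sum>i<n. - 2 * ln (w (Suc i, False)) - 3 :: real) \<in> borel_measurable (PiM ?A (\<lambda>_. borel))"
    "(\<lambda>w. \<Sum>i<n. w (Suc i, True) - 1 :: real) \<in> borel_measurable (PiM ?B (\<lambda>_. borel))"
    by (auto intro!: borel_measurable_sum borel_measurable_diff borel_measurable_times borel_measurable_ln measurable_component_singleton)
  have "height_sum n = (\<lambda>w. \<Sum>i<n. - 2 * ln (w (Suc i, False)) - 3) \<circ> (\<lambda>\<omega>. restrict (\<lambda>j. Z j \<omega>) ?A)"
    "area_sum n = (\<lambda>w. \<Sum>i<n. w (Suc i, True) - 1) \<circ> (\<lambda>\<omega>. restrict (\<lambda>j. Z j \<omega>) ?B)"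
    by (auto simp: fun_eq_iff height_noise_def area_noise_def intro!: sum.cong)
  then show ?thesis using indep_var_compose[OF iv m] by simp
qed

definition main_term :: "real \<Rightarrow> 'a \<Rightarrow> real ^ 2" where
  "main_term L \<omega> = (5 / 27 * L) powr (- 1 / 2) *\<^sub>R
     vec2 (- height_sum (base L) \<omega> / 3) (- height_sum (base L) \<omega> / 3 + area_sum (base L) \<omega>)"

lemma main_term_measurable [measurable]: "main_term L \<in> borel_measurable M"
  unfolding main_term_def by measurable

lemma main_term_converges: "converges_in_distribution M main_term (normal_measure 0 limit_covariance) at_top"
  unfolding converges_in_distribution_def
proof (intro conjI allI impI)
  show "\<forall>\<^sub>F L in at_top. main_term L \<in> borel_measurable M" by simp
  fix f :: "real ^ 2 \<Rightarrow> real"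
  assume f: "continuous_on UNIV f \<and> bounded (range f)"
  then obtain B where B: "\<And>x. \<bar>f x\<bar> \<le> B" by (auto simp: bounded_iff)
  have fm [measurable]: "f \<in> borel_measurable borel" using f by (intro borel_measurable_continuous_onI) simp
  define U where "U n \<omega> = (\<Sum>i<n. - height_noise i \<omega>) / sqrt (real n * (sqrt 5)\<^sup>2)" for n \<omega>
  define W where "W n \<omega> = area_sum n \<omega> / sqrt (real n * 1\<^sup>2)" for n \<omega>
  have [measurable]: "U n \<in> borel_measurable M" "W n \<in> borel_measurable M" for n
    unfolding U_def[abs_def] W_def[abs_def] by measurable
  have rdU: "real_distribution (distr M borel (U n))" and rdW: "real_distribution (distr M borel (W n))" for n
    by (rule real_distribution_distr, simp)+
  have rd: "real_distribution std_normal_distribution" by (rule real_dist_normal_dist)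
  text \<open>Skorohod representations of both coordinates on a product space replace a bivariate central limit theorem.\<close>
  obtain \<Omega>1 :: "real measure" and u u' where u: "prob_space \<Omega>1" "\<And>n::nat. u n \<in> measurable \<Omega>1 borel"
    "\<And>n. distr \<Omega>1 borel (u n) = distr M borel (U n)" "u' \<in> measurable \<Omega>1 lborel"
    "distr \<Omega>1 borel u' = std_normal_distribution" "\<And>x. x \<in> space \<Omega>1 \<Longrightarrow> (\<lambda>n. u n x) \<longlonglongrightarrow> u' x"
    using Skorohod[OF rdU rd height_clt[folded U_def]] by blast
  obtain \<Omega>2 :: "real measure" and w w' where w: "prob_space \<Omega>2" "\<And>n::nat. w n \<in> measurable \<Omega>2 borel"
    "\<And>n. distr \<Omega>2 borel (w n) = distr M borel (W n)" "w' \<in> measurable \<Omega>2 lborel"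
    "distr \<Omega>2 borel w' = std_normal_distribution" "\<And>x. x \<in> space \<Omega>2 \<Longrightarrow> (\<lambda>n. w n x) \<longlonglongrightarrow> w' x"
    using Skorohod[OF rdW rd area_clt[folded W_def]] by blast
  interpret O1: prob_space \<Omega>1 by (rule u)
  interpret O2: prob_space \<Omega>2 by (rule w)
  interpret O: pair_prob_space \<Omega>1 \<Omega>2 ..
  note [measurable] = u(2) w(2)
  have u'm [measurable]: "u' \<in> borel_measurable \<Omega>1" and w'm [measurable]: "w' \<in> borel_measurable \<Omega>2"
    using u(4) w(4) by simp_all
  \<comment> \<open>The arguments p and q stand for the factors that turn the two standardised sums
    into the normalised main term.\<close>
  define g where "g p q z = f (vec2 (p * fst z) (p * fst z + q * snd z))" for p q :: real and z :: "real \<times> real"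
  have gm [measurable]: "g p q \<in> borel_measurable (borel \<Otimes>\<^sub>M borel)" for p q
    unfolding g_def by measurable
  have indUW: "indep_var borel (U n) borel (W n)" for n
  proof -
    have "U n = (\<lambda>x. - x / sqrt (real n * (sqrt 5)\<^sup>2)) \<circ> height_sum n" "W n = (\<lambda>x. x / sqrt (real n * 1\<^sup>2)) \<circ> area_sum n"
      by (auto simp: U_def W_def fun_eq_iff sum_negf)
    then show ?thesis using indep_var_compose[OF indep_sums[of n], of "\<lambda>x. - x / sqrt (real n * (sqrt 5)\<^sup>2)" borel "\<lambda>x. x / sqrt (real n * 1\<^sup>2)" borel]
      by simp
  qed
  \<comment> \<open>By independence the pair of standardised sums has a product law, which is also
    the law of the pair of representations on the product space.\<close>
  have transfer: "(\<integral>\<omega>. g p q (U n \<omega>, W n \<omega>) \<partial>M) = (\<integral>z. g p q (u n (fst z), w n (snd z)) \<partial>(\<Omega>1 \<Otimes>\<^sub>M \<Omega>2))" for p q n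
  proof -
    have sf: "sigma_finite_measure (distr \<Omega>2 borel (w n))"
      by (intro prob_space_imp_sigma_finite O2.prob_space_distr) simp
    have "(\<integral>\<omega>. g p q (U n \<omega>, W n \<omega>) \<partial>M) = (\<integral>z. g p q z \<partial>distr M (borel \<Otimes>\<^sub>M borel) (\<lambda>\<omega>. (U n \<omega>, W n \<omega>)))"
      by (rule integral_distr[symmetric]) auto
    also have "distr M (borel \<Otimes>\<^sub>M borel) (\<lambda>\<omega>. (U n \<omega>, W n \<omega>)) = distr M borel (U n) \<Otimes>\<^sub>M distr M borel (W n)"
      using indUW[of n] by (simp add: indep_var_distribution_eq)
    also have "\<dots> = distr (\<Omega>1 \<Otimes>\<^sub>M \<Omega>2) (borel \<Otimes>\<^sub>M borel) (\<lambda>(x, y). (u n x, w n y))"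
      unfolding u(3)[symmetric] w(3)[symmetric] by (rule pair_measure_distr[OF u(2) w(2) sf])
    also have "(\<integral>z. g p q z \<partial>\<dots>) = (\<integral>z. g p q (u n (fst z), w n (snd z)) \<partial>(\<Omega>1 \<Otimes>\<^sub>M \<Omega>2))"
      by (subst integral_distr) (auto simp: case_prod_unfold)
    finally show ?thesis .
  qed
  let ?c = "sqrt (9 / 5) :: real"
  have limit: "(\<integral>z. g 1 ?c (u' (fst z), w' (snd z)) \<partial>(\<Omega>1 \<Otimes>\<^sub>M \<Omega>2)) = (\<integral>x. f x \<partial>normal_measure 0 limit_covariance)"
  proof -
    have sf: "sigma_finite_measure (distr \<Omega>2 borel w')"
      by (intro prob_space_imp_sigma_finite O2.prob_space_distr) simp
    have "(\<integral>x. f x \<partial>normal_measure 0 limit_covariance) = (\<integral>z. g 1 ?c z \<partial>(distr \<Omega>1 borel u' \<Otimes>\<^sub>M distr \<Omega>2 borel w'))"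
      unfolding normal_measure_eq_distr u(5) w(5) by (subst integral_distr) (auto simp: g_def[abs_def])
    also have "distr \<Omega>1 borel u' \<Otimes>\<^sub>M distr \<Omega>2 borel w' = distr (\<Omega>1 \<Otimes>\<^sub>M \<Omega>2) (borel \<Otimes>\<^sub>M borel) (\<lambda>(x, y). (u' x, w' y))"
      by (rule pair_measure_distr[OF u'm w'm sf])
    also have "(\<integral>z. g 1 ?c z \<partial>\<dots>) = (\<integral>z. g 1 ?c (u' (fst z), w' (snd z)) \<partial>(\<Omega>1 \<Otimes>\<^sub>M \<Omega>2))"
      by (subst integral_distr) (auto simp: case_prod_unfold)
    finally show ?thesis by simp
  qed
  \<comment> \<open>With about L / 3 steps of variances 5 and 1, the factors tend to sqrt (27/5 *
    5/3) / 3 = 1 and to sqrt (27/5 * 1/3) = sqrt (9/5).\<close>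
  define p where "p L = (5 / 27 * L) powr (- 1 / 2) * sqrt (5 * real (base L)) / 3" for L
  define q where "q L = (5 / 27 * L) powr (- 1 / 2) * sqrt (real (base L))" for L
  have base_lim: "((\<lambda>L. real (base L) / L) \<longlongrightarrow> 1 / 3) at_top"
  proof (rule tendsto_sandwich)
    show "\<forall>\<^sub>F L in at_top. (L / 3 - 1) / L \<le> real (base L) / L"
      using eventually_gt_at_top[of 0] by eventually_elim (intro divide_right_mono, linarith+)
    show "\<forall>\<^sub>F L in at_top. real (base L) / L \<le> 1 / 3"
      using eventually_gt_at_top[of 0]
    proof eventually_elim
      case (elim L)
      then have "real (base L) \<le> L / 3" by linarith
      then show ?case using elim by (simp add: field_simps)
    qed
    show "((\<lambda>L::real. (L / 3 - 1) / L) \<longlongrightarrow> 1 / 3) at_top" by real_asymp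
  qed simp
  have p_lim: "(p \<longlongrightarrow> 1) at_top"
  proof -
    have "((\<lambda>L. sqrt (27 * (real (base L) / L)) / 3) \<longlongrightarrow> sqrt (27 * (1 / 3)) / 3) at_top"
      by (intro tendsto_intros base_lim) simp
    moreover have "\<forall>\<^sub>F L in at_top. sqrt (27 * (real (base L) / L)) / 3 = p L"
      using eventually_gt_at_top[of 0]
    proof eventually_elim
      case (elim L)
      have "p L = sqrt (27 / 5 / L * (5 * real (base L))) / 3" unfolding p_def norming[OF elim] real_sqrt_mult by simp
      also have "27 / 5 / L * (5 * real (base L)) = 27 * (real (base L) / L)" by simp
      finally show ?case by simp
    qed
    moreover have "sqrt (27 * (1 / 3)) / 3 = (1::real)" by (simp add: real_sqrt_eq_iff[of _ "9", simplified])
    ultimately show ?thesis by (simp add: tendsto_cong)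
  qed
  have q_lim: "(q \<longlongrightarrow> ?c) at_top"
  proof -
    have "((\<lambda>L. sqrt (27 / 5 * (real (base L) / L))) \<longlongrightarrow> sqrt (27 / 5 * (1 / 3))) at_top"
      by (intro tendsto_intros base_lim)
    moreover have "\<forall>\<^sub>F L in at_top. sqrt (27 / 5 * (real (base L) / L)) = q L"
      using eventually_gt_at_top[of 0]
    proof eventually_elim
      case (elim L)
      have "q L = sqrt (27 / 5 / L * real (base L))" unfolding q_def norming[OF elim] real_sqrt_mult by simp
      also have "27 / 5 / L * real (base L) = 27 / 5 * (real (base L) / L)" by simp
      finally show ?case by simp
    qed
    ultimately show ?thesis by (simp add: tendsto_cong)
  qed
  have base_top: "filterlim base at_top at_top"
    by (intro filterlim_compose[OF filterlim_nat_sequentially] filterlim_compose[OF filterlim_floor_sequentially]) real_asymp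
  have eq: "(\<integral>\<omega>. f (main_term L \<omega>) \<partial>M) = (\<integral>z. g (p L) (q L) (u (base L) (fst z), w (base L) (snd z)) \<partial>(\<Omega>1 \<Otimes>\<^sub>M \<Omega>2))"
    if "0 < base L" for L
  proof -
    have n: "0 < sqrt (real (base L))" using that by simp
    have 1: "sqrt (5 * real (base L)) * U (base L) \<omega> = - height_sum (base L) \<omega>" for \<omega>
      using n by (simp add: U_def sum_negf mult.commute)
    have 2: "sqrt (real (base L)) * W (base L) \<omega> = area_sum (base L) \<omega>" for \<omega>
      using n by (simp add: W_def)
    have "p L * U (base L) \<omega> = (5 / 27 * L) powr (- 1 / 2) * (sqrt (5 * real (base L)) * U (base L) \<omega>) / 3"
      "q L * W (base L) \<omega> = (5 / 27 * L) powr (- 1 / 2) * (sqrt (real (base L)) * W (base L) \<omega>)" for \<omega>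
      by (simp_all add: p_def q_def)
    then have "f (main_term L \<omega>) = g (p L) (q L) (U (base L) \<omega>, W (base L) \<omega>)" for \<omega>
      unfolding 1 2 g_def main_term_def by (simp add: vec2_def scaleR_add_right algebra_simps)
    then show ?thesis using transfer[of "p L" "q L" "base L"] by simp
  qed
  show "((\<lambda>L. \<integral>\<omega>. f (main_term L \<omega>) \<partial>M) \<longlongrightarrow> (\<integral>x. f x \<partial>normal_measure 0 limit_covariance)) at_top"
  proof (rule tendsto_at_topI_sequentially)
    \<comment> \<open>Dominated convergence is applied along an arbitrary sequence tending to
      infinity.\<close>
    fix X :: "nat \<Rightarrow> real" assume X: "filterlim X at_top sequentially"
    have bX: "filterlim (\<lambda>k. base (X k)) at_top sequentially" by (rule filterlim_compose[OF base_top X])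
    have "(\<lambda>k. \<integral>z. g (p (X k)) (q (X k)) (u (base (X k)) (fst z), w (base (X k)) (snd z)) \<partial>(\<Omega>1 \<Otimes>\<^sub>M \<Omega>2)) \<longlonglongrightarrow>
        (\<integral>z. g 1 ?c (u' (fst z), w' (snd z)) \<partial>(\<Omega>1 \<Otimes>\<^sub>M \<Omega>2))"
    proof (rule integral_dominated_convergence[where w="\<lambda>_. B"])
      show "AE z in \<Omega>1 \<Otimes>\<^sub>M \<Omega>2. (\<lambda>k. g (p (X k)) (q (X k)) (u (base (X k)) (fst z), w (base (X k)) (snd z))) \<longlonglongrightarrow> g 1 ?c (u' (fst z), w' (snd z))"
      proof (rule AE_I2)
        fix z assume z: "z \<in> space (\<Omega>1 \<Otimes>\<^sub>M \<Omega>2)"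
        then have s: "fst z \<in> space \<Omega>1" "snd z \<in> space \<Omega>2" by (auto simp: space_pair_measure)
        have lu: "(\<lambda>k. u (base (X k)) (fst z)) \<longlonglongrightarrow> u' (fst z)" "(\<lambda>k. w (base (X k)) (snd z)) \<longlonglongrightarrow> w' (snd z)"
          by (rule filterlim_compose[OF u(6)[OF s(1)] bX], rule filterlim_compose[OF w(6)[OF s(2)] bX])
        have lp: "(\<lambda>k. p (X k)) \<longlonglongrightarrow> 1" "(\<lambda>k. q (X k)) \<longlonglongrightarrow> ?c"
          by (rule filterlim_compose[OF p_lim X], rule filterlim_compose[OF q_lim X])
        have "(\<lambda>k. vec2 (p (X k) * u (base (X k)) (fst z)) (p (X k) * u (base (X k)) (fst z) + q (X k) * w (base (X k)) (snd z)))
            \<longlonglongrightarrow> vec2 (1 * u' (fst z)) (1 * u' (fst z) + ?c * w' (snd z))"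
          by (intro tendsto_vec2 tendsto_add tendsto_mult lu lp)
        then show "(\<lambda>k. g (p (X k)) (q (X k)) (u (base (X k)) (fst z), w (base (X k)) (snd z))) \<longlonglongrightarrow> g 1 ?c (u' (fst z), w' (snd z))"
          unfolding g_def fst_conv snd_conv using f by (intro continuous_on_tendsto_compose[of UNIV f]) auto
      qed
      show "AE z in \<Omega>1 \<Otimes>\<^sub>M \<Omega>2. norm (g (p (X k)) (q (X k)) (u (base (X k)) (fst z), w (base (X k)) (snd z))) \<le> B" for k
        using B by (simp add: g_def)
    qed (simp_all add: O.finite_measure_axioms)
    moreover have "\<forall>\<^sub>F k in sequentially. (\<integral>z. g (p (X k)) (q (X k)) (u (base (X k)) (fst z), w (base (X k)) (snd z)) \<partial>(\<Omega>1 \<Otimes>\<^sub>M \<Omega>2)) = (\<integral>\<omega>. f (main_term (X k) \<omega>) \<partial>M)"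
      using eventually_compose_filterlim[OF eventually_gt_at_top[of 0] bX] by eventually_elim (simp add: eq)
    ultimately show "(\<lambda>k. \<integral>\<omega>. f (main_term (X k) \<omega>) \<partial>M) \<longlonglongrightarrow> (\<integral>x. f x \<partial>normal_measure 0 limit_covariance)"
      unfolding limit by (simp add: tendsto_cong)
  qed
qed

end

text \<open>As a function of the step sequence alone, its law depends only on the joint law of the
  steps.\<close>

definition limit_stat :: "real \<Rightarrow> (nat \<times> bool \<Rightarrow> real) \<Rightarrow> real ^ 2" where
  "limit_stat L z = (5 / 27 * L) powr (- 1 / 2) *\<^sub>R
     vec2 (real (renewal_count (\<lambda>i. z (i, True)) (\<lambda>i. z (i, False)) L) - 1 / 3 * L)
       (renewal_area (\<lambda>i. z (i, True)) (\<lambda>i. z (i, False)) L - 1 / 3 * L)"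

lemma limit_stat_measurable [measurable]: "limit_stat L \<in> borel_measurable (PiM UNIV (\<lambda>_. borel))"
  unfolding limit_stat_def by measurable

lemma norm_vec2_le: "norm (vec2 x y) \<le> \<bar>x\<bar> + \<bar>y\<bar>"
  using norm_le_l1_cart[of "vec2 x y"] by (simp add: sum_2)

lemma norming_le:
  assumes "0 < L" shows "(5 / 27 * L) powr (- 1 / 2) * sqrt L \<le> 3"
proof -
  have "(5 / 27 * L) powr (- 1 / 2) * sqrt L = sqrt (27 / 5 / L * L)" by (simp only: norming[OF assms] real_sqrt_mult)
  also have "27 / 5 / L * L = 27 / 5" using assms by simp
  also have "sqrt (27 / 5) \<le> 3" by (rule real_le_lsqrt) auto
  finally show ?thesis .
qed

lemma (in renewal_steps) limit_stat_converges:
  "converges_in_distribution M (\<lambda>L \<omega>. limit_stat L (\<lambda>j. Z j \<omega>)) (normal_measure 0 limit_covariance) at_top"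
proof (rule converges_in_distribution_close[OF main_term_converges prob_space_limit])
  show "sets (normal_measure 0 limit_covariance) = sets borel" by (simp add: normal_measure_def)
  show "\<forall>\<^sub>F L in at_top. (\<lambda>\<omega>. limit_stat L (\<lambda>j. Z j \<omega>)) \<in> borel_measurable M"
    by (intro always_eventually allI measurable_compose[OF Z_seq_measurable limit_stat_measurable])
  fix \<delta> \<rho> :: real
  assume \<delta>: "0 < \<delta>" and \<rho>: "0 < \<rho>"
  \<comment> \<open>The count errs by 4 and the area by 8 times \<open>\<epsilon> * sqrt L\<close>,
    and the norming factor is at most 3 / sqrt L; so 36 times \<epsilon> has to stay below
    \<delta>.\<close>
  define \<epsilon> where "\<epsilon> = \<delta> / 37"
  have \<epsilon>: "0 < \<epsilon>" "36 * \<epsilon> < \<delta>" using \<delta> by (simp_all add: \<epsilon>_def)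
  show "\<forall>\<^sub>F L in at_top. prob {\<omega>\<in>space M. \<delta> \<le> norm (limit_stat L (\<lambda>j. Z j \<omega>) - main_term L \<omega>)} < \<rho>"
    using renewal_approximation[OF \<epsilon>(1) \<rho>] eventually_gt_at_top[of 0]
  proof eventually_elim
    case (elim L)
    let ?c = "(5 / 27 * L) powr (- 1 / 2)"
    have "norm (limit_stat L (\<lambda>j. Z j \<omega>) - main_term L \<omega>) < \<delta>"
      if r: "\<bar>real (crossings L \<omega>) - L / 3 + height_sum (base L) \<omega> / 3\<bar> \<le> 4 * \<epsilon> * sqrt L"
        "\<bar>crossed_area L \<omega> - real (crossings L \<omega>) - area_sum (base L) \<omega>\<bar> \<le> 4 * \<epsilon> * sqrt L" for \<omega>
    proof -
      define r1 where "r1 = real (crossings L \<omega>) - L / 3 + height_sum (base L) \<omega> / 3"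
      define r2 where "r2 = crossed_area L \<omega> - real (crossings L \<omega>) - area_sum (base L) \<omega>"
      have "limit_stat L (\<lambda>j. Z j \<omega>) - main_term L \<omega> = ?c *\<^sub>R vec2 r1 (r1 + r2)"
        by (simp add: limit_stat_def main_term_def vec_eq_iff forall_2 r1_def r2_def algebra_simps)
      then have "norm (limit_stat L (\<lambda>j. Z j \<omega>) - main_term L \<omega>) \<le> ?c * (\<bar>r1\<bar> + \<bar>r1 + r2\<bar>)"
        by (simp add: mult_left_mono[OF norm_vec2_le])
      also have "\<dots> \<le> ?c * (12 * \<epsilon> * sqrt L)"
        using r by (intro mult_left_mono) (auto simp: r1_def[symmetric] r2_def[symmetric])
      also have "\<dots> = 12 * \<epsilon> * (?c * sqrt L)" by simp
      also have "\<dots> \<le> 12 * \<epsilon> * 3" using \<epsilon> norming_le[OF elim(2)] by (intro mult_left_mono) auto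
      also have "\<dots> < \<delta>" using \<epsilon> by simp
      finally show ?thesis .
    qed
    then have "prob {\<omega>\<in>space M. \<delta> \<le> norm (limit_stat L (\<lambda>j. Z j \<omega>) - main_term L \<omega>)} \<le>
      prob {\<omega>\<in>space M. \<not> (\<bar>real (crossings L \<omega>) - L / 3 + height_sum (base L) \<omega> / 3\<bar> \<le> 4 * \<epsilon> * sqrt L \<and>
        \<bar>crossed_area L \<omega> - real (crossings L \<omega>) - area_sum (base L) \<omega>\<bar> \<le> 4 * \<epsilon> * sqrt L)}"
      by (intro finite_measure_mono subsetI) (force simp: not_less[symmetric], measurable)
    then show ?case using elim(1) by linarith
  qed
qed

section \<open>Transfer to the Poisson process\<close>

lemma eventually_ratio_to_infinity: "\<forall>\<^sub>F x in ratio_to_infinity. 0 < fst x \<and> fst x < snd x"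
  unfolding ratio_to_infinity_def by (simp add: eventually_inf_principal case_prod_unfold)

lemma ln_ratio_at_top: "filterlim (\<lambda>x. ln (snd x / fst x)) at_top ratio_to_infinity"
proof -
  have "filterlim (\<lambda>(a, b). b / a :: real) at_top (filtercomap (\<lambda>(a, b). b / a) at_top)" by (rule filterlim_filtercomap)
  then have "filterlim (\<lambda>(a, b). b / a :: real) at_top ratio_to_infinity"
    unfolding ratio_to_infinity_def by (rule filterlim_mono) auto
  from filterlim_compose[OF ln_at_top this] show ?thesis by (simp add: case_prod_unfold)
qed

lemma norming_tendsto_0: "((\<lambda>L::real. (5 / 27 * L) powr (- 1 / 2)) \<longlongrightarrow> 0) at_top"
  by real_asymp

context quadrant_poisson
begin

lemma renewal_steps_step_rv: "0 < a \<Longrightarrow> renewal_steps M (step_rv a)"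
  by (intro renewal_steps.intro prob_space_axioms renewal_steps_axioms.intro indep_step_rv distr_step_rv)

lemma distr_step_sequence:
  assumes "0 < a"
  shows "distr M (PiM UNIV (\<lambda>_. borel)) (\<lambda>\<omega> j. step_rv a j \<omega>) = PiM UNIV step_law"
  using indep_step_rv[OF assms] step_rv_measurable[OF assms]
  by (subst (asm) indep_vars_iff_distr_eq_PiM) (simp_all add: distr_step_rv[OF assms] restrict_UNIV)

lemma step_sequence_measurable:
  assumes "0 < a" shows "(\<lambda>\<omega> j. step_rv a j \<omega>) \<in> measurable M (PiM UNIV (\<lambda>_. borel))"
  by (rule renewal_steps.Z_seq_measurable[OF renewal_steps_step_rv[OF assms]])

text \<open>The step sequence has the same law for every initial parameter, so each expectation may
  be computed with initial parameter 1.\<close>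

lemma step_stat_converges:
  "converges_in_distribution M (\<lambda>x \<omega>. limit_stat (ln (snd x / fst x)) (\<lambda>j. step_rv (fst x) j \<omega>))
     (normal_measure 0 limit_covariance) ratio_to_infinity"
  unfolding converges_in_distribution_def
proof (intro conjI allI impI)
  show "\<forall>\<^sub>F x in ratio_to_infinity. (\<lambda>\<omega>. limit_stat (ln (snd x / fst x)) (\<lambda>j. step_rv (fst x) j \<omega>)) \<in> borel_measurable M"
    using eventually_ratio_to_infinity
    by eventually_elim (auto intro: measurable_compose[OF step_sequence_measurable limit_stat_measurable])
  fix f :: "real ^ 2 \<Rightarrow> real"
  assume f: "continuous_on UNIV f \<and> bounded (range f)"
  have fm [measurable]: "f \<in> borel_measurable borel" using f by (intro borel_measurable_continuous_onI) simp
  have law: "(\<integral>\<omega>. f (limit_stat L (\<lambda>j. step_rv a j \<omega>)) \<partial>M) = (\<integral>z. f (limit_stat L z) \<partial>PiM UNIV step_law)" if "0 < a" for a L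
    unfolding distr_step_sequence[OF that, symmetric]
    by (rule integral_distr[symmetric]) (use step_sequence_measurable[OF that] in measurable)
  interpret one: renewal_steps M "step_rv 1" by (rule renewal_steps_step_rv) simp
  have "((\<lambda>L. \<integral>\<omega>. f (limit_stat L (\<lambda>j. step_rv 1 j \<omega>)) \<partial>M) \<longlongrightarrow> (\<integral>x. f x \<partial>normal_measure 0 limit_covariance)) at_top"
    using one.limit_stat_converges f unfolding converges_in_distribution_def by blast
  then have "((\<lambda>x. \<integral>\<omega>. f (limit_stat (ln (snd x / fst x)) (\<lambda>j. step_rv 1 j \<omega>)) \<partial>M) \<longlongrightarrow>
      (\<integral>x. f x \<partial>normal_measure 0 limit_covariance)) ratio_to_infinity"
    by (rule filterlim_compose[OF _ ln_ratio_at_top])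
  moreover have "\<forall>\<^sub>F x in ratio_to_infinity. (\<integral>\<omega>. f (limit_stat (ln (snd x / fst x)) (\<lambda>j. step_rv 1 j \<omega>)) \<partial>M) =
      (\<integral>\<omega>. f (limit_stat (ln (snd x / fst x)) (\<lambda>j. step_rv (fst x) j \<omega>)) \<partial>M)"
    using eventually_ratio_to_infinity by eventually_elim (simp add: law)
  ultimately show "((\<lambda>x. \<integral>\<omega>. f (limit_stat (ln (snd x / fst x)) (\<lambda>j. step_rv (fst x) j \<omega>)) \<partial>M) \<longlongrightarrow>
      (\<integral>x. f x \<partial>normal_measure 0 limit_covariance)) ratio_to_infinity"
    by (rule Lim_transform_eventually)
qed

text \<open>On the logarithmic scale relative to a, the jumps up to b are the crossings up to the
  level ln (b / a).\<close>

lemma limit_stat_step_rv: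
  assumes \<omega>: "\<omega> \<in> nice_set" and a: "0 < a" and ab: "a < b"
  shows "limit_stat (ln (b / a)) (\<lambda>j. step_rv a j \<omega>) = (5 / 27 * ln (b / a)) powr (- 1 / 2) *\<^sub>R
    vec2 (real (jump_count (P \<omega>) a b) - 1 / 3 * ln (b / a)) (triangles_area (P \<omega>) a b - 1 / 3 * ln (b / a))"
proof -
  interpret nonstop_config "P \<omega>" by (rule nonstop[OF \<omega>])
  define w where "w = hull_chain (P \<omega>) a"
  have w: "chain_rv a \<omega> = w" using \<omega> by (auto simp: chain_rv_def w_def)
  have e: "(\<lambda>i. step_rv a (i, True) \<omega>) = area_coord a w" and t: "(\<lambda>i. step_rv a (i, False) \<omega>) = height_coord a w"
    by (simp_all add: step_rv_def w fun_eq_iff)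
  have "log_time (area_coord a w) (height_coord a w) i = ln (jump_seq (P \<omega>) a i) - ln a" for i
    using ln_slope_eq[OF hull_chain_in_hull_chains[OF a, of i] a order_refl]
    unfolding log_time_def w_def slope_hull_chain[OF a] by simp
  moreover have "ln (jump_seq (P \<omega>) a i) - ln a \<le> ln (b / a) \<longleftrightarrow> jump_seq (P \<omega>) a i \<le> b" for i
    using jump_seq_pos[OF a, of i] a ab by (simp add: ln_div)
  ultimately have count: "renewal_count (area_coord a w) (height_coord a w) (ln (b / a)) = jump_count (P \<omega>) a b"
    by (simp add: renewal_count_def jump_count_def)
  then have "renewal_area (area_coord a w) (height_coord a w) (ln (b / a)) = triangles_area (P \<omega>) a b"
    by (simp add: renewal_area_def triangles_area_eq[OF a] w_def)
  then show ?thesis by (simp add: limit_stat_def e t count)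
qed

lemma hull_statistics_converge:
  "converges_in_distribution M
     (\<lambda>(a, b) \<omega>. (5 / 27 * ln (b / a)) powr (- 1 / 2) *\<^sub>R
        vec2 (real (num_jumps (P \<omega>) a b) - 1 / 3 * ln (b / a)) (triangles_area (P \<omega>) a b - 1 / 3 * ln (b / a)))
     (normal_measure 0 limit_covariance) ratio_to_infinity" (is "converges_in_distribution M ?X _ _")
proof (rule converges_in_distribution_close[OF step_stat_converges prob_space_limit])
  show "sets (normal_measure 0 limit_covariance) = sets borel" by (simp add: normal_measure_def)
  show "\<forall>\<^sub>F x in ratio_to_infinity. ?X x \<in> borel_measurable M"
    using eventually_ratio_to_infinity
  proof eventually_elim
    case (elim x)
    then have [measurable]: "(\<lambda>\<omega>. real (num_jumps (P \<omega>) (fst x) (snd x))) \<in> borel_measurable M"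
      "(\<lambda>\<omega>. triangles_area (P \<omega>) (fst x) (snd x)) \<in> borel_measurable M"
      by (auto intro: num_jumps_measurable triangles_area_measurable)
    show ?case unfolding case_prod_unfold by measurable
  qed
  fix \<delta> \<rho> :: real
  assume \<delta>: "0 < \<delta>" and \<rho>: "0 < \<rho>"
  let ?Y = "\<lambda>x \<omega>. limit_stat (ln (snd x / fst x)) (\<lambda>j. step_rv (fst x) j \<omega>)"
  have "\<forall>\<^sub>F x in ratio_to_infinity. (5 / 27 * ln (snd x / fst x)) powr (- 1 / 2) < \<delta>"
    using order_tendstoD(2)[OF filterlim_compose[OF norming_tendsto_0 ln_ratio_at_top] \<delta>] .
  then show "\<forall>\<^sub>F x in ratio_to_infinity. prob {\<omega>\<in>space M. \<delta> \<le> norm (?X x \<omega> - ?Y x \<omega>)} < \<rho>"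
    using eventually_ratio_to_infinity
  proof eventually_elim
    case (elim x)
    obtain a b where x: "x = (a, b)" by (cases x)
    let ?c = "(5 / 27 * ln (b / a)) powr (- 1 / 2)"
    let ?A = "{\<omega>\<in>space M. \<delta> \<le> norm (?X x \<omega> - ?Y x \<omega>)}"
    have ab: "0 < a" "a < b" using elim x by auto
    have "norm (?X x \<omega> - ?Y x \<omega>) < \<delta>" if \<omega>: "\<omega> \<in> nice_set" for \<omega>
    proof -
      interpret nonstop_config "P \<omega>" by (rule nonstop[OF \<omega>])
      \<comment> \<open>A jump at a itself is the only discrepancy from the walk; it moves the
        normalised vector by at most the norming factor, which tends to 0.\<close>
      define k :: real where "k = (if a \<in> jump_times (P \<omega>) \<and> a \<le> b then 1 else 0)"
      have n: "real (num_jumps (P \<omega>) a b) = real (jump_count (P \<omega>) a b) + k"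
        unfolding num_jumps_eq[OF ab(1)] k_def by simp
      have "?X x \<omega> - ?Y x \<omega> = ?c *\<^sub>R vec2 k 0"
        unfolding x fst_conv snd_conv prod.case limit_stat_step_rv[OF \<omega> ab] n
        by (simp add: vec_eq_iff forall_2 algebra_simps)
      then have "norm (?X x \<omega> - ?Y x \<omega>) \<le> ?c * (\<bar>k\<bar> + \<bar>0\<bar>)" by (simp only: norm_scaleR) (intro mult_mono norm_vec2_le; simp)
      also have "\<dots> \<le> ?c * 1" by (intro mult_left_mono) (auto simp: k_def)
      finally show ?thesis using elim(1) x by simp
    qed
    then have "AE \<omega> in M. \<omega> \<notin> ?A" using AE_nice by (auto elim!: eventually_mono simp: not_less[symmetric])
    \<comment> \<open>For a set outside the sigma-algebra \<open>measure\<close> is 0 by convention,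
      so both cases give 0.\<close>
    then have "prob ?A = 0" by (cases "?A \<in> events") (simp_all add: prob_eq_0 measure_notin_sets)
    then show ?case using \<rho> by simp
  qed
qed

end

theorem theorem3p1:
  fixes M :: "'w measure" and P :: "'w \<Rightarrow> (real \<times> real) set"
  assumes "prob_space M"
    and "unit_poisson_process M first_quadrant P"
  shows "converges_in_distribution M
           (\<lambda>(a, b) \<omega>. (5 / 27 * ln (b / a)) powr (- 1 / 2) *\<^sub>R
              (vector [real (num_jumps (P \<omega>) a b) - 1 / 3 * ln (b / a),
                       triangles_area (P \<omega>) a b - 1 / 3 * ln (b / a)] :: real ^ 2))
           (normal_measure 0 (vector [vector [1, 1], vector [1, 14 / 5]] :: real ^ 2 ^ 2))
           ratio_to_infinity"
proof -
  interpret quadrant_poisson M P by (intro quadrant_poisson.intro quadrant_poisson_axioms.intro assms)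
  show ?thesis using hull_statistics_converge unfolding vector_eq_vec2 .
qed

end
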